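(* For each $\nu\in\mathcal M(G,\omega)$, the functional $I_\nu(\psi)=\int\psi\,d\nu$ is an element of $C_0(G,\omega^{-1})^*$ and $\|I_\nu\|=\|\nu\|_\omega$; moreover $$C_0(G,\omega^{-1})^*=\{I_\nu:\nu\in\mathcal M(G,\omega)\}.$$ Thus $\mathcal M(G,\omega)$ is identified with $C_0(G,\omega^{-1})^*$ through the pairing $\langle\nu,\psi\rangle_\omega=\int\psi\,d\nu$ $(\nu\in\mathcal M(G,\omega),\ \psi\in C_0(G,\omega^{-1}))$. With respect to this identification (and the identification $\mathcal M_r(G)=C_0(G)^*$ through $\langle\mu,\phi\rangle=\int\phi\,d\mu$), the mutually inverse isometric isomorphisms $$\mathcal M(G,\omega)\to\mathcal M_r(G):\nu\mapsto\omega\nu\quad\text{and}\quad\mathcal M_r(G)\to\mathcal M(G,\omega):\mu\mapsto\tfrac1\omega\mu$$ are weak$^*$-homeomorphisms.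
   Context: $G$ is a locally compact group with identity $e_G$, and $\omega:G\to(0,\infty)$ is a continuous weight: $\omega(st)\le\omega(s)\omega(t)$ for $s,t\in G$, and $\omega(e_G)=1$. Function spaces: $C_0(G)$ is the space of continuous functions on $G$ vanishing at infinity with the uniform norm. $C_0(G,\omega^{-1})=\{\psi:\psi/\omega\in C_0(G)\}$ with norm $\|\psi\|_{\infty,\omega^{-1}}=\|\psi/\omega\|_\infty$. Measures: $\mathfrak S(G)$ is the $\delta$-ring of all Borel subsets of $G$ with compact closure. A complex compacted-Borel measure is a countably additive function $\mu:\mathfrak S(G)\to\mathbb C$; $|\mu|$ is its total variation (finite on $\mathfrak S(G)$). $\mu$ is regular if $|\mu|(A)=\sup\{|\mu|(C):C\subseteq A,\ C\text{ compact}\}$ for all $A\in\mathfrak S(G)$. $\mathcal M(G)$ is the space of all regular complex compacted-Borel measures, and $\mathcal M_r(G)$ is the Banach space of bounded ones, with $\|\mu\|=\sup\{|\mu|(A):A\in\mathfrak S(G)\}<\infty$. Integration against a complex measure $\mu$ on a $\delta$-ring $\mathfrak S$: for each $A\in\mathfrak S$, $\mu$ restricts to an ordinary complex measure on the $\sigma$-algebra $\{B\in\mathfrak S:B\subseteq A\}$ of subsets of $A$. A function $f$ is locally $\mu$-measurable if $f|_A$ is measurable for the $|\mu|$-completion of this $\sigma$-algebra for every $A\in\mathfrak S$. $\mathcal L^1(\mu)$ consists of the locally $\mu$-measurable complex functions $f$ which vanish off a countable union $\bigcup_nA_n$ of an increasing sequence of sets in $\mathfrak S$ and satisfy $\lim_n\int_{A_n}|f|\,d|\mu|<\infty$;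 then $\int f\,d\mu=\lim_n\int_{A_n}f\,d\mu$. (For $\mathfrak S=\mathfrak S(G)$, functions in $\mathcal L^1(\mu)$ must therefore vanish off a $\sigma$-compact set.) For a continuous function $h$ on $G$ and $\nu\in\mathcal M(G)$, $h\nu\in\mathcal M(G)$ is defined by $(h\nu)(A)=\int h\chi_A\,d\nu$ for $A\in\mathfrak S(G)$. Define $\mathcal M(G,\omega)=\{\nu\in\mathcal M(G):\omega\nu\in\mathcal M_r(G)\}$ with norm $\|\nu\|_\omega=\|\omega\nu\|$. *)

theory Defs
  imports "HOL-Analysis.Analysis"
begin

section \<open>Weights and function spaces\<close>

text \<open>
  The group is written additively: the library's (not necessarily commutative) topological groups
  are the type class \<^class>\<open>topological_group_add\<close>. So $st$ is \<open>s + t\<close> and the identity is \<open>0\<close>.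
\<close>

definition weight :: "('g::topological_group_add \<Rightarrow> real) \<Rightarrow> bool" where
  "weight \<omega> \<longleftrightarrow>
     continuous_on UNIV \<omega> \<and> (\<forall>s. 0 < \<omega> s) \<and> (\<forall>s t. \<omega> (s + t) \<le> \<omega> s * \<omega> t) \<and> \<omega> 0 = 1"

definition C0 :: "('g::topological_space \<Rightarrow> complex) set" where
  "C0 = {\<phi>. continuous_on UNIV \<phi> \<and> (\<forall>\<epsilon>>0. \<exists>K. compact K \<and> (\<forall>x. x \<notin> K \<longrightarrow> cmod (\<phi> x) < \<epsilon>))}"

definition sup_norm :: "('g \<Rightarrow> complex) \<Rightarrow> real" where
  "sup_norm \<phi> = (SUP x. cmod (\<phi> x))"

definition C0_weighted :: "('g::topological_space \<Rightarrow> real) \<Rightarrow> ('g \<Rightarrow> complex) set" where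
  "C0_weighted \<omega> = {\<psi>. (\<lambda>x. \<psi> x / of_real (\<omega> x)) \<in> C0}"

definition sup_norm_weighted :: "('g \<Rightarrow> real) \<Rightarrow> ('g \<Rightarrow> complex) \<Rightarrow> real" where
  "sup_norm_weighted \<omega> \<psi> = sup_norm (\<lambda>x. \<psi> x / of_real (\<omega> x))"

section \<open>Dual spaces and isometric isomorphisms\<close>

text \<open>
  A map that mathematically is only defined on a set \<open>D\<close> is encoded as an element of
  \<^term>\<open>extensional D\<close>, so that equality of encodings is equality of maps on \<open>D\<close>. Spaces of such maps
  carry the pointwise operations, restricted to \<open>D\<close>.
\<close>

definition function_space :: "'x set \<Rightarrow> ('x \<Rightarrow> complex) set \<Rightarrow> bool" where
  "function_space D E \<longleftrightarrow>
     E \<subseteq> extensional D \<and> (\<lambda>x\<in>D. 0) \<in> E \<and>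
     (\<forall>f\<in>E. \<forall>g\<in>E. (\<lambda>x\<in>D. f x + g x) \<in> E) \<and>
     (\<forall>c. \<forall>f\<in>E. (\<lambda>x\<in>D. c * f x) \<in> E)"

definition isometric_isomorphism ::
  "'x set \<Rightarrow> ('x \<Rightarrow> complex) set \<Rightarrow> (('x \<Rightarrow> complex) \<Rightarrow> real) \<Rightarrow>
   'y set \<Rightarrow> ('y \<Rightarrow> complex) set \<Rightarrow> (('y \<Rightarrow> complex) \<Rightarrow> real) \<Rightarrow>
   (('x \<Rightarrow> complex) \<Rightarrow> ('y \<Rightarrow> complex)) \<Rightarrow> bool" where
  "isometric_isomorphism D E N D' E' N' T \<longleftrightarrow>
     function_space D E \<and> function_space D' E' \<and> bij_betw T E E' \<and>
     (\<forall>f\<in>E. \<forall>g\<in>E. T (\<lambda>x\<in>D. f x + g x) = (\<lambda>y\<in>D'. T f y + T g y)) \<and>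
     (\<forall>c. \<forall>f\<in>E. T (\<lambda>x\<in>D. c * f x) = (\<lambda>y\<in>D'. c * T f y)) \<and>
     (\<forall>f\<in>E. N' (T f) = N f)"

definition dual ::
  "('g \<Rightarrow> complex) set \<Rightarrow> (('g \<Rightarrow> complex) \<Rightarrow> real) \<Rightarrow> (('g \<Rightarrow> complex) \<Rightarrow> complex) set" where
  "dual V N = {F \<in> extensional V.
     (\<forall>f\<in>V. \<forall>g\<in>V. F (\<lambda>x. f x + g x) = F f + F g) \<and>
     (\<forall>c. \<forall>f\<in>V. F (\<lambda>x. c * f x) = c * F f) \<and>
     (\<exists>B. \<forall>f\<in>V. cmod (F f) \<le> B * N f)}"

definition dual_norm ::
  "('g \<Rightarrow> complex) set \<Rightarrow> (('g \<Rightarrow> complex) \<Rightarrow> real) \<Rightarrow> (('g \<Rightarrow> complex) \<Rightarrow> complex) \<Rightarrow> real" where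
  "dual_norm V N F = (SUP f\<in>{f \<in> V. N f \<le> 1}. cmod (F f))"

text \<open>The topology of pointwise convergence on \<open>V\<close>.\<close>

definition weak_star ::
  "('g \<Rightarrow> complex) set \<Rightarrow> (('g \<Rightarrow> complex) \<Rightarrow> real) \<Rightarrow> (('g \<Rightarrow> complex) \<Rightarrow> complex) topology" where
  "weak_star V N = subtopology (product_topology (\<lambda>_. euclidean) V) (dual V N)"

section \<open>Complex compacted-Borel measures\<close>

definition compacted_borel :: "'g::topological_space set set" where
  "compacted_borel = {A \<in> sets borel. compact (closure A)}"

definition complex_cb_measure :: "('g::topological_space set \<Rightarrow> complex) \<Rightarrow> bool" where
  "complex_cb_measure \<mu> \<longleftrightarrow>
     \<mu> \<in> extensional compacted_borel \<and>
     (\<forall>A :: nat \<Rightarrow> 'g set. range A \<subseteq> compacted_borel \<longrightarrow> disjoint_family A \<longrightarrow>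
        (\<Union>n. A n) \<in> compacted_borel \<longrightarrow> (\<lambda>n. \<mu> (A n)) sums \<mu> (\<Union>n. A n))"

definition variation :: "('g::topological_space set \<Rightarrow> complex) \<Rightarrow> 'g set \<Rightarrow> ennreal" where
  "variation \<mu> A =
     (SUP P\<in>{P. finite P \<and> P \<subseteq> compacted_borel \<and> disjoint P \<and> \<Union>P = A}.
        \<Sum>B\<in>P. ennreal (cmod (\<mu> B)))"

definition regular_measures :: "('g::topological_space set \<Rightarrow> complex) set" where
  "regular_measures = {\<mu>. complex_cb_measure \<mu> \<and>
     (\<forall>A\<in>compacted_borel. variation \<mu> A = (SUP C\<in>{C. compact C \<and> C \<subseteq> A}. variation \<mu> C))}"

definition total_variation :: "('g::topological_space set \<Rightarrow> complex) \<Rightarrow> ennreal" where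
  "total_variation \<mu> = (SUP A\<in>compacted_borel. variation \<mu> A)"

definition bounded_regular_measures :: "('g::topological_space set \<Rightarrow> complex) set" where
  "bounded_regular_measures = {\<mu> \<in> regular_measures. total_variation \<mu> < \<infinity>}"

definition measure_norm :: "('g::topological_space set \<Rightarrow> complex) \<Rightarrow> real" where
  "measure_norm \<mu> = enn2real (total_variation \<mu>)"

section \<open>Integration\<close>

text \<open>
  The completed measure on the \<open>\<sigma>\<close>-algebra of all members of \<^term>\<open>compacted_borel\<close> contained in \<open>A\<close>,
  for a countably additive \<open>\<tau>\<close>.
\<close>

definition complete_on ::
  "'g::topological_space set \<Rightarrow> ('g set \<Rightarrow> ennreal) \<Rightarrow> 'g measure" where
  "complete_on A \<tau> = completion (measure_of A {B \<in> compacted_borel. B \<subseteq> A} \<tau>)"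

text \<open>
  The positive part in the Jordan decomposition of a signed measure \<open>\<sigma>\<close>; the negative part is that
  of \<open>-\<sigma>\<close>. (\<^const>\<open>ennreal\<close> sends negative numbers to 0, which is attained anyway at the empty set.)
\<close>

definition positive_part :: "('g::topological_space set \<Rightarrow> real) \<Rightarrow> 'g set \<Rightarrow> ennreal" where
  "positive_part \<sigma> B = (SUP C\<in>{C \<in> compacted_borel. C \<subseteq> B}. ennreal (\<sigma> C))"

text \<open>
  The integral over a set \<open>A\<close> in \<^term>\<open>compacted_borel\<close> with respect to the ordinary complex measure
  induced by \<open>\<mu>\<close> on \<open>A\<close>. A function which is measurable for the completion with respect to
  \<^term>\<open>variation \<mu>\<close> is measurable for the four completions used here, since the four
  Jordan parts are dominated by \<^term>\<open>variation \<mu>\<close>.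
\<close>

definition cb_integral_on ::
  "('g::topological_space set \<Rightarrow> complex) \<Rightarrow> 'g set \<Rightarrow> ('g \<Rightarrow> complex) \<Rightarrow> complex" where
  "cb_integral_on \<mu> A f =
     ((LINT x|complete_on A (positive_part (\<lambda>B. Re (\<mu> B))). f x)
      - (LINT x|complete_on A (positive_part (\<lambda>B. - Re (\<mu> B))). f x))
     + \<i> * ((LINT x|complete_on A (positive_part (\<lambda>B. Im (\<mu> B))). f x)
      - (LINT x|complete_on A (positive_part (\<lambda>B. - Im (\<mu> B))). f x))"

definition locally_measurable ::
  "('g::topological_space set \<Rightarrow> complex) \<Rightarrow> ('g \<Rightarrow> complex) \<Rightarrow> bool" where
  "locally_measurable \<mu> f \<longleftrightarrow>
     (\<forall>A\<in>compacted_borel. f \<in> borel_measurable (complete_on A (variation \<mu>)))"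

definition L1_exhaustion ::
  "('g::topological_space set \<Rightarrow> complex) \<Rightarrow> ('g \<Rightarrow> complex) \<Rightarrow> (nat \<Rightarrow> 'g set) \<Rightarrow> bool" where
  "L1_exhaustion \<mu> f A \<longleftrightarrow>
     incseq A \<and> range A \<subseteq> compacted_borel \<and> (\<forall>x. x \<notin> (\<Union>n. A n) \<longrightarrow> f x = 0) \<and>
     (\<exists>L<\<infinity>. (\<lambda>n. \<integral>\<^sup>+x. ennreal (cmod (f x)) \<partial>complete_on (A n) (variation \<mu>)) \<longlonglongrightarrow> L)"

definition L1 :: "('g::topological_space set \<Rightarrow> complex) \<Rightarrow> ('g \<Rightarrow> complex) set" where
  "L1 \<mu> = {f. locally_measurable \<mu> f \<and> (\<exists>A. L1_exhaustion \<mu> f A)}"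

text \<open>For \<open>f\<close> in \<^term>\<open>L1 \<mu>\<close> the limit exists and does not depend on the exhaustion.\<close>

definition cb_integral ::
  "('g::topological_space set \<Rightarrow> complex) \<Rightarrow> ('g \<Rightarrow> complex) \<Rightarrow> complex" where
  "cb_integral \<mu> f =
     (THE I. \<exists>A. L1_exhaustion \<mu> f A \<and> (\<lambda>n. cb_integral_on \<mu> (A n) f) \<longlonglongrightarrow> I)"

definition density_measure ::
  "('g::topological_space \<Rightarrow> complex) \<Rightarrow> ('g set \<Rightarrow> complex) \<Rightarrow> ('g set \<Rightarrow> complex)" where
  "density_measure h \<nu> = (\<lambda>A\<in>compacted_borel. cb_integral \<nu> (\<lambda>x. h x * indicator A x))"

section \<open>Weighted measures and the pairing\<close>

definition weighted_measures :: "('g::topological_space \<Rightarrow> real) \<Rightarrow> ('g set \<Rightarrow> complex) set" where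
  "weighted_measures \<omega> = {\<nu> \<in> regular_measures.
     density_measure (\<lambda>x. of_real (\<omega> x)) \<nu> \<in> bounded_regular_measures}"

definition weighted_measure_norm ::
  "('g::topological_space \<Rightarrow> real) \<Rightarrow> ('g set \<Rightarrow> complex) \<Rightarrow> real" where
  "weighted_measure_norm \<omega> \<nu> = measure_norm (density_measure (\<lambda>x. of_real (\<omega> x)) \<nu>)"

definition integral_functional ::
  "('g::topological_space \<Rightarrow> complex) set \<Rightarrow> ('g set \<Rightarrow> complex) \<Rightarrow> (('g \<Rightarrow> complex) \<Rightarrow> complex)" where
  "integral_functional V \<nu> = (\<lambda>\<psi>\<in>V. cb_integral \<nu> \<psi>)"

text \<open>
  The weak* topology transported to a space \<open>E\<close> of measures along the identification of \<open>E\<close>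
  with \<^term>\<open>dual V N\<close> given by integration.
\<close>

definition measures_weak_star ::
  "('g::topological_space \<Rightarrow> complex) set \<Rightarrow> (('g \<Rightarrow> complex) \<Rightarrow> real) \<Rightarrow>
   ('g set \<Rightarrow> complex) set \<Rightarrow> ('g set \<Rightarrow> complex) topology" where
  "measures_weak_star V N E = pullback_topology E (integral_functional V) (weak_star V N)"

end

(*
  The group structure plays no role: only local compactness is used. On each compact set a complex
  compacted-Borel measure has finite variation, so its four Jordan parts and its variation extend to
  Borel measures on the whole space, and integration against it becomes the complex combination of
  the four integrals. Every identity or estimate for these combinations follows from its values on
  compacted Borel sets.

  The unweighted case is the Riesz representation theorem. A bounded functional on C0 splits into
  four positive ones, u+(f) = sup {u g | 0 <= g <= f} and u- = u+ - u for its real and imaginary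
  parts, and a positive functional yields an outer measure to which Caratheodory's theorem applies.
  The norm is computed by testing against continuous functions that nearly realise the variation
  over a finite partition. The weighted case is transported along psi |-> psi / omega, since
  the integral of psi against nu is that of psi / omega against omega nu.
*)

theory Submission
  imports Defs
begin

text \<open>The integral is defined through the Jordan parts of a single measure, and these parts
  are not additive in the measure. Linearity in \<nu>, densities and the Riesz measures of a
  functional would each call for a comparison of Jordan parts. The relation
  \<open>represents\<close> avoids this: any finite complex combination of positive measures with
  the right values on compacted Borel sets computes the same integral, so each construction may keep
  the combination in which it arises.

  The obstacle in the weighted case is that a member \<nu> of \<open>weighted_measures\<close> can
  have infinite total variation, so its integrals over functions in \<open>C0_weighted\<close> are
  not obviously finite. The estimate |(1/\<omega>)\<mu>| \<le> (1/\<omega>)|\<mu>| for \<mu> =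
  \<omega>\<nu> supplies the integrability. The space may also fail to be \<sigma>-compact; a
  function vanishing at infinity still lives on the countable union of the compact superlevel sets
  of its modulus, as the support condition in \<open>L1\<close> demands.\<close>

section \<open>The \<delta>-ring of compacted Borel sets\<close>

lemma cb_sets: "A \<in> compacted_borel \<Longrightarrow> A \<in> sets borel"
  by (simp add: compacted_borel_def)

lemma compact_in_cb: "compact K \<Longrightarrow> K \<in> compacted_borel" for K :: "'g::t2_space set"
  by (simp add: compacted_borel_def compact_imp_closed borel_closed closure_closed)

lemma cb_subset:
  assumes "A \<in> compacted_borel" "B \<in> sets borel" "B \<subseteq> A"
  shows "B \<in> compacted_borel"
proof -
  have "closure A \<inter> closure B = closure B"
    using closure_mono[OF assms(3)] by auto
  moreover have "compact (closure A \<inter> closure B)"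
    using assms(1) by (intro compact_Int_closed) (auto simp: compacted_borel_def)
  ultimately show ?thesis
    using assms(2) by (simp add: compacted_borel_def)
qed

lemma cb_empty [simp]: "{} \<in> compacted_borel"
  by (simp add: compacted_borel_def)

lemma cb_Un: "A \<in> compacted_borel \<Longrightarrow> B \<in> compacted_borel \<Longrightarrow> A \<union> B \<in> compacted_borel"
  by (auto simp: compacted_borel_def compact_Un)

lemma cb_UN: "finite I \<Longrightarrow> (\<And>i. i \<in> I \<Longrightarrow> A i \<in> compacted_borel) \<Longrightarrow> (\<Union>i\<in>I. A i) \<in> compacted_borel"
  by (induction I rule: finite_induct) (auto intro: cb_Un)

lemma cb_Int: "A \<in> compacted_borel \<Longrightarrow> B \<in> sets borel \<Longrightarrow> A \<inter> B \<in> compacted_borel"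
  by (rule cb_subset[of A]) (auto simp: cb_sets)

lemma cb_Int2: "A \<in> sets borel \<Longrightarrow> B \<in> compacted_borel \<Longrightarrow> A \<inter> B \<in> compacted_borel"
  by (rule cb_subset[of B]) (auto simp: cb_sets)

lemma cb_Diff: "A \<in> compacted_borel \<Longrightarrow> B \<in> sets borel \<Longrightarrow> A - B \<in> compacted_borel"
  by (rule cb_subset[of A]) (auto simp: cb_sets)

text \<open>Recognising the members inside \<open>A\<close> as a trace of the Borel \<sigma>-algebra
  makes the measures in \<open>complete_on\<close> comparable with restrictions of Borel
  measures.\<close>

lemma cb_restrict_space:
  "A \<in> compacted_borel \<Longrightarrow> {B \<in> compacted_borel. B \<subseteq> A} = sets (restrict_space borel A)"
  by (auto simp: sets_restrict_space cb_sets image_iff intro: cb_Int)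

lemma cb_sigma_algebra: "A \<in> compacted_borel \<Longrightarrow> sigma_algebra A {B \<in> compacted_borel. B \<subseteq> A}"
  unfolding cb_restrict_space
  using sets.sigma_algebra_axioms[of "restrict_space borel A"] by (simp add: space_restrict_space)

section \<open>Countably additive functions on compacted Borel sets\<close>

text \<open>The empty set needs a clause of its own: the constant function \<infinity> satisfies the
  additivity clause.\<close>

definition cb_premeasure :: "('g::topological_space set \<Rightarrow> ennreal) \<Rightarrow> bool" where
  "cb_premeasure \<tau> \<longleftrightarrow> \<tau> {} = 0 \<and>
     (\<forall>A. range A \<subseteq> compacted_borel \<longrightarrow> disjoint_family A \<longrightarrow> (\<Union>n. A n) \<in> compacted_borel \<longrightarrow>
        (\<Sum>n. \<tau> (A n)) = \<tau> (\<Union>n. A n))"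

lemma cb_premeasureD:
  assumes "cb_premeasure \<tau>"
  shows "\<tau> {} = 0"
    and "\<And>A. range A \<subseteq> compacted_borel \<Longrightarrow> disjoint_family A \<Longrightarrow> (\<Union>n. A n) \<in> compacted_borel \<Longrightarrow>
        (\<Sum>n. \<tau> (A n)) = \<tau> (\<Union>n. A n)"
  using assms by (auto simp: cb_premeasure_def)

lemma cb_premeasure_Un:
  assumes \<tau>: "cb_premeasure \<tau>" and A: "A \<in> compacted_borel" and B: "B \<in> compacted_borel"
    and "A \<inter> B = {}"
  shows "\<tau> (A \<union> B) = \<tau> A + \<tau> B"
proof -
  have "(\<Sum>n. \<tau> (binaryset A B n)) = \<tau> (\<Union>n. binaryset A B n)"
    using assms
    by (intro cb_premeasureD(2)[OF \<tau>])
      (auto simp: range_binaryset_eq UN_binaryset_eq cb_Un disjoint_family_on_def binaryset_def)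
  moreover have "(\<lambda>n. \<tau> (binaryset A B n)) sums (\<tau> A + \<tau> B)"
    by (rule binaryset_sums) (rule cb_premeasureD(1)[OF \<tau>])
  ultimately show ?thesis
    by (simp add: sums_iff UN_binaryset_eq)
qed

lemma cb_premeasure_mono:
  assumes \<tau>: "cb_premeasure \<tau>" and A: "A \<in> sets borel" and B: "B \<in> compacted_borel" and "A \<subseteq> B"
  shows "\<tau> A \<le> \<tau> B"
proof -
  have "\<tau> (A \<union> (B - A)) = \<tau> A + \<tau> (B - A)"
    using assms by (intro cb_premeasure_Un[OF \<tau>]) (auto intro: cb_subset cb_Diff)
  moreover have "A \<union> (B - A) = B" using assms by auto
  ultimately show ?thesis by (metis le_iff_add)
qed

text \<open>Superadditivity for two sets gives monotonicity and, by induction, bounds every partial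
  sum of the series by the value of the union. The two hypotheses are the natural halves for set
  functions defined as suprema, such as the positive part and the variation.\<close>

lemma cb_premeasureI:
  assumes empty: "\<tau> {} = 0"
    and super: "\<And>A B. A \<in> compacted_borel \<Longrightarrow> B \<in> compacted_borel \<Longrightarrow> A \<inter> B = {} \<Longrightarrow>
      \<tau> A + \<tau> B \<le> \<tau> (A \<union> B)"
    and sub: "\<And>A. range A \<subseteq> compacted_borel \<Longrightarrow> disjoint_family A \<Longrightarrow> (\<Union>n. A n) \<in> compacted_borel \<Longrightarrow>
      \<tau> (\<Union>n. A n) \<le> (\<Sum>n. \<tau> (A n))"
  shows "cb_premeasure \<tau>"
  unfolding cb_premeasure_def
proof (intro conjI allI impI)
  fix A :: "nat \<Rightarrow> 'a set"
  assume A: "range A \<subseteq> compacted_borel" "disjoint_family A" "(\<Union>n. A n) \<in> compacted_borel"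
  have fin: "(\<Sum>i<n. \<tau> (A i)) \<le> \<tau> (\<Union>i<n. A i)" for n
  proof (induction n)
    case (Suc n)
    have "A i \<inter> A n = {}" if "i < n" for i
      using disjoint_family_onD[OF A(2), of i n] that by simp
    then have "\<tau> (\<Union>i<n. A i) + \<tau> (A n) \<le> \<tau> ((\<Union>i<n. A i) \<union> A n)"
      using A(1) by (intro super cb_UN) auto
    moreover have "(\<Union>i<n. A i) \<union> A n = (\<Union>i<Suc n. A i)"
      by (auto simp: less_Suc_eq)
    ultimately show ?case
      using Suc by (simp add: add_mono order_trans[OF add_right_mono])
  qed (simp add: empty)
  have mono: "\<tau> (\<Union>i<n. A i) \<le> \<tau> (\<Union>n. A n)" for n
  proof -
    have "A i \<in> sets borel" for i using A(1) by (auto intro: cb_sets)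
    then have "(\<Union>i<n. A i) \<in> sets borel" by auto
    then have "\<tau> (\<Union>i<n. A i) + \<tau> ((\<Union>n. A n) - (\<Union>i<n. A i)) \<le>
        \<tau> ((\<Union>i<n. A i) \<union> ((\<Union>n. A n) - (\<Union>i<n. A i)))"
      using A by (intro super cb_UN[OF finite_lessThan] cb_Diff A(3)) auto
    moreover have "(\<Union>i<n. A i) \<union> ((\<Union>n. A n) - (\<Union>i<n. A i)) = (\<Union>n. A n)"
      by auto
    ultimately show ?thesis
      using order_trans[OF add_increasing2[OF zero_le order_refl]] by metis
  qed
  have "(\<Sum>n. \<tau> (A n)) \<le> \<tau> (\<Union>n. A n)"
    by (rule suminf_le_const[OF summableI]) (rule order_trans[OF fin mono])
  then show "(\<Sum>n. \<tau> (A n)) = \<tau> (\<Union>n. A n)"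
    using sub[OF A] by simp
qed (rule empty)

definition cb_additive :: "('g::topological_space set \<Rightarrow> 'b::real_normed_vector) \<Rightarrow> bool" where
  "cb_additive \<sigma> \<longleftrightarrow>
     (\<forall>A. range A \<subseteq> compacted_borel \<longrightarrow> disjoint_family A \<longrightarrow> (\<Union>n. A n) \<in> compacted_borel \<longrightarrow>
        (\<lambda>n. \<sigma> (A n)) sums \<sigma> (\<Union>n. A n))"

lemma complex_cb_measure_iff:
  "complex_cb_measure \<mu> \<longleftrightarrow> \<mu> \<in> extensional compacted_borel \<and> cb_additive \<mu>"
  by (simp add: complex_cb_measure_def cb_additive_def)

lemma cb_additiveD:
  "cb_additive \<sigma> \<Longrightarrow> range A \<subseteq> compacted_borel \<Longrightarrow> disjoint_family A \<Longrightarrow> (\<Union>n. A n) \<in> compacted_borel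
    \<Longrightarrow> (\<lambda>n. \<sigma> (A n)) sums \<sigma> (\<Union>n. A n)"
  unfolding cb_additive_def by blast

lemma cb_additive_empty: assumes "cb_additive \<sigma>" shows "\<sigma> {} = 0"
proof -
  have "(\<lambda>n::nat. \<sigma> {}) sums \<sigma> (\<Union>n::nat. {})"
    by (rule cb_additiveD[OF assms]) (auto simp: disjoint_family_on_def)
  then have "(\<lambda>n::nat. \<sigma> {}) \<longlonglongrightarrow> 0"
    by (intro summable_LIMSEQ_zero) (rule sums_summable)
  then show ?thesis by (simp add: LIMSEQ_const_iff)
qed

lemma cb_additive_Un:
  assumes \<sigma>: "cb_additive \<sigma>" and "A \<in> compacted_borel" "B \<in> compacted_borel" "A \<inter> B = {}"
  shows "\<sigma> (A \<union> B) = \<sigma> A + \<sigma> B"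
proof -
  have "(\<lambda>n. \<sigma> (binaryset A B n)) sums \<sigma> (\<Union>n. binaryset A B n)"
    using assms
    by (intro cb_additiveD[OF \<sigma>])
      (auto simp: range_binaryset_eq UN_binaryset_eq cb_Un disjoint_family_on_def binaryset_def)
  moreover have "(\<lambda>n. \<sigma> (binaryset A B n)) sums (\<sigma> A + \<sigma> B)"
    by (rule binaryset_sums) (rule cb_additive_empty[OF \<sigma>])
  ultimately show ?thesis
    by (simp add: sums_iff UN_binaryset_eq)
qed

lemma cb_additive_Diff:
  assumes "cb_additive \<sigma>" "A \<in> compacted_borel" "B \<in> sets borel" "B \<subseteq> A"
  shows "\<sigma> (A - B) = \<sigma> A - \<sigma> B"
proof -
  have "\<sigma> ((A - B) \<union> B) = \<sigma> (A - B) + \<sigma> B"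
    using assms by (intro cb_additive_Un) (auto intro: cb_Diff cb_subset)
  moreover have "(A - B) \<union> B = A" using assms by auto
  ultimately show ?thesis by simp
qed

lemma cb_additive_bounded_linear:
  assumes h: "bounded_linear h" and \<sigma>: "cb_additive \<sigma>"
  shows "cb_additive (\<lambda>A. h (\<sigma> A))"
  unfolding cb_additive_def by (intro allI impI bounded_linear.sums[OF h] cb_additiveD[OF \<sigma>])

text \<open>If the values inside \<open>X\<close> are unbounded, then \<open>X\<close> splits into
  two pieces of norm above 1, one of which is again unbounded. Keeping that piece and discarding the
  other yields a disjoint sequence of discarded sets whose values do not tend to 0, against
  countable additivity.\<close>

lemma cb_additive_bounded:
  fixes \<sigma> :: "'g::topological_space set \<Rightarrow> 'b::real_normed_vector"
  assumes \<sigma>: "cb_additive \<sigma>" and A: "A \<in> compacted_borel"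
  obtains M where "\<And>B. B \<in> sets borel \<Longrightarrow> B \<subseteq> A \<Longrightarrow> norm (\<sigma> B) \<le> M"
proof (rule ccontr)
  define U where "U X \<longleftrightarrow> (\<forall>M. \<exists>B\<in>sets borel. B \<subseteq> X \<and> norm (\<sigma> B) > M)" for X
  assume "\<not> thesis"
  with that have UA: "U A"
    unfolding U_def by (meson linorder_not_less)
  have step: "\<exists>Y. (Y \<in> compacted_borel \<and> U Y) \<and> Y \<subseteq> X \<and> 1 < norm (\<sigma> (X - Y))"
    if X: "X \<in> compacted_borel \<and> U X" for X
  proof -
    \<comment> \<open>The threshold \<open>1 + norm (\<sigma> X)\<close> forces both
      \<open>C\<close> and \<open>X - C\<close> to have norm above 1, so either may be the discarded
      piece.\<close>
    obtain C where C: "C \<in> sets borel" "C \<subseteq> X" "norm (\<sigma> C) > 1 + norm (\<sigma> X)"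
      using X by (auto simp: U_def)
    have "norm (\<sigma> C) - norm (\<sigma> X) \<le> norm (\<sigma> X - \<sigma> C)"
      by (metis norm_minus_commute norm_triangle_ineq2)
    then have D: "norm (\<sigma> (X - C)) > 1" and C1: "norm (\<sigma> C) > 1"
      using C X norm_ge_zero[of "\<sigma> X"] by (auto simp: cb_additive_Diff[OF \<sigma>] simp del: norm_ge_zero)
    have "U C \<or> U (X - C)"
    proof (rule ccontr)
      assume "\<not> (U C \<or> U (X - C))"
      then obtain M1 M2 where M: "\<And>B. B \<in> sets borel \<Longrightarrow> B \<subseteq> C \<Longrightarrow> norm (\<sigma> B) \<le> M1"
          "\<And>B. B \<in> sets borel \<Longrightarrow> B \<subseteq> X - C \<Longrightarrow> norm (\<sigma> B) \<le> M2"
        unfolding U_def by (meson linorder_not_less)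
      have "norm (\<sigma> B) \<le> M1 + M2" if B: "B \<in> sets borel" "B \<subseteq> X" for B
      proof -
        have "\<sigma> ((B \<inter> C) \<union> (B - C)) = \<sigma> (B \<inter> C) + \<sigma> (B - C)"
          using B C X by (intro cb_additive_Un[OF \<sigma>]) (auto intro: cb_subset)
        moreover have "(B \<inter> C) \<union> (B - C) = B" by auto
        ultimately have "norm (\<sigma> B) \<le> norm (\<sigma> (B \<inter> C)) + norm (\<sigma> (B - C))"
          by (metis norm_triangle_ineq)
        also have "\<dots> \<le> M1 + M2"
          using B C by (intro add_mono M) auto
        finally show ?thesis .
      qed
      then show False
        using X unfolding U_def by (meson linorder_not_less)
    qed
    then show ?thesis
    proof
      assume "U C"
      then show ?thesis using C D X by (intro exI[of _ C]) (auto intro: cb_subset)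
    next
      assume "U (X - C)"
      moreover have "X - (X - C) = C" using C by auto
      ultimately show ?thesis using C C1 X by (intro exI[of _ "X - C"]) (auto intro: cb_Diff)
    qed
  qed
  have "\<exists>X. \<forall>n. (X n \<in> compacted_borel \<and> U (X n)) \<and>
      (X (Suc n) \<subseteq> X n \<and> 1 < norm (\<sigma> (X n - X (Suc n))))"
    using A UA step
    by (intro dependent_nat_choice[where P = "\<lambda>_ X. X \<in> compacted_borel \<and> U X" and
          Q = "\<lambda>_ X Y. Y \<subseteq> X \<and> 1 < norm (\<sigma> (X - Y))"]) auto
  then obtain X where X: "\<And>n. X n \<in> compacted_borel" "\<And>n. X (Suc n) \<subseteq> X n"
      "\<And>n. 1 < norm (\<sigma> (X n - X (Suc n)))" by blast
  define E where "E n = X n - X (Suc n)" for n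
  have dec: "decseq X" by (simp add: X(2) decseq_SucI)
  have E: "E n \<in> compacted_borel" for n
    by (simp add: E_def X cb_Diff cb_sets)
  have disj: "disjoint_family E"
  proof (unfold disjoint_family_on_def, intro ballI impI)
    fix m n :: nat assume "m \<noteq> n"
    then show "E m \<inter> E n = {}"
    proof (induction m n rule: linorder_wlog)
      case (le m n)
      then have "X n \<subseteq> X (Suc m)" using decseqD[OF dec, of "Suc m" n] by simp
      then show ?case by (auto simp: E_def)
    qed auto
  qed
  have "(\<Union>n. E n) \<in> compacted_borel"
    using E decseqD[OF dec, of 0] by (intro cb_subset[OF X(1)[of 0]]) (auto simp: E_def intro: cb_sets)
  then have "(\<lambda>n. \<sigma> (E n)) sums \<sigma> (\<Union>n. E n)"
    using E disj by (intro cb_additiveD[OF \<sigma>]) auto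
  then have "(\<lambda>n. \<sigma> (E n)) \<longlonglongrightarrow> 0"
    by (intro summable_LIMSEQ_zero) (rule sums_summable)
  then obtain n where "norm (\<sigma> (E n) - 0) < 1"
    using LIMSEQ_D[of _ 0 1] by (meson order_refl zero_less_one)
  then show False
    using X(3)[of n] by (simp add: E_def)
qed

text \<open>Since \<open>ennreal\<close> truncates negative terms to 0, it is only subadditive;
  hence an inequality, which is the direction needed for suprema.\<close>

lemma sums_ennreal_le:
  fixes f :: "nat \<Rightarrow> real"
  assumes "f sums s"
  shows "ennreal s \<le> (\<Sum>n. ennreal (f n))"
proof (rule LIMSEQ_le_const2)
  show "(\<lambda>n. ennreal (\<Sum>i<n. f i)) \<longlonglongrightarrow> ennreal s"
    using assms by (intro tendsto_ennrealI) (simp add: sums_def)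
  have "ennreal (\<Sum>i\<in>I. f i) \<le> (\<Sum>i\<in>I. ennreal (f i))" if "finite I" for I
    using that
  proof (induction I rule: finite_induct)
    case (insert x F)
    have "ennreal (f x + sum f F) \<le> ennreal (f x) + ennreal (sum f F)"
      by (cases "0 \<le> f x"; cases "0 \<le> sum f F")
        (auto simp: ennreal_neg ennreal_plus[symmetric] simp del: ennreal_plus intro: ennreal_leI)
    then show ?case using insert by (simp add: order_trans[OF _ add_left_mono])
  qed simp
  then show "\<exists>N. \<forall>n\<ge>N. ennreal (\<Sum>i<n. f i) \<le> (\<Sum>n. ennreal (f n))"
    by (meson finite_lessThan order_trans sum_le_suminf summableI zero_le)
qed

lemma sums_ennreal_norm_le:
  fixes f :: "nat \<Rightarrow> 'b::real_normed_vector"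
  assumes "f sums s"
  shows "ennreal (norm s) \<le> (\<Sum>n. ennreal (norm (f n)))"
proof (rule LIMSEQ_le_const2)
  show "(\<lambda>n. ennreal (norm (\<Sum>i<n. f i))) \<longlonglongrightarrow> ennreal (norm s)"
    using assms by (intro tendsto_ennrealI tendsto_norm) (simp add: sums_def)
  have "ennreal (norm (\<Sum>i\<in>I. f i)) \<le> (\<Sum>i\<in>I. ennreal (norm (f i)))" for I
    by (simp add: norm_sum ennreal_leI)
  then show "\<exists>N. \<forall>n\<ge>N. ennreal (norm (\<Sum>i<n. f i)) \<le> (\<Sum>n. ennreal (norm (f n)))"
    by (meson finite_lessThan order_trans sum_le_suminf summableI zero_le)
qed

section \<open>Jordan decomposition\<close>

text \<open>Subsets of two disjoint sets unite to a subset of the union, which gives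
  superadditivity; a subset of a countable union is cut along the pieces, which gives
  subadditivity.\<close>

lemma cb_premeasure_positive_part:
  assumes \<sigma>: "cb_additive \<sigma>"
  shows "cb_premeasure (positive_part \<sigma>)"
proof (rule cb_premeasureI)
  have "{C \<in> compacted_borel. C \<subseteq> {}} = {{}::'a set}" by auto
  then show "positive_part \<sigma> {} = 0"
    by (simp add: positive_part_def cb_additive_empty[OF \<sigma>])
next
  fix A B :: "'a set"
  assume AB: "A \<in> compacted_borel" "B \<in> compacted_borel" "A \<inter> B = {}"
  have *: "ennreal (\<sigma> C) + ennreal (\<sigma> D) \<le> positive_part \<sigma> (A \<union> B)"
    if CD: "C \<in> compacted_borel" "C \<subseteq> A" "D \<in> compacted_borel" "D \<subseteq> B" for C D
  proof -
    \<comment> \<open>A set of negative value counts as 0 after \<open>ennreal\<close>; replacing it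
      by the empty set makes the truncated sum an honest value of \<sigma>.\<close>
    define C' where "C' = (if \<sigma> C \<ge> 0 then C else {})"
    define D' where "D' = (if \<sigma> D \<ge> 0 then D else {})"
    have "ennreal (\<sigma> C) + ennreal (\<sigma> D) = ennreal (\<sigma> C' + \<sigma> D')"
      by (auto simp: C'_def D'_def cb_additive_empty[OF \<sigma>] ennreal_neg simp flip: ennreal_plus)
    also have "\<sigma> C' + \<sigma> D' = \<sigma> (C' \<union> D')"
      using CD AB by (subst cb_additive_Un[OF \<sigma>]) (auto simp: C'_def D'_def)
    also have "ennreal \<dots> \<le> positive_part \<sigma> (A \<union> B)"
      unfolding positive_part_def using CD
      by (intro SUP_upper) (auto simp: C'_def D'_def intro: cb_Un)
    finally show ?thesis .
  qed
  have ne: "{C \<in> compacted_borel. C \<subseteq> A} \<noteq> {}" for A :: "'a set" using cb_empty by blast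
  have "positive_part \<sigma> A + positive_part \<sigma> B =
      (SUP D\<in>{D \<in> compacted_borel. D \<subseteq> B}. SUP C\<in>{C \<in> compacted_borel. C \<subseteq> A}. ennreal (\<sigma> C) + ennreal (\<sigma> D))"
    unfolding positive_part_def
    by (simp add: ennreal_SUP_add_right[OF ne] ennreal_SUP_add_left[OF ne])
  also have "\<dots> \<le> positive_part \<sigma> (A \<union> B)"
    using * by (intro SUP_least) auto
  finally show "positive_part \<sigma> A + positive_part \<sigma> B \<le> positive_part \<sigma> (A \<union> B)" .
next
  fix A :: "nat \<Rightarrow> 'a set"
  assume A: "range A \<subseteq> compacted_borel" "disjoint_family A" "(\<Union>n. A n) \<in> compacted_borel"
  show "positive_part \<sigma> (\<Union>n. A n) \<le> (\<Sum>n. positive_part \<sigma> (A n))"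
    unfolding positive_part_def[of \<sigma> "\<Union>n. A n"]
  proof (rule SUP_least, clarify)
    fix C assume C: "C \<in> compacted_borel" "C \<subseteq> (\<Union>n. A n)"
    have eq: "(\<Union>n. C \<inter> A n) = C" using C by auto
    have "(\<lambda>n. \<sigma> (C \<inter> A n)) sums \<sigma> (\<Union>n. C \<inter> A n)"
      using A C by (intro cb_additiveD[OF \<sigma>])
        (auto simp: eq disjoint_family_on_def intro!: cb_Int cb_sets)
    then have "ennreal (\<sigma> C) \<le> (\<Sum>n. ennreal (\<sigma> (C \<inter> A n)))"
      unfolding eq by (rule sums_ennreal_le)
    also have "\<dots> \<le> (\<Sum>n. positive_part \<sigma> (A n))"
      unfolding positive_part_def using A C
      by (intro suminf_le SUP_upper) (auto intro!: cb_Int cb_sets)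
    finally show "ennreal (\<sigma> C) \<le> (\<Sum>n. positive_part \<sigma> (A n))" .
  qed
qed

lemma positive_part_finite:
  assumes "cb_additive \<sigma>" "A \<in> compacted_borel"
  shows "positive_part \<sigma> A < \<infinity>"
proof -
  obtain M where M: "\<And>B. B \<in> sets borel \<Longrightarrow> B \<subseteq> A \<Longrightarrow> norm (\<sigma> B) \<le> M"
    using cb_additive_bounded[OF assms] by metis
  have "positive_part \<sigma> A \<le> ennreal M"
    unfolding positive_part_def
  proof (rule SUP_least, rule ennreal_leI)
    fix C assume "C \<in> {C \<in> compacted_borel. C \<subseteq> A}"
    then show "\<sigma> C \<le> M" using M[of C] by (simp add: cb_sets)
  qed
  also have "\<dots> < \<infinity>" by simp
  finally show ?thesis .
qed

text \<open>For \<open>C\<close> inside \<open>A\<close>, the value of \<open>C\<close> is that of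
  \<open>A\<close> minus that of \<open>A - C\<close>, hence at most the value of \<open>A\<close>
  plus its negative part. The supremum over \<open>C\<close> gives one inequality, and the same
  argument for \<open>- \<sigma>\<close> gives the other.\<close>

lemma jordan_decomposition:
  assumes \<sigma>: "cb_additive \<sigma>" and A: "A \<in> compacted_borel"
  shows "enn2real (positive_part \<sigma> A) - enn2real (positive_part (\<lambda>B. - \<sigma> B) A) = \<sigma> A"
proof -
  have le: "enn2real (positive_part \<sigma> A) \<le> \<sigma> A + enn2real (positive_part (\<lambda>B. - \<sigma> B) A)"
    if \<sigma>: "cb_additive \<sigma>" for \<sigma> :: "'a set \<Rightarrow> real"
  proof -
    have \<sigma>': "cb_additive (\<lambda>B. - \<sigma> B)"
      using cb_additive_bounded_linear[OF bounded_linear_minus[OF bounded_linear_ident] \<sigma>] .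
    have up: "\<tau> C \<le> enn2real (positive_part \<tau> A)"
      if "cb_additive \<tau>" "C \<in> compacted_borel" "C \<subseteq> A" for C and \<tau> :: "'a set \<Rightarrow> real"
    proof -
      have "ennreal (\<tau> C) \<le> positive_part \<tau> A"
        unfolding positive_part_def using that by (intro SUP_upper) auto
      then show ?thesis
        using positive_part_finite[OF that(1) A]
        by (metis (no_types) enn2real_nonneg ennreal_enn2real ennreal_le_iff infinity_ennreal_def)
    qed
    have "ennreal (\<sigma> C) \<le> ennreal (\<sigma> A + enn2real (positive_part (\<lambda>B. - \<sigma> B) A))"
      if C: "C \<in> compacted_borel" "C \<subseteq> A" for C
    proof (rule ennreal_leI)
      have "- \<sigma> (A - C) \<le> enn2real (positive_part (\<lambda>B. - \<sigma> B) A)"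
        using up[OF \<sigma>', of "A - C"] C A by (auto intro: cb_Diff cb_sets)
      then show "\<sigma> C \<le> \<sigma> A + enn2real (positive_part (\<lambda>B. - \<sigma> B) A)"
        using C A by (simp add: cb_additive_Diff[OF \<sigma>] cb_sets)
    qed
    then have "positive_part \<sigma> A \<le> ennreal (\<sigma> A + enn2real (positive_part (\<lambda>B. - \<sigma> B) A))"
      unfolding positive_part_def[of \<sigma>] by (intro SUP_least) auto
    moreover have "0 \<le> \<sigma> A + enn2real (positive_part (\<lambda>B. - \<sigma> B) A)"
      using up[OF \<sigma>', of A] A by simp
    ultimately show ?thesis
      by (simp add: enn2real_leI)
  qed
  have \<sigma>': "cb_additive (\<lambda>B. - \<sigma> B)"
    using cb_additive_bounded_linear[OF bounded_linear_minus[OF bounded_linear_ident] \<sigma>] .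
  show ?thesis using le[OF \<sigma>] le[OF \<sigma>'] by simp
qed

section \<open>The variation\<close>

lemma variation_ge: "A \<in> compacted_borel \<Longrightarrow> ennreal (cmod (\<nu> A)) \<le> variation \<nu> A"
  unfolding variation_def by (rule SUP_upper2[of "{A}"]) auto

text \<open>Minimality of the variation among the premeasures dominating the modulus of \<nu>: on a
  partition the dominating values add up to that of the whole set. Upper bounds for variations are
  obtained this way.\<close>

lemma variation_le:
  assumes \<tau>: "cb_premeasure \<tau>"
    and le: "\<And>B. B \<in> compacted_borel \<Longrightarrow> ennreal (cmod (\<nu> B)) \<le> \<tau> B"
  shows "variation \<nu> A \<le> \<tau> A"
  unfolding variation_def
proof (rule SUP_least, clarify)
  fix P :: "'a set set"
  assume P: "finite P" "P \<subseteq> compacted_borel" "disjoint P"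
  have "(\<Sum>B\<in>Q. \<tau> B) = \<tau> (\<Union>Q)" if "finite Q" "Q \<subseteq> P" for Q
    using that
  proof (induction Q rule: finite_induct)
    case (insert B Q)
    have "\<tau> (B \<union> \<Union>Q) = \<tau> B + \<tau> (\<Union>Q)"
    proof (rule cb_premeasure_Un[OF \<tau>])
      show "\<Union>Q \<in> compacted_borel" using insert P cb_UN[of Q id] by auto
      have "B \<inter> X = {}" if "X \<in> Q" for X
        using insert that P(3) by (intro disjointD[of P]) auto
      then show "B \<inter> \<Union>Q = {}" by auto
    qed (use insert P in auto)
    then show ?case using insert by simp
  qed (simp add: cb_premeasureD[OF \<tau>])
  then have "(\<Sum>B\<in>P. \<tau> B) = \<tau> (\<Union>P)" using P by simp
  moreover have "(\<Sum>B\<in>P. ennreal (cmod (\<nu> B))) \<le> (\<Sum>B\<in>P. \<tau> B)"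
    using P by (intro sum_mono le) auto
  ultimately show "(\<Sum>B\<in>P. ennreal (cmod (\<nu> B))) \<le> \<tau> (\<Union>P)" by simp
qed

text \<open>Partitions of two disjoint sets join to a partition of the union; a partition of a
  countable union is cut along the pieces \<open>A n\<close>.\<close>

lemma cb_premeasure_variation:
  assumes \<nu>: "cb_additive \<nu>"
  shows "cb_premeasure (variation \<nu>)"
proof (rule cb_premeasureI)
  show "variation \<nu> {} = 0"
  proof -
    have "(\<Sum>B\<in>P. ennreal (cmod (\<nu> B))) = 0" if "\<Union>P = {}" for P
      using that by (intro sum.neutral) (auto simp: cb_additive_empty[OF \<nu>])
    then show ?thesis
      unfolding variation_def by (intro antisym SUP_least) auto
  qed
next
  define parts where "parts X = {P. finite P \<and> P \<subseteq> compacted_borel \<and> disjoint P \<and> \<Union>P = X}"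
    for X :: "'a set"
  let ?s = "\<lambda>P. \<Sum>B\<in>P. ennreal (cmod (\<nu> B))"
  fix A B :: "'a set"
  assume AB: "A \<in> compacted_borel" "B \<in> compacted_borel" "A \<inter> B = {}"
  have *: "?s P + ?s Q \<le> variation \<nu> (A \<union> B)" if "P \<in> parts A" "Q \<in> parts B" for P Q
  proof -
    have PQ: "finite P" "P \<subseteq> compacted_borel" "disjoint P" "\<Union>P = A"
      "finite Q" "Q \<subseteq> compacted_borel" "disjoint Q" "\<Union>Q = B"
      using that by (auto simp: parts_def)
    \<comment> \<open>The two partitions may share the empty set, which the sum over
      \<open>P \<union> Q\<close> counts once; its value is 0, so nothing is lost.\<close>
    have "P \<inter> Q \<subseteq> {{}}" using PQ AB by blast
    then have "?s (P \<inter> Q) = 0"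
      by (intro sum.neutral) (auto simp: cb_additive_empty[OF \<nu>])
    then have "?s P + ?s Q = ?s (P \<union> Q)"
      using sum.union_inter[of P Q "\<lambda>B. ennreal (cmod (\<nu> B))"] PQ by simp
    also have "disjoint (P \<union> Q)"
      using PQ AB by (intro disjoint_union) auto
    then have "?s (P \<union> Q) \<le> variation \<nu> (A \<union> B)"
      unfolding variation_def using PQ by (intro SUP_upper) auto
    finally show ?thesis .
  qed
  have ne: "parts X \<noteq> {}" if "X \<in> compacted_borel" for X :: "'a set"
    using that by (auto simp: parts_def intro: exI[of _ "{X}"])
  have "variation \<nu> A + variation \<nu> B = (SUP Q\<in>parts B. SUP P\<in>parts A. ?s P + ?s Q)"
    unfolding variation_def parts_def[symmetric]
    by (simp add: ennreal_SUP_add_right[OF ne[OF AB(2)]] ennreal_SUP_add_left[OF ne[OF AB(1)]])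
  also have "\<dots> \<le> variation \<nu> (A \<union> B)"
    using * by (intro SUP_least) auto
  finally show "variation \<nu> A + variation \<nu> B \<le> variation \<nu> (A \<union> B)" .
next
  fix A :: "nat \<Rightarrow> 'a set"
  assume A: "range A \<subseteq> compacted_borel" "disjoint_family A" "(\<Union>n. A n) \<in> compacted_borel"
  then have An: "A n \<in> compacted_borel" for n by auto
  show "variation \<nu> (\<Union>n. A n) \<le> (\<Sum>n. variation \<nu> (A n))"
    unfolding variation_def[of \<nu> "\<Union>n. A n"]
  proof (rule SUP_least, clarify)
    fix P :: "'a set set"
    assume P: "finite P" "P \<subseteq> compacted_borel" "disjoint P" "\<Union>P = (\<Union>n. A n)"
    have "ennreal (cmod (\<nu> B)) \<le> (\<Sum>n. ennreal (cmod (\<nu> (B \<inter> A n))))" if "B \<in> P" for B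
    proof -
      have eq: "(\<Union>n. B \<inter> A n) = B" using P that by auto
      have "(\<lambda>n. \<nu> (B \<inter> A n)) sums \<nu> (\<Union>n. B \<inter> A n)"
        using A P that An by (intro cb_additiveD[OF \<nu>])
          (auto simp: eq disjoint_family_on_def intro!: cb_Int cb_sets)
      then show ?thesis
        unfolding eq by (rule sums_ennreal_norm_le)
    qed
    then have "(\<Sum>B\<in>P. ennreal (cmod (\<nu> B))) \<le> (\<Sum>B\<in>P. \<Sum>n. ennreal (cmod (\<nu> (B \<inter> A n))))"
      by (rule sum_mono)
    also have "\<dots> = (\<Sum>n. \<Sum>B\<in>P. ennreal (cmod (\<nu> (B \<inter> A n))))"
      by (rule suminf_sum[symmetric]) simp
    also have "\<dots> \<le> (\<Sum>n. variation \<nu> (A n))"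
    proof (intro suminf_le)
      fix n
      \<comment> \<open>Members of \<open>P\<close> may have the same trace on \<open>A n\<close>
        only if that trace is empty, and then it contributes 0; this justifies reindexing by a map
        that need not be injective.\<close>
      have "(\<Sum>B\<in>P. ennreal (cmod (\<nu> (B \<inter> A n)))) =
          (\<Sum>B\<in>(\<lambda>B. B \<inter> A n) ` P. ennreal (cmod (\<nu> B)))"
      proof (rule sum.reindex_nontrivial[symmetric, unfolded o_def])
        fix B C assume BC: "B \<in> P" "C \<in> P" "B \<noteq> C" "B \<inter> A n = C \<inter> A n"
        then have "B \<inter> C = {}" using P(3) by (auto simp: disjoint_def)
        then have "B \<inter> A n = {}" using BC by blast
        then show "ennreal (cmod (\<nu> (B \<inter> A n))) = 0" by (simp add: cb_additive_empty[OF \<nu>])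
      qed (rule P)
      also have "\<dots> \<le> variation \<nu> (A n)"
        unfolding variation_def
      proof (rule SUP_upper, clarify, intro conjI)
        show "disjoint ((\<lambda>B. B \<inter> A n) ` P)"
          using P(3) by (auto simp: disjoint_def)
        show "\<Union> ((\<lambda>B. B \<inter> A n) ` P) = A n" using P(4) by auto
        show "(\<lambda>B. B \<inter> A n) ` P \<subseteq> compacted_borel" using P(2) An by (auto intro: cb_Int cb_sets)
      qed (use P in auto)
      finally show "(\<Sum>B\<in>P. ennreal (cmod (\<nu> (B \<inter> A n)))) \<le> variation \<nu> (A n)" .
    qed auto
    finally show "(\<Sum>B\<in>P. ennreal (cmod (\<nu> B))) \<le> (\<Sum>n. variation \<nu> (A n))" .
  qed
qed

section \<open>Borel measures extending a premeasure\<close>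

text \<open>
  The supremum over compacted Borel sets is needed because the space need not be
  \<open>\<sigma>\<close>-compact.
\<close>

definition borel_extension :: "('g::topological_space set \<Rightarrow> ennreal) \<Rightarrow> 'g measure" where
  "borel_extension \<tau> = measure_of UNIV (sets borel) (\<lambda>B. SUP A\<in>compacted_borel. \<tau> (A \<inter> B))"

lemma borel_sigma_algebra: "sigma_algebra UNIV (sets borel)"
  by (metis sets.sigma_algebra_axioms space_borel)

lemma sets_borel_extension [simp, measurable_cong]: "sets (borel_extension \<tau>) = sets borel"
  unfolding borel_extension_def
  using sigma_algebra.sigma_sets_eq[OF borel_sigma_algebra] by (subst sets_measure_of) auto

lemma space_borel_extension [simp]: "space (borel_extension \<tau>) = UNIV"
  by (metis sets_borel_extension sets_eq_imp_space_eq space_borel)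

text \<open>The supremum can be exchanged with the series because compacted Borel sets are directed
  under union; for fixed \<open>A\<close> only countable additivity within \<open>A\<close> is
  used.\<close>

lemma emeasure_borel_extension:
  assumes \<tau>: "cb_premeasure \<tau>" and B: "B \<in> sets borel"
  shows "emeasure (borel_extension \<tau>) B = (SUP A\<in>compacted_borel. \<tau> (A \<inter> B))"
  unfolding borel_extension_def
proof (rule emeasure_measure_of_sigma[OF borel_sigma_algebra _ _ B])
  show "positive (sets borel) (\<lambda>B. SUP A\<in>compacted_borel. \<tau> (A \<inter> B))"
    using cb_premeasureD(1)[OF \<tau>] cb_empty by (auto simp: positive_def intro!: antisym SUP_least)
  show "countably_additive (sets borel) (\<lambda>B. SUP A\<in>compacted_borel. \<tau> (A \<inter> B))"
  proof (rule countably_additiveI)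
    fix B :: "nat \<Rightarrow> 'a set"
    assume B: "range B \<subseteq> sets borel" "disjoint_family B" "(\<Union>n. B n) \<in> sets borel"
    have "(\<Sum>n. SUP A\<in>compacted_borel. \<tau> (A \<inter> B n)) = (SUP A\<in>compacted_borel. \<Sum>n. \<tau> (A \<inter> B n))"
    proof (rule ennreal_suminf_SUP_eq_directed)
      fix N :: "nat set" and i j :: "'a set"
      assume "i \<in> compacted_borel" "j \<in> compacted_borel" "finite N"
      then show "\<exists>k\<in>compacted_borel. \<forall>n\<in>N. \<tau> (i \<inter> B n) \<le> \<tau> (k \<inter> B n) \<and> \<tau> (j \<inter> B n) \<le> \<tau> (k \<inter> B n)"
        using B by (intro bexI[of _ "i \<union> j"] ballI conjI cb_premeasure_mono[OF \<tau>] cb_Un)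
          (auto intro!: cb_Int cb_Un sets.Int simp: cb_sets)
    qed
    also have "\<dots> = (SUP A\<in>compacted_borel. \<tau> (A \<inter> (\<Union>n. B n)))"
    proof (rule SUP_cong[OF refl])
      fix A :: "'a set" assume A: "A \<in> compacted_borel"
      have eq: "(\<Union>n. A \<inter> B n) = A \<inter> (\<Union>n. B n)" by blast
      have "(\<Sum>n. \<tau> (A \<inter> B n)) = \<tau> (\<Union>n. A \<inter> B n)"
      proof (rule cb_premeasureD(2)[OF \<tau>])
        show "disjoint_family (\<lambda>n. A \<inter> B n)" using B(2) by (auto simp: disjoint_family_on_def)
        show "(\<Union>n. A \<inter> B n) \<in> compacted_borel"
          unfolding eq by (rule cb_Int[OF A B(3)])
      qed (use A B in \<open>auto intro: cb_Int\<close>)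
      then show "(\<Sum>n. \<tau> (A \<inter> B n)) = \<tau> (A \<inter> (\<Union>n. B n))" unfolding eq .
    qed
    finally show "(\<Sum>n. SUP A\<in>compacted_borel. \<tau> (A \<inter> B n)) = (SUP A\<in>compacted_borel. \<tau> (A \<inter> (\<Union>n. B n)))" .
  qed
qed

lemma emeasure_borel_extension_cb:
  assumes \<tau>: "cb_premeasure \<tau>" and B: "B \<in> compacted_borel"
  shows "emeasure (borel_extension \<tau>) B = \<tau> B"
  unfolding emeasure_borel_extension[OF \<tau> cb_sets[OF B]]
proof (rule antisym)
  show "(SUP A\<in>compacted_borel. \<tau> (A \<inter> B)) \<le> \<tau> B"
    using B by (intro SUP_least cb_premeasure_mono[OF \<tau>]) (auto intro: cb_sets)
  show "\<tau> B \<le> (SUP A\<in>compacted_borel. \<tau> (A \<inter> B))"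
    using B by (intro SUP_upper2[of B]) auto
qed

text \<open>Reduces a bound on an arbitrary Borel set, possibly far from compact, to its compacted
  Borel subsets.\<close>

lemma emeasure_borel_extension_le:
  assumes \<tau>: "cb_premeasure \<tau>" and B: "B \<in> sets borel"
    and le: "\<And>A. A \<in> compacted_borel \<Longrightarrow> A \<subseteq> B \<Longrightarrow> \<tau> A \<le> c"
  shows "emeasure (borel_extension \<tau>) B \<le> c"
  unfolding emeasure_borel_extension[OF \<tau> B]
  by (rule SUP_least) (rule le[OF cb_Int[OF _ B] Int_lower2])

text \<open>Connects the definition of the integral, which has a separate completed measure for each
  \<open>A\<close>, with one Borel measure on the whole space.\<close>

lemma complete_on_eq:
  assumes \<tau>: "cb_premeasure \<tau>" and A: "A \<in> compacted_borel"
  shows "complete_on A \<tau> = completion (restrict_space (borel_extension \<tau>) A)"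
proof -
  let ?S = "{B \<in> compacted_borel. B \<subseteq> A}"
  have sets: "sets (measure_of A ?S \<tau>) = ?S"
    using sigma_algebra.sigma_sets_eq[OF cb_sigma_algebra[OF A]] by (subst sets_measure_of) auto
  have "measure_of A ?S \<tau> = restrict_space (borel_extension \<tau>) A"
  proof (rule measure_eqI)
    show "sets (measure_of A ?S \<tau>) = sets (restrict_space (borel_extension \<tau>) A)"
      unfolding sets unfolding cb_restrict_space[OF A] by (simp add: sets_restrict_space)
  next
    fix B assume "B \<in> sets (measure_of A ?S \<tau>)"
    then have B: "B \<in> ?S" unfolding sets .
    have "emeasure (measure_of A ?S \<tau>) B = \<tau> B"
    proof (rule emeasure_measure_of_sigma[OF cb_sigma_algebra[OF A] _ _ B])
      show "positive ?S \<tau>" by (simp add: positive_def cb_premeasureD[OF \<tau>])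
      show "countably_additive ?S \<tau>"
        using cb_premeasureD(2)[OF \<tau>] by (intro countably_additiveI) auto
    qed
    also have "\<dots> = emeasure (restrict_space (borel_extension \<tau>) A) B"
      using A B by (subst emeasure_restrict_space) (auto simp: cb_sets emeasure_borel_extension_cb[OF \<tau>])
    finally show "emeasure (measure_of A ?S \<tau>) B = emeasure (restrict_space (borel_extension \<tau>) A) B" .
  qed
  then show ?thesis by (simp add: complete_on_def)
qed

text \<open>Such a measure may be infinite on the whole space, so the real number
  \<open>measure M A\<close> is trusted only for compacted Borel \<open>A\<close>.\<close>

definition cb_finite_measure :: "'g::topological_space measure \<Rightarrow> bool" where
  "cb_finite_measure M \<longleftrightarrow> sets M = sets borel \<and> (\<forall>A\<in>compacted_borel. emeasure M A < \<infinity>)"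

lemma cb_finite_measureD:
  assumes "cb_finite_measure M"
  shows "sets M = sets borel" "space M = UNIV" "A \<in> compacted_borel \<Longrightarrow> emeasure M A < \<infinity>"
    "A \<in> compacted_borel \<Longrightarrow> emeasure M A = ennreal (measure M A)"
  using assms sets_eq_imp_space_eq[of M borel]
  by (auto simp: cb_finite_measure_def emeasure_eq_ennreal_measure)

lemma cb_finite_borel_extension:
  "cb_premeasure \<tau> \<Longrightarrow> (\<And>A. A \<in> compacted_borel \<Longrightarrow> \<tau> A < \<infinity>) \<Longrightarrow> cb_finite_measure (borel_extension \<tau>)"
  by (simp add: cb_finite_measure_def emeasure_borel_extension_cb del: infinity_ennreal_def)

section \<open>Domination\<close>

text \<open>The nonnegative integral is a supremum over simple functions below \<open>u\<close>, and
  for these the domination on sets passes straight through the finite sum.\<close>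

lemma nn_integral_le_sum:
  fixes u :: "'a \<Rightarrow> ennreal"
  assumes K: "finite K" and sets: "\<And>k. k \<in> K \<Longrightarrow> sets (M k) = sets V"
    and le: "\<And>A. A \<in> sets V \<Longrightarrow> emeasure V A \<le> (\<Sum>k\<in>K. a k * emeasure (M k) A)"
  shows "(\<integral>\<^sup>+x. u x \<partial>V) \<le> (\<Sum>k\<in>K. a k * (\<integral>\<^sup>+x. u x \<partial>M k))"
  unfolding nn_integral_def[of V]
proof (rule SUP_least, clarify)
  fix g :: "'a \<Rightarrow> ennreal" assume g: "simple_function V g" "g \<le> u"
  have sp: "space (M k) = space V" if "k \<in> K" for k
    using sets_eq_imp_space_eq[OF sets[OF that]] .
  have gk: "simple_function (M k) g" if "k \<in> K" for k
    using g(1) sets[OF that] sp[OF that] by (simp add: simple_function_def)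
  have "integral\<^sup>S V g = (\<Sum>y\<in>g ` space V. y * emeasure V (g -` {y} \<inter> space V))"
    by (simp add: simple_integral_def)
  also have "\<dots> \<le> (\<Sum>y\<in>g ` space V. y * (\<Sum>k\<in>K. a k * emeasure (M k) (g -` {y} \<inter> space V)))"
    using g by (intro sum_mono mult_left_mono le) (auto intro: simple_functionD)
  also have "\<dots> = (\<Sum>k\<in>K. a k * (\<Sum>y\<in>g ` space V. y * emeasure (M k) (g -` {y} \<inter> space V)))"
    by (simp add: sum_distrib_left mult_ac sum.swap[of _ K])
  also have "\<dots> = (\<Sum>k\<in>K. a k * integral\<^sup>S (M k) g)"
    by (intro sum.cong refl) (simp add: simple_integral_def sp)
  also have "\<dots> \<le> (\<Sum>k\<in>K. a k * (\<integral>\<^sup>+x. u x \<partial>M k))"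
  proof (intro sum_mono mult_left_mono)
    fix k assume "k \<in> K"
    then show "integral\<^sup>S (M k) g \<le> (\<integral>\<^sup>+x. u x \<partial>M k)"
      unfolding nn_integral_def using g gk by (intro SUP_upper) auto
  qed simp
  finally show "integral\<^sup>S V g \<le> (\<Sum>k\<in>K. a k * (\<integral>\<^sup>+x. u x \<partial>M k))" .
qed

lemma nn_integral_measure_mono:
  assumes "sets M = sets V" and "\<And>A. A \<in> sets V \<Longrightarrow> emeasure V A \<le> emeasure M A"
  shows "(\<integral>\<^sup>+x. u x \<partial>V) \<le> (\<integral>\<^sup>+x. u x \<partial>M)"
  using nn_integral_le_sum[of "{()}" "\<lambda>_. M" V "\<lambda>_. 1"] assms by simp

lemma integrable_measure_mono:
  fixes f :: "'a \<Rightarrow> 'b::{banach, second_countable_topology}"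
  assumes sets: "sets M = sets V" and "\<And>A. A \<in> sets V \<Longrightarrow> emeasure V A \<le> emeasure M A"
    and "integrable M f"
  shows "integrable V f"
proof (rule integrableI_bounded)
  show "f \<in> borel_measurable V"
    using borel_measurable_integrable[OF assms(3)] measurable_cong_sets[OF sets refl] by blast
  have "(\<integral>\<^sup>+x. ennreal (norm (f x)) \<partial>V) \<le> (\<integral>\<^sup>+x. ennreal (norm (f x)) \<partial>M)"
    by (rule nn_integral_measure_mono[OF assms(1,2)])
  also have "\<dots> < \<infinity>"
    using assms(3) by (simp add: integrable_iff_bounded)
  finally show "(\<integral>\<^sup>+x. ennreal (norm (f x)) \<partial>V) < \<infinity>" .
qed

text \<open>The factor \<open>g\<close> is taken as the identity and as \<open>cmod\<close>, so that
  both sides of the estimate in \<open>integral_combination_le\<close> become sums over the same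
  fibres.\<close>

lemma has_bochner_integral_simple:
  fixes F :: "'g::topological_space \<Rightarrow> 'c" and g :: "'c \<Rightarrow> 'b::{banach, second_countable_topology}"
  assumes F: "simple_function borel F" and A: "A \<in> compacted_borel" and M: "cb_finite_measure M"
  shows "has_bochner_integral M (\<lambda>x. indicator A x *\<^sub>R g (F x))
    (\<Sum>y\<in>range F. measure M (F -` {y} \<inter> A) *\<^sub>R g y)"
proof -
  have fin: "finite (range F)" using F by (auto simp: simple_function_def)
  have E: "F -` {y} \<inter> A \<in> compacted_borel" for y
    using simple_functionD(2)[OF F, of "{y}"] A by (auto intro: cb_Int2)
  have eq: "indicator A x *\<^sub>R g (F x) = (\<Sum>y\<in>range F. indicator (F -` {y} \<inter> A) x *\<^sub>R g y)" for x
  proof -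
    have "(\<Sum>y\<in>range F. indicator (F -` {y} \<inter> A) x *\<^sub>R g y) =
        (\<Sum>y\<in>range F. if y = F x then indicator A x *\<^sub>R g y else 0)"
      by (intro sum.cong) (auto simp: indicator_def)
    also have "\<dots> = indicator A x *\<^sub>R g (F x)"
      using fin by simp
    finally show ?thesis ..
  qed
  show ?thesis
    unfolding eq using cb_finite_measureD[OF M] E
    by (intro has_bochner_integral_sum has_bochner_integral_indicator) (auto simp: cb_sets)
qed

text \<open>With \<open>V = null_measure borel\<close> this also transfers identities from sets to integrals.\<close>

lemma integral_combination_le:
  fixes f :: "'g::topological_space \<Rightarrow> complex"
  assumes K: "finite K" and M: "\<And>k. k \<in> K \<Longrightarrow> cb_finite_measure (M k)" and V: "cb_finite_measure V"
    and le: "\<And>A. A \<in> compacted_borel \<Longrightarrow> cmod (\<Sum>k\<in>K. c k * of_real (measure (M k) A)) \<le> measure V A"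
    and f: "f \<in> borel_measurable borel"
    and fM: "\<And>k. k \<in> K \<Longrightarrow> integrable (M k) f" and fV: "integrable V f"
    and A: "incseq A" "range A \<subseteq> compacted_borel" "\<And>x. x \<notin> (\<Union>n. A n) \<Longrightarrow> f x = 0"
  shows "cmod (\<Sum>k\<in>K. c k * (\<integral>x. f x \<partial>M k)) \<le> (\<integral>x. cmod (f x) \<partial>V)"
proof -
  obtain F where F: "\<And>i. simple_function borel (F i)" "\<And>x. (\<lambda>i. F i x) \<longlonglongrightarrow> f x"
      "\<And>i x. cmod (F i x) \<le> 2 * cmod (f x)"
    using borel_measurable_implies_sequence_metric[OF f, of 0] by auto
  \<comment> \<open>The domination is known on compacted Borel sets only, so the simple
    approximations are cut off along \<open>A\<close>. Their limit is still \<open>f\<close>, which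
    vanishes off the union.\<close>
  define G where "G i x = indicator (A i) x *\<^sub>R F i x" for i x
  have Ai: "A i \<in> compacted_borel" for i using A(2) by auto
  have Fm: "F i \<in> borel_measurable borel" for i
    using F(1) by (rule borel_measurable_simple_function)
  then have Gm: "G i \<in> borel_measurable borel" for i
    unfolding G_def using Ai[THEN cb_sets] by measurable
  have Glim: "(\<lambda>i. G i x) \<longlonglongrightarrow> f x" for x
  proof (cases "x \<in> (\<Union>n. A n)")
    case True
    then obtain n where "x \<in> A n" by auto
    then have "x \<in> A i" if "n \<le> i" for i using incseqD[OF A(1) that] by auto
    then have "\<forall>\<^sub>F i in sequentially. F i x = G i x"
      by (intro eventually_sequentiallyI[of n]) (simp add: G_def)
    then show ?thesis using F(2) by (rule Lim_transform_eventually[rotated])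
  next
    case False
    then have "G i x = 0" "f x = 0" for i using A(3) by (auto simp: G_def)
    then show ?thesis by simp
  qed
  have Gle: "cmod (G i x) \<le> 2 * cmod (f x)" for i x
    using F(3)[of i x] by (auto simp: G_def indicator_def)
  have limM: "(\<lambda>i. \<integral>x. G i x \<partial>M k) \<longlonglongrightarrow> (\<integral>x. f x \<partial>M k)" if k: "k \<in> K" for k
  proof (rule integral_dominated_convergence[where w = "\<lambda>x. 2 * cmod (f x)"])
    note [measurable_cong] = cb_finite_measureD(1)[OF M[OF k]]
    show "f \<in> borel_measurable (M k)" "\<And>i. G i \<in> borel_measurable (M k)"
      using f Gm by measurable
  qed (use fM[OF k] Glim Gle in auto)
  have limV: "(\<lambda>i. \<integral>x. cmod (G i x) \<partial>V) \<longlonglongrightarrow> (\<integral>x. cmod (f x) \<partial>V)"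
  proof (rule integral_dominated_convergence[where w = "\<lambda>x. 2 * cmod (f x)"])
    note [measurable_cong] = cb_finite_measureD(1)[OF V]
    show "(\<lambda>x. cmod (f x)) \<in> borel_measurable V" "\<And>i. (\<lambda>x. cmod (G i x)) \<in> borel_measurable V"
      using f Gm by measurable
  qed (use fV Gle in \<open>auto intro!: AE_I2 tendsto_norm Glim\<close>)
  have step: "cmod (\<Sum>k\<in>K. c k * (\<integral>x. G i x \<partial>M k)) \<le> (\<integral>x. cmod (G i x) \<partial>V)" for i
  proof -
    \<comment> \<open>The fibres inside \<open>A i\<close> are compacted Borel sets, so the
      hypothesis \<open>le\<close> applies to each of them.\<close>
    let ?E = "\<lambda>y. F i -` {y} \<inter> A i"
    have E: "?E y \<in> compacted_borel" for y
      using simple_functionD(2)[OF F(1), of i "{y}"] Ai by (auto intro: cb_Int2)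
    have "(\<integral>x. G i x \<partial>M k) = (\<Sum>y\<in>range (F i). measure (M k) (?E y) *\<^sub>R y)" if "k \<in> K" for k
      unfolding G_def
      by (rule has_bochner_integral_integral_eq has_bochner_integral_simple[where g = "\<lambda>y. y"] F Ai M that)+
    then have "(\<Sum>k\<in>K. c k * (\<integral>x. G i x \<partial>M k)) =
        (\<Sum>k\<in>K. \<Sum>y\<in>range (F i). y * (c k * of_real (measure (M k) (?E y))))"
      by (simp add: sum_distrib_left scaleR_conv_of_real mult_ac)
    also have "\<dots> = (\<Sum>y\<in>range (F i). y * (\<Sum>k\<in>K. c k * of_real (measure (M k) (?E y))))"
      by (subst sum.swap) (simp add: sum_distrib_left)
    finally have "cmod (\<Sum>k\<in>K. c k * (\<integral>x. G i x \<partial>M k)) \<le>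
        (\<Sum>y\<in>range (F i). cmod y * cmod (\<Sum>k\<in>K. c k * of_real (measure (M k) (?E y))))"
      by (metis (no_types, lifting) norm_mult norm_sum sum.cong)
    also have "\<dots> \<le> (\<Sum>y\<in>range (F i). cmod y * measure V (?E y))"
      by (intro sum_mono mult_left_mono le E) simp
    also have "\<dots> = (\<Sum>y\<in>range (F i). measure V (?E y) *\<^sub>R cmod y)"
      by (simp add: mult.commute)
    also have "\<dots> = (\<integral>x. indicator (A i) x *\<^sub>R cmod (F i x) \<partial>V)"
      by (rule sym) (rule has_bochner_integral_integral_eq has_bochner_integral_simple F Ai V)+
    also have "\<dots> = (\<integral>x. cmod (G i x) \<partial>V)"
      by (simp add: G_def)
    finally show ?thesis .
  qed
  show ?thesis
  proof (rule LIMSEQ_le)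
    show "(\<lambda>i. cmod (\<Sum>k\<in>K. c k * (\<integral>x. G i x \<partial>M k))) \<longlonglongrightarrow> cmod (\<Sum>k\<in>K. c k * (\<integral>x. f x \<partial>M k))"
      by (intro tendsto_intros limM)
  qed (use limV step in auto)
qed

lemma cb_finite_null_measure: "cb_finite_measure (null_measure borel)"
  by (simp add: cb_finite_measure_def)

section \<open>Complex combinations of measures\<close>

text \<open>One set function has many representations, and its values off
  \<open>compacted_borel\<close> are left open; \<open>represents_integral_eq\<close> shows that
  integrals do not depend on the choice.\<close>

definition represents ::
  "'i set \<Rightarrow> ('i \<Rightarrow> complex) \<Rightarrow> ('i \<Rightarrow> 'g::topological_space measure) \<Rightarrow> ('g set \<Rightarrow> complex) \<Rightarrow> bool"
where
  "represents K c M \<nu> \<longleftrightarrow> finite K \<and> (\<forall>k\<in>K. cb_finite_measure (M k)) \<and>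
     (\<forall>A\<in>compacted_borel. \<nu> A = (\<Sum>k\<in>K. c k * of_real (measure (M k) A)))"

lemma representsD:
  assumes "represents K c M \<nu>"
  shows "finite K" "\<And>k. k \<in> K \<Longrightarrow> cb_finite_measure (M k)"
    "\<And>A. A \<in> compacted_borel \<Longrightarrow> \<nu> A = (\<Sum>k\<in>K. c k * of_real (measure (M k) A))"
  using assms by (auto simp: represents_def)

text \<open>The difference of the two combinations is again a combination, indexed by the disjoint
  sum of the index sets. It vanishes on compacted Borel sets and is therefore dominated by the null
  measure.\<close>

lemma represents_integral_eq:
  fixes f :: "'g::topological_space \<Rightarrow> complex"
  assumes KM: "represents K c M \<nu>" and LN: "represents L d N \<nu>"
    and f: "f \<in> borel_measurable borel"
    and fM: "\<And>k. k \<in> K \<Longrightarrow> integrable (M k) f" and fN: "\<And>l. l \<in> L \<Longrightarrow> integrable (N l) f"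
    and A: "incseq A" "range A \<subseteq> compacted_borel" "\<And>x. x \<notin> (\<Union>n. A n) \<Longrightarrow> f x = 0"
  shows "(\<Sum>k\<in>K. c k * (\<integral>x. f x \<partial>M k)) = (\<Sum>l\<in>L. d l * (\<integral>x. f x \<partial>N l))"
proof -
  let ?c = "case_sum c (\<lambda>l. - d l)" and ?M = "case_sum M N"
  note D = representsD[OF KM] representsD[OF LN]
  have "cmod (\<Sum>k\<in>K <+> L. ?c k * (\<integral>x. f x \<partial>?M k)) \<le> (\<integral>x. cmod (f x) \<partial>null_measure borel)"
  proof (rule integral_combination_le[OF _ _ cb_finite_null_measure _ f _ _ A])
    fix A :: "'g set" assume A: "A \<in> compacted_borel"
    show "cmod (\<Sum>k\<in>K <+> L. ?c k * of_real (measure (?M k) A)) \<le> measure (null_measure borel) A"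
      using D A by (simp add: sum.Plus sum_negf)
  qed (use D f fM fN in auto)
  then show ?thesis
    using D by (simp add: sum.Plus sum_negf)
qed

lemma represents_cb_additive:
  fixes \<nu> :: "'g::topological_space set \<Rightarrow> complex"
  assumes "represents K c M \<nu>"
  shows "cb_additive \<nu>"
  unfolding cb_additive_def
proof (intro allI impI)
  fix A :: "nat \<Rightarrow> 'g set"
  assume A: "range A \<subseteq> compacted_borel" "disjoint_family A" "(\<Union>n. A n) \<in> compacted_borel"
  note D = representsD[OF assms]
  have "(\<lambda>n. measure (M k) (A n)) sums measure (M k) (\<Union>n. A n)" if "k \<in> K" for k
    using A cb_finite_measureD(1)[OF D(2)[OF that]] cb_finite_measureD(3)[OF D(2)[OF that] A(3)]
    by (intro measure_UNION) (auto simp: cb_sets image_subset_iff)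
  then have "(\<lambda>n. \<Sum>k\<in>K. c k * of_real (measure (M k) (A n))) sums
      (\<Sum>k\<in>K. c k * of_real (measure (M k) (\<Union>n. A n)))"
    by (intro sums_sum sums_mult) (simp add: sums_of_real_iff)
  moreover have "\<nu> (A n) = (\<Sum>k\<in>K. c k * of_real (measure (M k) (A n)))" for n
    using A(1) by (intro D(3)) auto
  ultimately show "(\<lambda>n. \<nu> (A n)) sums \<nu> (\<Union>n. A n)"
    using D(3)[OF A(3)] by simp
qed

lemma represents_variation_le:
  fixes \<nu> :: "'g::topological_space set \<Rightarrow> complex"
  assumes "represents K c M \<nu>"
  shows "variation \<nu> A \<le> (\<Sum>k\<in>K. ennreal (cmod (c k)) * emeasure (M k) A)"
proof (rule variation_le)
  note D = representsD[OF assms]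
  show "cb_premeasure (\<lambda>A. \<Sum>k\<in>K. ennreal (cmod (c k)) * emeasure (M k) A)"
    unfolding cb_premeasure_def
  proof (intro conjI allI impI)
    fix A :: "nat \<Rightarrow> 'g set"
    assume A: "range A \<subseteq> compacted_borel" "disjoint_family A" "(\<Union>n. A n) \<in> compacted_borel"
    have "(\<Sum>n. emeasure (M k) (A n)) = emeasure (M k) (\<Union>n. A n)" if "k \<in> K" for k
      using A cb_finite_measureD(1)[OF D(2)[OF that]]
      by (intro suminf_emeasure) (auto simp: cb_sets image_subset_iff)
    then show "(\<Sum>n. \<Sum>k\<in>K. ennreal (cmod (c k)) * emeasure (M k) (A n)) =
        (\<Sum>k\<in>K. ennreal (cmod (c k)) * emeasure (M k) (\<Union>n. A n))"
      by (subst suminf_sum) (auto intro!: sum.cong simp: ennreal_suminf_cmult)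
  qed simp
  fix B :: "'g set" assume B: "B \<in> compacted_borel"
  have "cmod (\<nu> B) \<le> (\<Sum>k\<in>K. cmod (c k) * measure (M k) B)"
    unfolding D(3)[OF B] by (rule order_trans[OF norm_sum]) (simp add: norm_mult)
  then have "ennreal (cmod (\<nu> B)) \<le> ennreal (\<Sum>k\<in>K. cmod (c k) * measure (M k) B)"
    by (rule ennreal_leI)
  also have "\<dots> = (\<Sum>k\<in>K. ennreal (cmod (c k)) * emeasure (M k) B)"
    using cb_finite_measureD(4)[OF D(2) B]
    by (subst sum_ennreal[symmetric]) (auto intro!: sum.cong simp: ennreal_mult)
  finally show "ennreal (cmod (\<nu> B)) \<le> (\<Sum>k\<in>K. ennreal (cmod (c k)) * emeasure (M k) B)" .
qed

text \<open>The factor \<open>(- \<i>) ^ k\<close> rotates the axis of \<open>\<i> ^ k\<close> onto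
  the positive reals. So k = 0, 1, 2, 3 give the positive parts of Re, Im, -Re, -Im, and one index
  replaces four separate treatments.\<close>

definition jordan_part :: "('g::topological_space set \<Rightarrow> complex) \<Rightarrow> nat \<Rightarrow> 'g measure" where
  "jordan_part \<nu> k = borel_extension (positive_part (\<lambda>A. Re (\<nu> A * (- \<i>) ^ k)))"

definition variation_measure :: "('g::topological_space set \<Rightarrow> complex) \<Rightarrow> 'g measure" where
  "variation_measure \<nu> = borel_extension (variation \<nu>)"

lemma cb_additive_Re_mult:
  "cb_additive \<nu> \<Longrightarrow> cb_additive (\<lambda>A. Re (\<nu> A * z))"
  by (rule cb_additive_bounded_linear[OF bounded_linear_compose[OF bounded_linear_Re bounded_linear_mult_left]])

lemma sets_jordan_part [simp, measurable_cong]: "sets (jordan_part \<nu> k) = sets borel"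
  by (simp add: jordan_part_def)

lemma sets_variation_measure [simp, measurable_cong]: "sets (variation_measure \<nu>) = sets borel"
  by (simp add: variation_measure_def)

lemma space_variation_measure [simp]: "space (variation_measure \<nu>) = UNIV"
  by (simp add: variation_measure_def)

lemma cb_finite_jordan_part: "cb_additive \<nu> \<Longrightarrow> cb_finite_measure (jordan_part \<nu> k)"
  unfolding jordan_part_def
  by (intro cb_finite_borel_extension cb_premeasure_positive_part positive_part_finite cb_additive_Re_mult)

lemma represents_jordan_part:
  assumes \<nu>: "cb_additive \<nu>"
  shows "represents {..<4} (\<lambda>k. \<i> ^ k) (jordan_part \<nu>) \<nu>"
  unfolding represents_def
proof (intro conjI ballI)
  fix A :: "'a set" assume A: "A \<in> compacted_borel"
  have m: "measure (jordan_part \<nu> k) A = enn2real (positive_part (\<lambda>A. Re (\<nu> A * (- \<i>) ^ k)) A)" for k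
    unfolding jordan_part_def measure_def
    by (subst emeasure_borel_extension_cb[OF cb_premeasure_positive_part[OF cb_additive_Re_mult[OF \<nu>]] A]) (rule refl)
  have "complex_of_real (measure (jordan_part \<nu> 0) A - measure (jordan_part \<nu> 2) A) = of_real (Re (\<nu> A))"
    using jordan_decomposition[OF cb_additive_Re_mult[OF \<nu>, of 1] A] by (simp add: m)
  moreover have "complex_of_real (measure (jordan_part \<nu> 1) A - measure (jordan_part \<nu> 3) A) = of_real (Im (\<nu> A))"
    using jordan_decomposition[OF cb_additive_Re_mult[OF \<nu>, of "- \<i>"] A]
    by (simp add: m power3_eq_cube)
  ultimately show "\<nu> A = (\<Sum>k<4. \<i> ^ k * of_real (measure (jordan_part \<nu> k) A))"
    by (simp add: eval_nat_numeral complex_eq_iff)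
qed (auto intro: cb_finite_jordan_part \<nu>)

text \<open>The variation is dominated by the sum of the four Jordan parts, which are finite because
  a countably additive function is bounded below each compacted set.\<close>

lemma variation_finite:
  assumes \<nu>: "cb_additive \<nu>" and A: "A \<in> compacted_borel"
  shows "variation \<nu> A < \<infinity>"
proof -
  have "(\<Sum>k<4. ennreal (cmod (\<i> ^ k)) * emeasure (jordan_part \<nu> k) A) < \<infinity>"
    using cb_finite_measureD(3)[OF cb_finite_jordan_part[OF \<nu>] A] by (auto simp: norm_power)
  then show ?thesis
    using represents_variation_le[OF represents_jordan_part[OF \<nu>], of A] by (rule le_less_trans[rotated])
qed

lemma cb_finite_variation_measure: "cb_additive \<nu> \<Longrightarrow> cb_finite_measure (variation_measure \<nu>)"
  unfolding variation_measure_def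
  by (intro cb_finite_borel_extension cb_premeasure_variation variation_finite)

lemma emeasure_variation_measure_cb:
  "cb_additive \<nu> \<Longrightarrow> A \<in> compacted_borel \<Longrightarrow> emeasure (variation_measure \<nu>) A = variation \<nu> A"
  unfolding variation_measure_def by (intro emeasure_borel_extension_cb cb_premeasure_variation)

lemma emeasure_variation_measure_UNIV:
  "cb_additive \<nu> \<Longrightarrow> emeasure (variation_measure \<nu>) UNIV = total_variation \<nu>"
  unfolding variation_measure_def total_variation_def
  by (subst emeasure_borel_extension) (auto intro: cb_premeasure_variation)

text \<open>The rotating factor has modulus 1, so the rotated real part is at most the modulus.
  Integrability for the variation thus suffices for all four parts.\<close>

lemma jordan_part_le_variation:
  assumes \<nu>: "cb_additive \<nu>" and A: "A \<in> sets borel"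
  shows "emeasure (jordan_part \<nu> k) A \<le> emeasure (variation_measure \<nu>) A"
  unfolding jordan_part_def
proof (rule emeasure_borel_extension_le[OF cb_premeasure_positive_part A])
  fix B assume B: "B \<in> compacted_borel" "B \<subseteq> A"
  have "positive_part (\<lambda>A. Re (\<nu> A * (- \<i>) ^ k)) B \<le> variation \<nu> B"
    unfolding positive_part_def
  proof (rule SUP_least, clarify)
    fix C assume C: "C \<in> compacted_borel" "C \<subseteq> B"
    have "Re (\<nu> C * (- \<i>) ^ k) \<le> cmod (\<nu> C)"
      using complex_Re_le_cmod[of "\<nu> C * (- \<i>) ^ k"] by (simp add: norm_mult norm_power)
    then have "ennreal (Re (\<nu> C * (- \<i>) ^ k)) \<le> ennreal (cmod (\<nu> C))" by (rule ennreal_leI)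
    also have "\<dots> \<le> variation \<nu> C" by (rule variation_ge[OF C(1)])
    also have "\<dots> \<le> variation \<nu> B"
      using B C by (intro cb_premeasure_mono cb_premeasure_variation \<nu>) (auto intro: cb_sets)
    finally show "ennreal (Re (\<nu> C * (- \<i>) ^ k)) \<le> variation \<nu> B" .
  qed
  also have "\<dots> = emeasure (variation_measure \<nu>) B"
    using B by (simp add: emeasure_variation_measure_cb[OF \<nu>])
  also have "\<dots> \<le> emeasure (variation_measure \<nu>) A"
    using A B by (intro emeasure_mono) auto
  finally show "positive_part (\<lambda>A. Re (\<nu> A * (- \<i>) ^ k)) B \<le> emeasure (variation_measure \<nu>) A" .
qed (rule cb_additive_Re_mult[OF \<nu>])

lemma represents_variation_measure_le:
  assumes KM: "represents K c M \<nu>" and A: "A \<in> sets borel"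
  shows "emeasure (variation_measure \<nu>) A \<le> (\<Sum>k\<in>K. ennreal (cmod (c k)) * emeasure (M k) A)"
  unfolding variation_measure_def
proof (rule emeasure_borel_extension_le[OF cb_premeasure_variation[OF represents_cb_additive[OF KM]] A])
  fix B assume B: "B \<in> compacted_borel" "B \<subseteq> A"
  have "variation \<nu> B \<le> (\<Sum>k\<in>K. ennreal (cmod (c k)) * emeasure (M k) B)"
    by (rule represents_variation_le[OF KM])
  also have "\<dots> \<le> (\<Sum>k\<in>K. ennreal (cmod (c k)) * emeasure (M k) A)"
    using A B cb_finite_measureD(1)[OF representsD(2)[OF KM]]
    by (intro sum_mono mult_left_mono emeasure_mono) auto
  finally show "variation \<nu> B \<le> (\<Sum>k\<in>K. ennreal (cmod (c k)) * emeasure (M k) A)" .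
qed

text \<open>Together with \<open>integrable_jordan_part\<close> this carries integrability from any
  representation to the Jordan parts that define the integral.\<close>

lemma represents_integrable_variation:
  fixes f :: "'g::topological_space \<Rightarrow> complex"
  assumes KM: "represents K c M \<nu>" and f: "f \<in> borel_measurable borel"
    and fM: "\<And>k. k \<in> K \<Longrightarrow> integrable (M k) f"
  shows "integrable (variation_measure \<nu>) f"
proof (rule integrableI_bounded)
  note D = representsD[OF KM]
  have "(\<integral>\<^sup>+x. ennreal (cmod (f x)) \<partial>variation_measure \<nu>) \<le>
      (\<Sum>k\<in>K. ennreal (cmod (c k)) * (\<integral>\<^sup>+x. ennreal (cmod (f x)) \<partial>M k))"
    using D cb_finite_measureD(1)[OF D(2)] represents_variation_measure_le[OF KM]
    by (intro nn_integral_le_sum) auto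
  also have "\<dots> < \<infinity>"
    using fM D(1) unfolding integrable_iff_bounded by (auto simp: ennreal_mult_less_top)
  finally show "(\<integral>\<^sup>+x. ennreal (cmod (f x)) \<partial>variation_measure \<nu>) < \<infinity>" .
qed (use f in measurable)

section \<open>Integration against complex compacted-Borel measures\<close>

text \<open>The support clause of \<open>L1_exhaustion\<close> by itself, so that it can be checked
  apart from integrability.\<close>

definition cb_supported :: "('g::topological_space \<Rightarrow> 'b::zero) \<Rightarrow> bool" where
  "cb_supported f \<longleftrightarrow>
     (\<exists>A. incseq A \<and> range A \<subseteq> compacted_borel \<and> (\<forall>x. x \<notin> (\<Union>n. A n) \<longrightarrow> f x = 0))"

lemma cb_supported_cb: "A \<in> compacted_borel \<Longrightarrow> (\<And>x. x \<notin> A \<Longrightarrow> f x = 0) \<Longrightarrow> cb_supported f"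
  unfolding cb_supported_def by (intro exI[of _ "\<lambda>_. A"]) (auto simp: incseq_def)

lemma cb_supported_zero:
  assumes "cb_supported f" "\<And>x. f x = 0 \<Longrightarrow> g x = 0"
  shows "cb_supported g"
proof -
  obtain A where "incseq A" "range A \<subseteq> compacted_borel" "\<forall>x. x \<notin> (\<Union>n. A n) \<longrightarrow> f x = 0"
    using assms(1) unfolding cb_supported_def by (elim exE conjE) (rule that)
  then show ?thesis
    unfolding cb_supported_def using assms(2) by (intro exI[of _ A]) simp
qed

lemma cb_supported_add:
  fixes f g :: "'g::topological_space \<Rightarrow> 'b::monoid_add"
  assumes "cb_supported f" "cb_supported g"
  shows "cb_supported (\<lambda>x. f x + g x)"
proof -
  obtain A B where A: "incseq A" "range A \<subseteq> compacted_borel" "\<And>x. x \<notin> (\<Union>n. A n) \<Longrightarrow> f x = 0"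
    and B: "incseq B" "range B \<subseteq> compacted_borel" "\<And>x. x \<notin> (\<Union>n. B n) \<Longrightarrow> g x = 0"
    using assms unfolding cb_supported_def by metis
  have "incseq (\<lambda>n. A n \<union> B n)"
    using A(1) B(1) unfolding incseq_def by blast
  moreover have "range (\<lambda>n. A n \<union> B n) \<subseteq> compacted_borel"
    using A(2) B(2) by (auto intro!: cb_Un)
  moreover have "f x + g x = 0" if "x \<notin> (\<Union>n. A n \<union> B n)" for x
    using A(3)[of x] B(3)[of x] that by auto
  ultimately show ?thesis unfolding cb_supported_def by blast
qed

text \<open>A Borel function has the same integral for a measure and for its completion; from here
  on completions disappear.\<close>

lemma lebesgue_integral_complete_on:
  fixes f :: "'g::topological_space \<Rightarrow> complex"
  assumes \<tau>: "cb_premeasure \<tau>" and A: "A \<in> compacted_borel" and f: "f \<in> borel_measurable borel"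
  shows "(LINT x|complete_on A \<tau>. f x) = (\<integral>x. indicator A x *\<^sub>R f x \<partial>borel_extension \<tau>)"
proof -
  have "f \<in> borel_measurable (restrict_space (borel_extension \<tau>) A)"
    using f by (intro measurable_restrict_space1) (simp add: measurable_def)
  then show ?thesis
    unfolding complete_on_eq[OF \<tau> A] using A
    by (simp add: integral_completion integral_restrict_space cb_sets)
qed

lemma cb_integral_on_eq:
  assumes \<nu>: "cb_additive \<nu>" and A: "A \<in> compacted_borel" and f: "f \<in> borel_measurable borel"
  shows "cb_integral_on \<nu> A f = (\<Sum>k<4. \<i> ^ k * (\<integral>x. indicator A x *\<^sub>R f x \<partial>jordan_part \<nu> k))"
proof -
  have *: "(LINT x|complete_on A (positive_part (\<lambda>A. Re (\<nu> A * (- \<i>) ^ k))). f x) =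
      (\<integral>x. indicator A x *\<^sub>R f x \<partial>jordan_part \<nu> k)" for k
    unfolding jordan_part_def
    by (intro lebesgue_integral_complete_on cb_premeasure_positive_part cb_additive_Re_mult \<nu> A f)
  have [simp]: "(\<lambda>A. Re (\<nu> A * (- \<i>) ^ 2)) = (\<lambda>B. - Re (\<nu> B))"
      "(\<lambda>A. Re (\<nu> A * (- \<i>) ^ 3)) = (\<lambda>B. - Im (\<nu> B))"
    by (simp_all add: power3_eq_cube)
  show ?thesis
    using *[of 0] *[of 1] *[of 2] *[of 3]
    by (simp add: cb_integral_on_def eval_nat_numeral algebra_simps)
qed

lemma nn_integral_complete_on:
  assumes \<tau>: "cb_premeasure \<tau>" and A: "A \<in> compacted_borel"
  shows "(\<integral>\<^sup>+x. u x \<partial>complete_on A \<tau>) = (\<integral>\<^sup>+x. u x * indicator A x \<partial>borel_extension \<tau>)"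
  unfolding complete_on_eq[OF \<tau> A] nn_integral_completion
  by (rule nn_integral_restrict_space) (simp add: cb_sets[OF A])

lemma integrable_jordan_part:
  fixes f :: "'g::topological_space \<Rightarrow> 'b::{banach, second_countable_topology}"
  assumes "cb_additive \<nu>" "integrable (variation_measure \<nu>) f"
  shows "integrable (jordan_part \<nu> k) f"
proof (rule integrable_measure_mono[OF _ _ assms(2)])
  show "emeasure (jordan_part \<nu> k) A \<le> emeasure (variation_measure \<nu>) A" if "A \<in> sets (jordan_part \<nu> k)" for A
    using that by (intro jordan_part_le_variation assms(1)) simp
qed simp

text \<open>Cutting off along an exhaustion converges monotonically for the variation and
  dominatedly, by the modulus of \<open>f\<close>, for the Jordan parts. The exhaustion is
  arbitrary, as uniqueness of the integral requires.\<close>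

lemma cb_exhaustion_limits:
  fixes f :: "'g::topological_space \<Rightarrow> complex"
  assumes \<nu>: "cb_additive \<nu>" and f: "f \<in> borel_measurable borel" and int: "integrable (variation_measure \<nu>) f"
    and A: "incseq A" "range A \<subseteq> compacted_borel" "\<And>x. x \<notin> (\<Union>n. A n) \<Longrightarrow> f x = 0"
  shows "L1_exhaustion \<nu> f A"
    and "(\<lambda>n. cb_integral_on \<nu> (A n) f) \<longlonglongrightarrow> (\<Sum>k<4. \<i> ^ k * (\<integral>x. f x \<partial>jordan_part \<nu> k))"
proof -
  have An: "A n \<in> compacted_borel" for n using A(2) by auto
  note [measurable] = An[THEN cb_sets] f
  have ev: "\<forall>\<^sub>F n in sequentially. indicator (A n) x *\<^sub>R f x = f x" for x
  proof (cases "x \<in> (\<Union>n. A n)")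
    case True
    then obtain n where "x \<in> A n" by auto
    then have "x \<in> A i" if "n \<le> i" for i using incseqD[OF A(1) that] by auto
    then show ?thesis by (intro eventually_sequentiallyI[of n]) simp
  qed (use A(3) in simp)
  have lim: "(\<lambda>n. indicator (A n) x *\<^sub>R f x) \<longlonglongrightarrow> f x" for x
    by (rule tendsto_eventually[OF ev])
  have "(\<lambda>n. \<integral>\<^sup>+x. ennreal (cmod (f x)) * indicator (A n) x \<partial>variation_measure \<nu>) \<longlonglongrightarrow>
      (\<integral>\<^sup>+x. ennreal (cmod (f x)) \<partial>variation_measure \<nu>)"
  proof (rule nn_integral_LIMSEQ)
    show "incseq (\<lambda>n x. ennreal (cmod (f x)) * indicator (A n) x)"
      using A(1) by (auto simp: incseq_def le_fun_def indicator_def)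
    show "(\<lambda>n. ennreal (cmod (f x)) * indicator (A n) x) \<longlonglongrightarrow> ennreal (cmod (f x))" for x
      by (rule tendsto_eventually, rule eventually_mono[OF ev[of x]]) (auto simp: indicator_def)
  qed measurable
  moreover have "(\<integral>\<^sup>+x. ennreal (cmod (f x)) \<partial>variation_measure \<nu>) < \<infinity>"
    using int by (simp add: integrable_iff_bounded)
  ultimately show "L1_exhaustion \<nu> f A"
    unfolding L1_exhaustion_def using A nn_integral_complete_on[OF cb_premeasure_variation[OF \<nu>] An]
    by (auto simp: variation_measure_def)
  have "(\<lambda>n. \<integral>x. indicator (A n) x *\<^sub>R f x \<partial>jordan_part \<nu> k) \<longlonglongrightarrow> (\<integral>x. f x \<partial>jordan_part \<nu> k)" for k
  proof (rule integral_dominated_convergence[where w = "\<lambda>x. cmod (f x)"])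
    show "integrable (jordan_part \<nu> k) (\<lambda>x. cmod (f x))"
      using integrable_jordan_part[OF \<nu> int] by auto
  qed (auto intro!: AE_I2 lim simp: mult_left_le_one_le)
  then show "(\<lambda>n. cb_integral_on \<nu> (A n) f) \<longlonglongrightarrow> (\<Sum>k<4. \<i> ^ k * (\<integral>x. f x \<partial>jordan_part \<nu> k))"
    unfolding cb_integral_on_eq[OF \<nu> An f] by (intro tendsto_intros)
qed

text \<open>Every exhaustion of \<open>f\<close> has the same limit, which settles the definite
  description in \<open>cb_integral\<close>.\<close>

lemma cb_integral_jordan_part:
  fixes f :: "'g::topological_space \<Rightarrow> complex"
  assumes \<nu>: "cb_additive \<nu>" and f: "f \<in> borel_measurable borel" and int: "integrable (variation_measure \<nu>) f"
    and supp: "cb_supported f"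
  shows "f \<in> L1 \<nu>" and "cb_integral \<nu> f = (\<Sum>k<4. \<i> ^ k * (\<integral>x. f x \<partial>jordan_part \<nu> k))"
proof -
  obtain A where A: "incseq A" "range A \<subseteq> compacted_borel" "\<And>x. x \<notin> (\<Union>n. A n) \<Longrightarrow> f x = 0"
    using supp unfolding cb_supported_def by metis
  note lims = cb_exhaustion_limits[OF \<nu> f int]
  have "f \<in> borel_measurable (complete_on A (variation \<nu>))" if "A \<in> compacted_borel" for A
    unfolding complete_on_eq[OF cb_premeasure_variation[OF \<nu>] that]
    using f by (intro measurable_completion measurable_restrict_space1) (simp add: measurable_def)
  then show "f \<in> L1 \<nu>"
    using lims(1)[OF A] by (auto simp: L1_def locally_measurable_def)
  show "cb_integral \<nu> f = (\<Sum>k<4. \<i> ^ k * (\<integral>x. f x \<partial>jordan_part \<nu> k))"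
    unfolding cb_integral_def
  proof (rule the_equality)
    show "\<exists>A. L1_exhaustion \<nu> f A \<and>
        (\<lambda>n. cb_integral_on \<nu> (A n) f) \<longlonglongrightarrow> (\<Sum>k<4. \<i> ^ k * (\<integral>x. f x \<partial>jordan_part \<nu> k))"
      using lims[OF A] by blast
    fix I assume "\<exists>A. L1_exhaustion \<nu> f A \<and> (\<lambda>n. cb_integral_on \<nu> (A n) f) \<longlonglongrightarrow> I"
    then obtain B where B: "L1_exhaustion \<nu> f B" "(\<lambda>n. cb_integral_on \<nu> (B n) f) \<longlonglongrightarrow> I" by blast
    have "(\<lambda>n. cb_integral_on \<nu> (B n) f) \<longlonglongrightarrow> (\<Sum>k<4. \<i> ^ k * (\<integral>x. f x \<partial>jordan_part \<nu> k))"
      using B(1) by (intro lims(2)) (auto simp: L1_exhaustion_def)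
    then show "I = (\<Sum>k<4. \<i> ^ k * (\<integral>x. f x \<partial>jordan_part \<nu> k))"
      using B(2) LIMSEQ_unique by blast
  qed
qed

text \<open>Integrability for each \<open>M k\<close> passes to the variation and hence to the
  Jordan parts; then the two representations of \<nu> are compared. Later integrals are computed
  from whichever representation is at hand.\<close>

lemma represents_cb_integral:
  fixes f :: "'g::topological_space \<Rightarrow> complex"
  assumes KM: "represents K c M \<nu>" and f: "f \<in> borel_measurable borel"
    and fM: "\<And>k. k \<in> K \<Longrightarrow> integrable (M k) f" and supp: "cb_supported f"
  shows "f \<in> L1 \<nu>" and "cb_integral \<nu> f = (\<Sum>k\<in>K. c k * (\<integral>x. f x \<partial>M k))"
proof -
  note \<nu> = represents_cb_additive[OF KM]
  note int = represents_integrable_variation[OF KM f fM]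
  show "f \<in> L1 \<nu>" by (rule cb_integral_jordan_part[OF \<nu> f int supp])
  obtain A where A: "incseq A" "range A \<subseteq> compacted_borel" "\<And>x. x \<notin> (\<Union>n. A n) \<Longrightarrow> f x = 0"
    using supp unfolding cb_supported_def by metis
  have "cb_integral \<nu> f = (\<Sum>k<4. \<i> ^ k * (\<integral>x. f x \<partial>jordan_part \<nu> k))"
    by (rule cb_integral_jordan_part[OF \<nu> f int supp])
  also have "\<dots> = (\<Sum>k\<in>K. c k * (\<integral>x. f x \<partial>M k))"
    by (rule represents_integral_eq[OF represents_jordan_part[OF \<nu>] KM f _ fM A])
      (auto intro: integrable_jordan_part[OF \<nu> int])
  finally show "cb_integral \<nu> f = (\<Sum>k\<in>K. c k * (\<integral>x. f x \<partial>M k))" .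
qed

lemma cb_integral_add:
  fixes f g :: "'g::topological_space \<Rightarrow> complex"
  assumes \<nu>: "cb_additive \<nu>"
    and f: "f \<in> borel_measurable borel" "integrable (variation_measure \<nu>) f" "cb_supported f"
    and g: "g \<in> borel_measurable borel" "integrable (variation_measure \<nu>) g" "cb_supported g"
  shows "cb_integral \<nu> (\<lambda>x. f x + g x) = cb_integral \<nu> f + cb_integral \<nu> g"
proof -
  have "(\<lambda>x. f x + g x) \<in> borel_measurable borel" using f(1) g(1) by measurable
  then have "cb_integral \<nu> (\<lambda>x. f x + g x) =
      (\<Sum>k<4. \<i> ^ k * (\<integral>x. f x + g x \<partial>jordan_part \<nu> k))"
    using f g by (intro cb_integral_jordan_part[OF \<nu>] cb_supported_add) auto
  then show ?thesis
    using f g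
    by (simp add: cb_integral_jordan_part(2)[OF \<nu>] integrable_jordan_part[OF \<nu>] distrib_left sum.distrib)
qed

lemma cb_integral_cmult:
  fixes f :: "'g::topological_space \<Rightarrow> complex"
  assumes \<nu>: "cb_additive \<nu>"
    and f: "f \<in> borel_measurable borel" "integrable (variation_measure \<nu>) f" "cb_supported f"
  shows "cb_integral \<nu> (\<lambda>x. c * f x) = c * cb_integral \<nu> f"
proof -
  have "(\<lambda>x. c * f x) \<in> borel_measurable borel" using f(1) by measurable
  then have "cb_integral \<nu> (\<lambda>x. c * f x) =
      (\<Sum>k<4. \<i> ^ k * (\<integral>x. c * f x \<partial>jordan_part \<nu> k))"
    using f cb_supported_zero[OF f(3), of "\<lambda>x. c * f x"]
    by (intro cb_integral_jordan_part[OF \<nu>]) auto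
  then show ?thesis
    using f
    by (simp add: cb_integral_jordan_part(2)[OF \<nu>] integrable_jordan_part[OF \<nu>] sum_distrib_left mult_ac)
qed

lemma represents_add:
  assumes KM: "represents K c M \<mu>" and LN: "represents L d N \<nu>"
    and eq: "\<And>A. A \<in> compacted_borel \<Longrightarrow> \<kappa> A = \<mu> A + \<nu> A"
  shows "represents (K <+> L) (case_sum c d) (case_sum M N) \<kappa>"
  unfolding represents_def
  using eq representsD[OF KM] representsD[OF LN] by (auto simp: sum.Plus)

lemma represents_cmult:
  assumes KM: "represents K d M \<nu>" and eq: "\<And>A. A \<in> compacted_borel \<Longrightarrow> \<kappa> A = c * \<nu> A"
  shows "represents K (\<lambda>k. c * d k) M \<kappa>"
  unfolding represents_def
  using eq representsD[OF KM] by (auto simp: sum_distrib_left mult_ac)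

text \<open>The Jordan parts of a sum are not the sums of the Jordan parts, so the sum is
  represented by the eight parts of its two summands instead.\<close>

lemma cb_integral_measure_add:
  fixes f :: "'g::topological_space \<Rightarrow> complex"
  assumes \<mu>: "cb_additive \<mu>" and \<nu>: "cb_additive \<nu>" and f: "f \<in> borel_measurable borel"
    and int: "integrable (variation_measure \<mu>) f" "integrable (variation_measure \<nu>) f"
    and supp: "cb_supported f"
    and eq: "\<And>A. A \<in> compacted_borel \<Longrightarrow> \<kappa> A = \<mu> A + \<nu> A"
  shows "cb_integral \<kappa> f = cb_integral \<mu> f + cb_integral \<nu> f"
proof -
  have "cb_integral \<kappa> f =
      (\<Sum>k\<in>{..<4} <+> {..<4}. case_sum (\<lambda>k. \<i> ^ k) (\<lambda>k. \<i> ^ k) k *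
        (\<integral>x. f x \<partial>case_sum (jordan_part \<mu>) (jordan_part \<nu>) k))"
    by (rule represents_cb_integral[OF
          represents_add[OF represents_jordan_part[OF \<mu>] represents_jordan_part[OF \<nu>] eq] f _ supp])
      (auto simp: integrable_jordan_part[OF \<mu> int(1)] integrable_jordan_part[OF \<nu> int(2)])
  then show ?thesis
    by (simp add: sum.Plus cb_integral_jordan_part(2)[OF \<mu> f int(1) supp] cb_integral_jordan_part(2)[OF \<nu> f int(2) supp])
qed

lemma cb_integral_measure_cmult:
  fixes f :: "'g::topological_space \<Rightarrow> complex"
  assumes \<nu>: "cb_additive \<nu>" and f: "f \<in> borel_measurable borel"
    and int: "integrable (variation_measure \<nu>) f" and supp: "cb_supported f"
    and eq: "\<And>A. A \<in> compacted_borel \<Longrightarrow> \<kappa> A = c * \<nu> A"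
  shows "cb_integral \<kappa> f = c * cb_integral \<nu> f"
proof -
  have "cb_integral \<kappa> f = (\<Sum>k<4. (c * \<i> ^ k) * (\<integral>x. f x \<partial>jordan_part \<nu> k))"
    by (rule represents_cb_integral[OF represents_cmult[OF represents_jordan_part[OF \<nu>] eq] f
          integrable_jordan_part[OF \<nu> int] supp])
  then show ?thesis
    by (simp add: cb_integral_jordan_part(2)[OF \<nu> f int supp] sum_distrib_left mult_ac)
qed

text \<open>\<open>integral_combination_le\<close> with the variation as dominating measure; its
  hypothesis is that the modulus of a value is at most the variation of the set.\<close>

lemma cmod_cb_integral_le:
  fixes f :: "'g::topological_space \<Rightarrow> complex"
  assumes \<nu>: "cb_additive \<nu>" and f: "f \<in> borel_measurable borel"
    and int: "integrable (variation_measure \<nu>) f" and supp: "cb_supported f"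
  shows "cmod (cb_integral \<nu> f) \<le> (\<integral>x. cmod (f x) \<partial>variation_measure \<nu>)"
proof -
  obtain A where A: "incseq A" "range A \<subseteq> compacted_borel" "\<And>x. x \<notin> (\<Union>n. A n) \<Longrightarrow> f x = 0"
    using supp unfolding cb_supported_def by metis
  note V = cb_finite_variation_measure[OF \<nu>]
  have "cmod (\<Sum>k<4. \<i> ^ k * (\<integral>x. f x \<partial>jordan_part \<nu> k)) \<le> (\<integral>x. cmod (f x) \<partial>variation_measure \<nu>)"
  proof (rule integral_combination_le[OF _ cb_finite_jordan_part[OF \<nu>] V _ f integrable_jordan_part[OF \<nu> int] int A])
    fix A :: "'g set" assume A: "A \<in> compacted_borel"
    have "ennreal (cmod (\<nu> A)) \<le> ennreal (measure (variation_measure \<nu>) A)"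
      using variation_ge[OF A, of \<nu>] cb_finite_measureD(4)[OF V A] emeasure_variation_measure_cb[OF \<nu> A]
      by simp
    then show "cmod (\<Sum>k<4. \<i> ^ k * of_real (measure (jordan_part \<nu> k) A)) \<le> measure (variation_measure \<nu>) A"
      using representsD(3)[OF represents_jordan_part[OF \<nu>] A] by simp
  qed auto
  then show ?thesis by (simp add: cb_integral_jordan_part(2)[OF assms])
qed

lemma has_bochner_integral_indicator_cb:
  assumes "cb_finite_measure M" "A \<in> compacted_borel"
  shows "has_bochner_integral M (indicator A) (complex_of_real (measure M A))"
proof -
  have "has_bochner_integral M (\<lambda>x. indicator A x *\<^sub>R (1::complex)) (measure M A *\<^sub>R 1)"
    using cb_finite_measureD[OF assms(1)] assms(2)
    by (intro has_bochner_integral_indicator) (simp_all add: cb_sets)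
  moreover have "(\<lambda>x. indicator A x *\<^sub>R (1::complex)) = indicator A"
    by (auto simp: indicator_def)
  ultimately show ?thesis by (simp add: of_real_def)
qed

lemma cb_integral_indicator:
  assumes \<nu>: "cb_additive \<nu>" and A: "A \<in> compacted_borel"
  shows "cb_integral \<nu> (indicator A) = \<nu> A"
proof -
  note J = has_bochner_integral_indicator_cb[OF cb_finite_jordan_part[OF \<nu>] A]
  have "cb_integral \<nu> (indicator A) = (\<Sum>k<4. \<i> ^ k * (\<integral>x. indicator A x \<partial>jordan_part \<nu> k))"
  proof (rule represents_cb_integral(2)[OF represents_jordan_part[OF \<nu>]])
    show "cb_supported (indicator A :: 'a \<Rightarrow> complex)" by (rule cb_supported_cb[OF A]) simp
  qed (use J A in \<open>auto simp: has_bochner_integral_iff intro!: borel_measurable_indicator cb_sets\<close>)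
  also have "\<dots> = \<nu> A"
    using J by (simp add: has_bochner_integral_iff representsD(3)[OF represents_jordan_part[OF \<nu>] A])
  finally show ?thesis .
qed

section \<open>Densities\<close>

text \<open>Local boundedness is what \<omega> and 1/\<omega> share; neither need be bounded on the
  whole group. It makes densities finite on compacted Borel sets.\<close>

definition cb_bounded :: "('g::topological_space \<Rightarrow> real) \<Rightarrow> bool" where
  "cb_bounded h \<longleftrightarrow> h \<in> borel_measurable borel \<and> (\<forall>x. 0 \<le> h x) \<and>
     (\<forall>A\<in>compacted_borel. \<exists>b. \<forall>x\<in>A. h x \<le> b)"

lemma cb_bounded_continuous:
  fixes h :: "'g::topological_space \<Rightarrow> real"
  assumes h: "continuous_on UNIV h" and "\<And>x. 0 \<le> h x"
  shows "cb_bounded h"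
  unfolding cb_bounded_def
proof (intro conjI ballI)
  show "h \<in> borel_measurable borel" using h by (rule borel_measurable_continuous_onI)
  fix A :: "'g set" assume "A \<in> compacted_borel"
  then have "compact (h ` closure A)"
    using continuous_on_subset[OF h] by (intro compact_continuous_image) (auto simp: compacted_borel_def)
  then obtain b where "\<And>y. y \<in> h ` closure A \<Longrightarrow> norm y \<le> b"
    using compact_imp_bounded bounded_iff by metis
  then have "h x \<le> b" if "x \<in> A" for x
    using that closure_subset[of A] by (force simp: abs_le_iff)
  then show "\<exists>b. \<forall>x\<in>A. h x \<le> b" by blast
qed (use assms in auto)

lemma cb_bounded_integrable:
  assumes h: "cb_bounded h" and M: "cb_finite_measure M" and A: "A \<in> compacted_borel"
  shows "integrable M (\<lambda>x. indicator A x * h x)"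
proof -
  obtain b where b: "\<And>x. x \<in> A \<Longrightarrow> h x \<le> b" using h A unfolding cb_bounded_def by metis
  note [measurable_cong] = cb_finite_measureD(1)[OF M]
  have [measurable]: "h \<in> borel_measurable borel" "A \<in> sets borel"
    using h A by (auto simp: cb_bounded_def cb_sets)
  show ?thesis
  proof (rule Bochner_Integration.integrable_bound)
    show "integrable M (\<lambda>x. indicator A x *\<^sub>R b)"
      using has_bochner_integral_indicator[of A M b] cb_finite_measureD[OF M] A
      by (auto simp: has_bochner_integral_iff cb_sets)
    show "AE x in M. norm (indicator A x * h x) \<le> norm (indicator A x *\<^sub>R b)"
      using b h by (auto simp: indicator_def cb_bounded_def intro!: AE_I2 order_trans[OF b abs_ge_self])
  qed measurable
qed

lemma cb_bounded_density:
  assumes h: "cb_bounded h" and M: "cb_finite_measure M"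
  shows "cb_finite_measure (density M h)"
    and "A \<in> compacted_borel \<Longrightarrow> measure (density M h) A = (\<integral>x. indicator A x * h x \<partial>M)"
proof -
  note [measurable_cong] = cb_finite_measureD(1)[OF M]
  have [measurable]: "h \<in> borel_measurable borel" and nn: "\<And>x. 0 \<le> h x"
    using h by (auto simp: cb_bounded_def)
  have *: "emeasure (density M h) A = ennreal (\<integral>x. indicator A x * h x \<partial>M)" if A: "A \<in> compacted_borel" for A
  proof -
    have [measurable]: "A \<in> sets borel" using A by (rule cb_sets)
    have "emeasure (density M h) A = (\<integral>\<^sup>+x. ennreal (indicator A x * h x) \<partial>M)"
      by (subst emeasure_density) (auto intro!: nn_integral_cong simp: indicator_def)
    also have "\<dots> = ennreal (\<integral>x. indicator A x * h x \<partial>M)"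
      using cb_bounded_integrable[OF h M A] nn by (intro nn_integral_eq_integral) auto
    finally show ?thesis .
  qed
  show "cb_finite_measure (density M h)"
    unfolding cb_finite_measure_def using * cb_finite_measureD(1)[OF M] by simp
  show "A \<in> compacted_borel \<Longrightarrow> measure (density M h) A = (\<integral>x. indicator A x * h x \<partial>M)"
    using * nn by (simp add: measure_def integral_nonneg_AE)
qed

text \<open>Multiplying every representing measure by \<open>h\<close> represents the density
  measure, so its additivity, regularity and inversion reduce to facts about densities of positive
  measures.\<close>

lemma represents_density_measure:
  assumes KM: "represents K c M \<nu>" and h: "cb_bounded h"
  shows "represents K c (\<lambda>k. density (M k) h) (density_measure (\<lambda>x. of_real (h x)) \<nu>)"
  unfolding represents_def
proof (intro conjI ballI)
  note D = representsD[OF KM]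
  show "finite K" by (rule D)
  show "cb_finite_measure (density (M k) h)" if "k \<in> K" for k
    by (rule cb_bounded_density[OF h D(2)[OF that]])
  fix A :: "'b set" assume A: "A \<in> compacted_borel"
  have [measurable]: "h \<in> borel_measurable borel" "A \<in> sets borel"
    using h A by (auto simp: cb_bounded_def cb_sets)
  have eq: "(\<lambda>x. complex_of_real (h x) * indicator A x) = (\<lambda>x. of_real (indicator A x * h x))"
    by (auto simp: indicator_def)
  have "density_measure (\<lambda>x. of_real (h x)) \<nu> A = cb_integral \<nu> (\<lambda>x. of_real (h x) * indicator A x)"
    using A by (simp add: density_measure_def)
  also have "\<dots> = (\<Sum>k\<in>K. c k * (\<integral>x. of_real (h x) * indicator A x \<partial>M k))"
  proof (rule represents_cb_integral[OF KM])
    show "integrable (M k) (\<lambda>x. complex_of_real (h x) * indicator A x)" if "k \<in> K" for k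
      unfolding eq using cb_bounded_integrable[OF h D(2)[OF that] A] by (rule integrable_of_real)
    show "cb_supported (\<lambda>x. complex_of_real (h x) * indicator A x)"
      by (rule cb_supported_cb[OF A]) simp
  qed measurable
  also have "\<dots> = (\<Sum>k\<in>K. c k * of_real (measure (density (M k) h) A))"
    unfolding eq by (intro sum.cong refl) (simp add: cb_bounded_density(2)[OF h D(2) A] del: of_real_mult)
  finally show "density_measure (\<lambda>x. of_real (h x)) \<nu> A = (\<Sum>k\<in>K. c k * of_real (measure (density (M k) h) A))" .
qed

lemma density_measure_extensional [simp]: "density_measure h \<nu> \<in> extensional compacted_borel"
  by (simp add: density_measure_def)

lemma cb_additive_density_measure:
  "cb_additive \<nu> \<Longrightarrow> cb_bounded h \<Longrightarrow> cb_additive (density_measure (\<lambda>x. of_real (h x)) \<nu>)"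
  by (rule represents_cb_additive[OF represents_density_measure[OF represents_jordan_part]])

text \<open>Integrability is asked on the side of \<nu>, where \<open>weighted_integrable\<close>
  provides it; for each Jordan part the formula is the usual change of density.\<close>

lemma cb_integral_density_measure:
  fixes f :: "'g::topological_space \<Rightarrow> complex"
  assumes \<nu>: "cb_additive \<nu>" and h: "cb_bounded h" and f: "f \<in> borel_measurable borel"
    and int: "integrable (variation_measure \<nu>) (\<lambda>x. of_real (h x) * f x)" and supp: "cb_supported f"
  shows "cb_integral (density_measure (\<lambda>x. of_real (h x)) \<nu>) f = cb_integral \<nu> (\<lambda>x. of_real (h x) * f x)"
proof -
  have [measurable]: "h \<in> borel_measurable borel" and nn: "\<And>x. 0 \<le> h x"
    using h by (auto simp: cb_bounded_def)
  note [measurable] = f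
  have "cb_integral (density_measure (\<lambda>x. of_real (h x)) \<nu>) f =
      (\<Sum>k<4. \<i> ^ k * (\<integral>x. f x \<partial>density (jordan_part \<nu> k) h))"
  proof (rule represents_cb_integral[OF represents_density_measure[OF represents_jordan_part[OF \<nu>] h] f _ supp])
    show "integrable (density (jordan_part \<nu> k) h) f" for k
      using integrable_jordan_part[OF \<nu> int] nn
      by (subst integrable_density) (auto simp: scaleR_conv_of_real)
  qed
  also have "\<dots> = (\<Sum>k<4. \<i> ^ k * (\<integral>x. of_real (h x) * f x \<partial>jordan_part \<nu> k))"
    using nn by (subst integral_density) (auto simp: scaleR_conv_of_real)
  also have "\<dots> = cb_integral \<nu> (\<lambda>x. of_real (h x) * f x)"
    using cb_supported_zero[OF supp, of "\<lambda>x. of_real (h x) * f x"]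
    by (intro cb_integral_jordan_part(2)[symmetric] \<nu> int) auto
  finally show ?thesis .
qed

text \<open>On each Jordan part the two densities multiply to 1; extensionality turns agreement on
  compacted Borel sets into equality.\<close>

lemma density_measure_inverse:
  assumes \<nu>: "cb_additive \<nu>" "\<nu> \<in> extensional compacted_borel" and h: "cb_bounded h" and g: "cb_bounded g"
    and gh: "\<And>x. h x * g x = 1"
  shows "density_measure (\<lambda>x. of_real (g x)) (density_measure (\<lambda>x. of_real (h x)) \<nu>) = \<nu>"
proof (rule extensionalityI[OF density_measure_extensional \<nu>(2)])
  fix A :: "'a set" assume A: "A \<in> compacted_borel"
  have [measurable]: "h \<in> borel_measurable borel" "g \<in> borel_measurable borel"
    using h g by (auto simp: cb_bounded_def)
  have "density (density (jordan_part \<nu> k) h) g = jordan_part \<nu> k" for k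
  proof -
    have "ennreal (h x) * ennreal (g x) = 1" for x
      using gh[of x] g h by (simp add: cb_bounded_def flip: ennreal_mult)
    then show ?thesis by (simp add: density_density_eq density_1)
  qed
  then show "density_measure (\<lambda>x. of_real (g x)) (density_measure (\<lambda>x. of_real (h x)) \<nu>) A = \<nu> A"
    using representsD(3)[OF represents_density_measure[OF represents_density_measure[OF
            represents_jordan_part[OF \<nu>(1)] h] g] A]
      representsD(3)[OF represents_jordan_part[OF \<nu>(1)] A]
    by simp
qed

text \<open>By \<open>cmod_cb_integral_le\<close> the measure with density \<open>h\<close> over the
  variation dominates the modulus of the density measure, and the variation is minimal. Taking
  1/\<omega> for \<open>h\<close> and \<omega>\<nu> for \<nu> bounds |\<nu>| by
  (1/\<omega>)|\<omega>\<nu>|.\<close>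

lemma variation_density_measure_le:
  assumes \<nu>: "cb_additive \<nu>" and h: "cb_bounded h" and A: "A \<in> sets borel"
  shows "emeasure (variation_measure (density_measure (\<lambda>x. of_real (h x)) \<nu>)) A \<le>
    emeasure (density (variation_measure \<nu>) h) A"
  unfolding variation_measure_def[of "density_measure _ \<nu>"]
proof (rule emeasure_borel_extension_le[OF cb_premeasure_variation[OF cb_additive_density_measure[OF \<nu> h]] A])
  let ?D = "density (variation_measure \<nu>) h"
  note V = cb_finite_variation_measure[OF \<nu>]
  note D = cb_bounded_density(1)[OF h V]
  fix B assume B: "B \<in> compacted_borel" "B \<subseteq> A"
  have [measurable]: "h \<in> borel_measurable borel" and nn: "\<And>x. 0 \<le> h x"
    using h by (auto simp: cb_bounded_def)
  have "variation (density_measure (\<lambda>x. of_real (h x)) \<nu>) B \<le> emeasure ?D B"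
  proof (rule variation_le)
    show "cb_premeasure (emeasure ?D)"
      unfolding cb_premeasure_def by (auto intro!: suminf_emeasure simp: cb_sets image_subset_iff)
    fix C :: "'a set" assume C: "C \<in> compacted_borel"
    have eq: "(\<lambda>x. complex_of_real (h x) * indicator C x) = (\<lambda>x. of_real (indicator C x * h x))"
      by (auto simp: indicator_def)
    have [measurable]: "C \<in> sets borel" using C by (rule cb_sets)
    have "cmod (density_measure (\<lambda>x. of_real (h x)) \<nu> C) \<le>
        (\<integral>x. cmod (of_real (h x) * indicator C x) \<partial>variation_measure \<nu>)"
      using C cb_bounded_integrable[OF h V C]
      by (simp add: density_measure_def)
        (intro cmod_cb_integral_le[OF \<nu>] cb_supported_cb[OF C]; simp add: eq integrable_of_real del: of_real_mult)
    also have "\<dots> = (\<integral>x. indicator C x * h x \<partial>variation_measure \<nu>)"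
      using nn by (intro Bochner_Integration.integral_cong) (auto simp: indicator_def)
    also have "\<dots> = measure ?D C"
      by (rule cb_bounded_density(2)[OF h V C, symmetric])
    finally show "ennreal (cmod (density_measure (\<lambda>x. of_real (h x)) \<nu> C)) \<le> emeasure ?D C"
      using cb_finite_measureD(4)[OF D C] by (simp add: ennreal_leI)
  qed
  also have "\<dots> \<le> emeasure ?D A"
    using A B by (intro emeasure_mono) auto
  finally show "variation (density_measure (\<lambda>x. of_real (h x)) \<nu>) B \<le> emeasure ?D A" .
qed

section \<open>Nonnegative functions vanishing at infinity\<close>

text \<open>The Riesz construction works on this cone of real functions; an additive functional on
  it need not be extended to signed functions.\<close>

definition C0_pos :: "('g::topological_space \<Rightarrow> real) set" where
  "C0_pos = {f. continuous_on UNIV f \<and> (\<forall>x. 0 \<le> f x) \<and>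
     (\<forall>\<epsilon>>0. \<exists>K. compact K \<and> (\<forall>x. x \<notin> K \<longrightarrow> f x < \<epsilon>))}"

lemma C0_posD:
  assumes "f \<in> C0_pos"
  shows "continuous_on UNIV f" "0 \<le> f x" "\<epsilon> > 0 \<Longrightarrow> \<exists>K. compact K \<and> (\<forall>x. x \<notin> K \<longrightarrow> f x < \<epsilon>)"
  using assms by (auto simp: C0_pos_def)

lemma C0_pos_le:
  assumes f: "f \<in> C0_pos" and g: "continuous_on UNIV g" "\<And>x. 0 \<le> g x" "\<And>x. g x \<le> f x"
  shows "g \<in> C0_pos"
  unfolding C0_pos_def
proof (intro CollectI conjI allI impI)
  fix \<epsilon> :: real assume "0 < \<epsilon>"
  then obtain K where "compact K" "\<forall>x. x \<notin> K \<longrightarrow> f x < \<epsilon>"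
    using C0_posD(3)[OF f] by blast
  then show "\<exists>K. compact K \<and> (\<forall>x. x \<notin> K \<longrightarrow> g x < \<epsilon>)"
    using g(3) by (intro exI[of _ K]) (auto intro: le_less_trans)
qed (use g in auto)

lemma C0_pos_zero: "(\<lambda>_. 0) \<in> C0_pos"
  by (auto simp: C0_pos_def intro: exI[of _ "{}"])

lemma C0_pos_add:
  assumes f: "f \<in> C0_pos" and g: "g \<in> C0_pos"
  shows "(\<lambda>x. f x + g x) \<in> C0_pos"
  unfolding C0_pos_def
proof (intro CollectI conjI allI impI)
  fix \<epsilon> :: real assume "0 < \<epsilon>"
  then have "0 < \<epsilon> / 2" by simp
  obtain K L where K: "compact K" "\<forall>x. x \<notin> K \<longrightarrow> f x < \<epsilon> / 2" and L: "compact L" "\<forall>x. x \<notin> L \<longrightarrow> g x < \<epsilon> / 2"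
    using C0_posD(3)[OF f \<open>0 < \<epsilon> / 2\<close>] C0_posD(3)[OF g \<open>0 < \<epsilon> / 2\<close>] by blast
  have "f x + g x < \<epsilon>" if "x \<notin> K \<union> L" for x
    using K(2)[rule_format, of x] L(2)[rule_format, of x] that by simp
  then show "\<exists>K. compact K \<and> (\<forall>x. x \<notin> K \<longrightarrow> f x + g x < \<epsilon>)"
    using K(1) L(1) by (intro exI[of _ "K \<union> L"]) (auto intro: compact_Un)
qed (use C0_posD[OF f] C0_posD[OF g] in \<open>auto intro: continuous_intros\<close>)

lemma C0_pos_cmult_nat:
  assumes "f \<in> C0_pos"
  shows "(\<lambda>x. real n * f x) \<in> C0_pos"
proof (induction n)
  case (Suc n)
  then show ?case using C0_pos_add[OF assms Suc] by (simp add: algebra_simps)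
qed (simp add: C0_pos_zero)

lemma C0_pos_compact_ge:
  assumes f: "f \<in> C0_pos" and "0 < \<epsilon>"
  shows "compact {x. \<epsilon> \<le> f x}"
proof -
  obtain K where K: "compact K" "\<forall>x. x \<notin> K \<longrightarrow> f x < \<epsilon>"
    using C0_posD(3)[OF assms] by blast
  have "closed {x. \<epsilon> \<le> f x}"
    by (intro closed_Collect_le continuous_on_const C0_posD(1)[OF f])
  then have "compact (K \<inter> {x. \<epsilon> \<le> f x})" using K(1) by (rule compact_Int_closed[rotated])
  moreover have "K \<inter> {x. \<epsilon> \<le> f x} = {x. \<epsilon> \<le> f x}" using K(2) by (auto simp: not_less[symmetric])
  ultimately show ?thesis by simp
qed

lemma C0_pos_bounded:
  assumes f: "f \<in> C0_pos"
  obtains b where "0 < b" "\<And>x. f x \<le> b"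
proof -
  have "compact (f ` {x. 1 \<le> f x})"
    using C0_pos_compact_ge[OF f, of 1] continuous_on_subset[OF C0_posD(1)[OF f]]
    by (intro compact_continuous_image) auto
  then obtain b where b: "\<And>y. y \<in> f ` {x. 1 \<le> f x} \<Longrightarrow> norm y \<le> b"
    using compact_imp_bounded bounded_iff by metis
  have "f x \<le> max b 1" for x
    using b[of "f x"] by (cases "1 \<le> f x") auto
  then show thesis by (intro that[of "max b 1"]) auto
qed

lemma Hausdorff_space_t2: "Hausdorff_space (euclidean :: 'g::t2_space topology)"
  by (simp add: Hausdorff_space_def disjnt_def) (metis hausdorff)

lemma locally_compact_open_hull:
  fixes K :: "'g::t2_space set"
  assumes lc: "locally_compact_space (euclidean :: 'g topology)" and K: "compact K"
  obtains W L where "open W" "compact L" "K \<subseteq> W" "W \<subseteq> L"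
proof -
  obtain W L where "open W" "compact L" "K \<subseteq> W" "W \<subseteq> L"
    using lc K locally_compact_space_compact_closed_compact[OF disjI1[OF Hausdorff_space_t2[where 'g = 'g]]]
    by auto
  then show thesis by (rule that)
qed

lemma Urysohn_compact_open:
  fixes K U :: "'g::t2_space set"
  assumes lc: "locally_compact_space (euclidean :: 'g topology)" and K: "compact K" and U: "open U" "K \<subseteq> U"
  obtains u :: "'g \<Rightarrow> real" and L where "continuous_on UNIV u" "\<And>x. 0 \<le> u x" "\<And>x. u x \<le> 1"
    "\<And>x. x \<in> K \<Longrightarrow> u x = 1" "\<And>x. x \<notin> U \<Longrightarrow> u x = 0" "compact L" "\<And>x. x \<notin> L \<Longrightarrow> u x = 0"
proof -
  obtain W L where WL: "open W" "compact L" "K \<subseteq> W" "W \<subseteq> L"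
    using locally_compact_open_hull[OF lc K] .
  have cr: "completely_regular_space (euclidean :: 'g topology)"
    by (rule locally_compact_regular_imp_completely_regular_space[OF lc disjI1[OF Hausdorff_space_t2]])
  \<comment> \<open>The closed set is the complement of \<open>W \<inter> U\<close>, not of
    \<open>U\<close>: vanishing off \<open>W\<close> puts the support into the compact
    \<open>L\<close>.\<close>
  have sets: "compactin euclidean K" "closedin euclidean (- (W \<inter> U))" "disjnt K (- (W \<inter> U))"
    using K U WL by (auto simp: disjnt_def)
  obtain u :: "'g \<Rightarrow> real" where u: "continuous_map euclidean (subtopology euclidean {0..1}) u"
      "u ` (- (W \<inter> U)) \<subseteq> {0}" "u ` K \<subseteq> {1}"
    by (rule Urysohn_completely_regular_compact_closed[OF zero_le_one cr sets])
  show thesis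
  proof (rule that[of u L])
    show "continuous_on UNIV u" using u(1) by (simp add: continuous_map_in_subtopology)
    show "0 \<le> u x" "u x \<le> 1" for x using u(1) by (auto simp: continuous_map_in_subtopology)
    have "u x = 0" if "x \<notin> W \<inter> U" for x using u(2) that by blast
    then show "u x = 0" if "x \<notin> U" for x using that by blast
    show "u x = 0" if "x \<notin> L" for x using \<open>\<And>x. x \<notin> W \<inter> U \<Longrightarrow> u x = 0\<close>[of x] WL(4) that by blast
  qed (use u WL in auto)
qed

lemma C0_pos_compact_support:
  assumes "continuous_on UNIV u" "\<And>x. 0 \<le> u x" "compact L" "\<And>x. x \<notin> L \<Longrightarrow> u x = 0"
  shows "u \<in> C0_pos"
  using assms by (auto simp: C0_pos_def)

text \<open>Splitting along a Urysohn function replaces partitions of unity.\<close>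

lemma C0_pos_split:
  fixes K U V :: "'g::t2_space set"
  assumes lc: "locally_compact_space (euclidean :: 'g topology)" and g: "g \<in> C0_pos"
    and K: "compact K" "\<And>x. x \<notin> K \<Longrightarrow> g x = 0" and UV: "open U" "open V" "K \<subseteq> U \<union> V"
  obtains g1 g2 where "g1 \<in> C0_pos" "g2 \<in> C0_pos" "\<And>x. g x = g1 x + g2 x"
    "\<And>x. g1 x \<le> g x" "\<And>x. g2 x \<le> g x" "\<And>x. x \<notin> U \<Longrightarrow> g1 x = 0" "\<And>x. x \<notin> V \<Longrightarrow> g2 x = 0"
proof -
  \<comment> \<open>On \<open>K - V\<close> the function \<open>u\<close> will be 1, and off
    \<open>K\<close> the function \<open>g\<close> is 0; hence \<open>(1 - u) g\<close> vanishes off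
    \<open>V\<close>.\<close>
  have "compact (K - V)" "K - V \<subseteq> U" using K UV by (auto intro: compact_diff)
  then obtain u :: "'g \<Rightarrow> real" and L where u: "continuous_on UNIV u" "\<And>x. 0 \<le> u x" "\<And>x. u x \<le> 1"
      "\<And>x. x \<in> K - V \<Longrightarrow> u x = 1" "\<And>x. x \<notin> U \<Longrightarrow> u x = 0"
    using Urysohn_compact_open[OF lc _ UV(1), of "K - V"] by metis
  have le: "u x * g x \<le> g x" for x
    using u C0_posD(2)[OF g] by (simp add: mult_left_le_one_le)
  show thesis
  proof (rule that[of "\<lambda>x. u x * g x" "\<lambda>x. (1 - u x) * g x"])
    show "(\<lambda>x. u x * g x) \<in> C0_pos"
      using u C0_posD[OF g] le by (intro C0_pos_le[OF g] continuous_intros) auto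
    show le': "(1 - u x) * g x \<le> g x" for x
      using u C0_posD(2)[OF g] by (simp add: mult_left_le_one_le)
    show "(\<lambda>x. (1 - u x) * g x) \<in> C0_pos"
      using u C0_posD[OF g] le' by (intro C0_pos_le[OF g] continuous_intros) auto
    show "(1 - u x) * g x = 0" if "x \<notin> V" for x
      using that u(4)[of x] K(2)[of x] by auto
  qed (use u le in \<open>auto simp: algebra_simps\<close>)
qed

section \<open>The Riesz representation theorem for positive functionals\<close>

text \<open>An arbitrary upper bound \<open>c\<close> takes the place of a norm on the cone.
  Additivity supplies homogeneity for natural multiples, which is enough for the layer argument
  below.\<close>

locale C0_positive_functional =
  fixes \<Lambda> :: "('g::t2_space \<Rightarrow> real) \<Rightarrow> real" and B :: real
  assumes lc: "locally_compact_space (euclidean :: 'g topology)"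
    and nonneg: "f \<in> C0_pos \<Longrightarrow> 0 \<le> \<Lambda> f"
    and additive: "f \<in> C0_pos \<Longrightarrow> g \<in> C0_pos \<Longrightarrow> \<Lambda> (\<lambda>x. f x + g x) = \<Lambda> f + \<Lambda> g"
    and B_nonneg: "0 \<le> B"
    and bound: "f \<in> C0_pos \<Longrightarrow> (\<And>x. f x \<le> c) \<Longrightarrow> \<Lambda> f \<le> B * c"
begin

lemma mono:
  assumes f: "f \<in> C0_pos" and g: "g \<in> C0_pos" and le: "\<And>x. f x \<le> g x"
  shows "\<Lambda> f \<le> \<Lambda> g"
proof -
  have h: "(\<lambda>x. g x - f x) \<in> C0_pos"
    using C0_posD[OF f] C0_posD[OF g] le by (intro C0_pos_le[OF g] continuous_intros) auto
  show ?thesis using additive[OF f h] nonneg[OF h] by simp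
qed

lemma zero: "\<Lambda> (\<lambda>_. 0) = 0"
  using additive[OF C0_pos_zero C0_pos_zero] by simp

lemma cmult_nat: "f \<in> C0_pos \<Longrightarrow> \<Lambda> (\<lambda>x. real n * f x) = real n * \<Lambda> f"
proof (induction n)
  case (Suc n)
  then show ?case using additive[OF Suc.prems C0_pos_cmult_nat[OF Suc.prems, of n]]
    by (simp add: algebra_simps)
qed (simp add: zero)

lemma sum_C0_pos: "finite I \<Longrightarrow> (\<And>i. i \<in> I \<Longrightarrow> f i \<in> C0_pos) \<Longrightarrow>
  (\<lambda>x. \<Sum>i\<in>I. f i x) \<in> C0_pos \<and> \<Lambda> (\<lambda>x. \<Sum>i\<in>I. f i x) = (\<Sum>i\<in>I. \<Lambda> (f i))"
  by (induction I rule: finite_induct) (auto simp: zero C0_pos_zero C0_pos_add additive)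

text \<open>The part of \<open>f\<close> up to height \<delta> contributes at most
  \<open>B * \<delta>\<close>, and the rest vanishes off the compact set where \<open>f\<close> is
  at least \<delta>. This stands in for the density of compactly supported functions.\<close>

lemma truncate:
  assumes f: "f \<in> C0_pos" and "0 < e"
  obtains \<delta> where "0 < \<delta>" "(\<lambda>x. max 0 (f x - \<delta>)) \<in> C0_pos" "\<Lambda> f \<le> \<Lambda> (\<lambda>x. max 0 (f x - \<delta>)) + e"
proof -
  \<comment> \<open>The added 1 keeps the denominator positive when \<open>B\<close> is 0.\<close>
  define \<delta> where "\<delta> = e / (B + 1)"
  have \<delta>: "0 < \<delta>" "B * \<delta> \<le> e"
    using \<open>0 < e\<close> B_nonneg by (auto simp: \<delta>_def field_simps)
  have 1: "(\<lambda>x. max 0 (f x - \<delta>)) \<in> C0_pos" and 2: "(\<lambda>x. min (f x) \<delta>) \<in> C0_pos"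
    using C0_posD[OF f] \<delta> by (intro C0_pos_le[OF f] continuous_intros; auto)+
  have "(\<lambda>x. max 0 (f x - \<delta>) + min (f x) \<delta>) = f" by auto
  then have "\<Lambda> f = \<Lambda> (\<lambda>x. max 0 (f x - \<delta>)) + \<Lambda> (\<lambda>x. min (f x) \<delta>)"
    using additive[OF 1 2] by simp
  also have "\<Lambda> (\<lambda>x. min (f x) \<delta>) \<le> B * \<delta>" by (rule bound[OF 2]) simp
  finally show thesis using that[OF \<delta>(1) 1] \<delta>(2) by simp
qed

text \<open>Test functions may be positive up to the boundary of \<open>U\<close>;
  \<open>below_truncate\<close> retreats to a compact subset at arbitrarily small cost.\<close>

definition below :: "'g set \<Rightarrow> ('g \<Rightarrow> real) set" where
  "below U = {f \<in> C0_pos. \<forall>x. f x \<le> indicator U x}"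

definition open_content :: "'g set \<Rightarrow> ennreal" where
  "open_content U = (SUP f\<in>below U. ennreal (\<Lambda> f))"

text \<open>Outer regularity is built in here and is what \<open>riesz_measure_inner_regular\<close>
  later exploits.\<close>

definition outer :: "'g set \<Rightarrow> ennreal" where
  "outer E = (INF U\<in>{U. open U \<and> E \<subseteq> U}. open_content U)"

lemma below_zero: "(\<lambda>_. 0) \<in> below U"
  by (simp add: below_def C0_pos_zero)

lemma belowI: "f \<in> C0_pos \<Longrightarrow> (\<And>x. f x \<le> 1) \<Longrightarrow> (\<And>x. x \<notin> U \<Longrightarrow> f x = 0) \<Longrightarrow> f \<in> below U"
  by (auto simp: below_def indicator_def)

lemma belowD:
  assumes "f \<in> below U"
  shows "f \<in> C0_pos" "f x \<le> 1" "x \<notin> U \<Longrightarrow> f x = 0"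
proof -
  have f: "f \<in> C0_pos" "f x \<le> indicator U x" for x
    using assms by (auto simp: below_def)
  show "f \<in> C0_pos" by (rule f)
  show "f x \<le> 1" using f(2)[of x] by (rule order_trans) (simp add: indicator_def)
  show "f x = 0" if "x \<notin> U" using f(2)[of x] C0_posD(2)[OF f(1), of x] that by simp
qed

lemma content_upper: "f \<in> below U \<Longrightarrow> ennreal (\<Lambda> f) \<le> open_content U"
  unfolding open_content_def by (rule SUP_upper)

lemma content_mono: "U \<subseteq> V \<Longrightarrow> open_content U \<le> open_content V"
  unfolding open_content_def
  by (rule SUP_subset_mono) (auto simp: below_def intro: order_trans[OF _ indicator_leI])

lemma content_empty: "open_content {} = 0"
proof -
  have "ennreal (\<Lambda> f) \<le> 0" if "f \<in> below {}" for f
  proof -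
    have "f = (\<lambda>_. 0)" using belowD(3)[OF that] by auto
    then show ?thesis by (simp add: zero)
  qed
  then show ?thesis unfolding open_content_def by (intro antisym SUP_least) auto
qed

lemma content_le_bound: "open_content U \<le> ennreal B"
  unfolding open_content_def
proof (rule SUP_least, rule ennreal_leI)
  fix f assume "f \<in> below U"
  then show "\<Lambda> f \<le> B" using bound[of f 1] belowD by simp
qed

lemma below_truncate:
  assumes f: "f \<in> below U" and "0 < e"
  obtains g K where "g \<in> below U" "\<Lambda> f \<le> \<Lambda> g + e" "compact K" "K \<subseteq> U" "\<And>x. x \<notin> K \<Longrightarrow> g x = 0"
proof -
  obtain \<delta> where \<delta>: "0 < \<delta>" "(\<lambda>x. max 0 (f x - \<delta>)) \<in> C0_pos" "\<Lambda> f \<le> \<Lambda> (\<lambda>x. max 0 (f x - \<delta>)) + e"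
    using truncate[OF belowD(1)[OF f] \<open>0 < e\<close>] .
  show thesis
  proof (rule that[OF _ \<delta>(3)])
    show "(\<lambda>x. max 0 (f x - \<delta>)) \<in> below U"
    proof (rule belowI[OF \<delta>(2)])
      show "max 0 (f x - \<delta>) \<le> 1" for x using belowD(2)[OF f, of x] \<delta>(1) by simp
      show "max 0 (f x - \<delta>) = 0" if "x \<notin> U" for x using belowD(3)[OF f that] \<delta>(1) by simp
    qed
    show "compact {x. \<delta> \<le> f x}" by (rule C0_pos_compact_ge[OF belowD(1)[OF f] \<delta>(1)])
    show "{x. \<delta> \<le> f x} \<subseteq> U" using belowD(3)[OF f] \<delta>(1) by fastforce
  qed auto
qed

text \<open>Truncation comes first, because splitting a function between \<open>U\<close> and
  \<open>V\<close> needs a compact set covered by both; the loss \<open>e\<close> is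
  arbitrary.\<close>

lemma content_Un:
  assumes U: "open U" and V: "open V"
  shows "open_content (U \<union> V) \<le> open_content U + open_content V"
proof (rule ennreal_le_epsilon)
  fix e :: real assume e: "0 < e"
  show "open_content (U \<union> V) \<le> open_content U + open_content V + ennreal e"
    unfolding open_content_def[of "U \<union> V"]
  proof (rule SUP_least)
    fix f assume "f \<in> below (U \<union> V)"
    then obtain g K where g: "g \<in> below (U \<union> V)" "\<Lambda> f \<le> \<Lambda> g + e"
        and K: "compact K" "K \<subseteq> U \<union> V" "\<And>x. x \<notin> K \<Longrightarrow> g x = 0"
      using below_truncate[OF _ e] by metis
    obtain g1 g2 where g12: "g1 \<in> C0_pos" "g2 \<in> C0_pos" "\<And>x. g x = g1 x + g2 x"
        "\<And>x. g1 x \<le> g x" "\<And>x. g2 x \<le> g x" "\<And>x. x \<notin> U \<Longrightarrow> g1 x = 0" "\<And>x. x \<notin> V \<Longrightarrow> g2 x = 0"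
      using C0_pos_split[OF lc belowD(1)[OF g(1)] K(1) K(3) U V K(2)] by metis
    have "g1 \<in> below U" "g2 \<in> below V"
      using g12 order_trans[OF g12(4) belowD(2)[OF g(1)]] order_trans[OF g12(5) belowD(2)[OF g(1)]]
      by (auto intro: belowI)
    then have "ennreal (\<Lambda> g1) + ennreal (\<Lambda> g2) \<le> open_content U + open_content V"
      by (intro add_mono content_upper)
    moreover have "g = (\<lambda>x. g1 x + g2 x)" using g12(3) by auto
    then have "\<Lambda> f \<le> \<Lambda> g1 + \<Lambda> g2 + e"
      using g(2) additive[OF g12(1,2)] by simp
    then have "ennreal (\<Lambda> f) \<le> ennreal (\<Lambda> g1) + ennreal (\<Lambda> g2) + ennreal e"
      using nonneg[OF g12(1)] nonneg[OF g12(2)] e by (simp flip: ennreal_plus add: ennreal_leI)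
    ultimately show "ennreal (\<Lambda> f) \<le> open_content U + open_content V + ennreal e"
      by (meson add_right_mono order_trans)
  qed
qed

lemma content_UN_lessThan:
  "(\<And>i. open (U i)) \<Longrightarrow> open_content (\<Union>i<n. U i) \<le> (\<Sum>i<n. open_content (U i))" for n :: nat
proof (induction n)
  case (Suc n)
  have "(\<Union>i<Suc n. U i) = (\<Union>i<n. U i) \<union> U n" by (auto simp: less_Suc_eq)
  then have "open_content (\<Union>i<Suc n. U i) \<le> open_content (\<Union>i<n. U i) + open_content (U n)"
    using content_Un[OF open_UN Suc.prems, of "{..<n}" U n] Suc.prems by simp
  also have "\<dots> \<le> (\<Sum>i<Suc n. open_content (U i))"
    using Suc.IH[OF Suc.prems] by (simp add: add_right_mono)
  finally show ?case .
qed (simp add: content_empty)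

text \<open>After truncation the function lives on a compact set, which finitely many of the open
  sets cover; the finite case then applies.\<close>

lemma content_UN:
  fixes U :: "nat \<Rightarrow> 'g set"
  assumes U: "\<And>i. open (U i)"
  shows "open_content (\<Union>i. U i) \<le> (\<Sum>i. open_content (U i))"
proof (rule ennreal_le_epsilon)
  fix e :: real assume e: "0 < e"
  show "open_content (\<Union>i. U i) \<le> (\<Sum>i. open_content (U i)) + ennreal e"
    unfolding open_content_def[of "\<Union>i. U i"]
  proof (rule SUP_least)
    fix f assume "f \<in> below (\<Union>i. U i)"
    then obtain g K where g: "g \<in> below (\<Union>i. U i)" "\<Lambda> f \<le> \<Lambda> g + e"
        and K: "compact K" "K \<subseteq> (\<Union>i. U i)" "\<And>x. x \<notin> K \<Longrightarrow> g x = 0"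
      using below_truncate[OF _ e] by metis
    obtain I where I: "finite I" "K \<subseteq> (\<Union>i\<in>I. U i)"
      using compactE_image[OF K(1), of UNIV U] U K(2) by auto
    obtain n where n: "I \<subseteq> {..<n}" using finite_nat_iff_bounded I(1) by blast
    have "g \<in> below (\<Union>i<n. U i)"
      using K(3) I(2) n belowD[OF g(1)] by (intro belowI) blast+
    then have "ennreal (\<Lambda> g) \<le> open_content (\<Union>i<n. U i)" by (rule content_upper)
    also have "\<dots> \<le> (\<Sum>i<n. open_content (U i))" by (rule content_UN_lessThan[OF U])
    also have "\<dots> \<le> (\<Sum>i. open_content (U i))" by (intro sum_le_suminf) auto
    finally have *: "ennreal (\<Lambda> g) \<le> (\<Sum>i. open_content (U i))" .
    have "ennreal (\<Lambda> f) \<le> ennreal (\<Lambda> g) + ennreal e"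
      using g(2) nonneg[OF belowD(1)[OF g(1)]] e by (simp flip: ennreal_plus add: ennreal_leI)
    also have "\<dots> \<le> (\<Sum>i. open_content (U i)) + ennreal e" using * by (rule add_right_mono)
    finally show "ennreal (\<Lambda> f) \<le> (\<Sum>i. open_content (U i)) + ennreal e" .
  qed
qed

lemma outer_open: "open U \<Longrightarrow> outer U = open_content U"
  unfolding outer_def by (intro antisym INF_lower INF_greatest content_mono) auto

lemma outer_mono: "E \<subseteq> F \<Longrightarrow> outer E \<le> outer F"
  unfolding outer_def by (rule INF_superset_mono) auto

lemma outer_finite: "outer E < \<infinity>"
proof -
  have "outer E \<le> open_content UNIV" unfolding outer_def by (intro INF_lower) auto
  also have "\<dots> \<le> ennreal B" by (rule content_le_bound)
  also have "\<dots> < \<infinity>" by simp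
  finally show ?thesis .
qed

lemma outer_approx:
  assumes "0 < e"
  obtains U where "open U" "E \<subseteq> U" "open_content U \<le> outer E + ennreal e"
proof -
  have "outer E < outer E + ennreal e"
    using outer_finite[of E] assms by (simp add: ennreal_add_left_cancel_less)
  then obtain U where "open U" "E \<subseteq> U" "open_content U < outer E + ennreal e"
    unfolding outer_def[of E] INF_less_iff by auto
  then show thesis by (intro that) auto
qed

lemma outer_UN:
  fixes E :: "nat \<Rightarrow> 'g set"
  shows "outer (\<Union>i. E i) \<le> (\<Sum>i. outer (E i))"
proof (rule ennreal_le_epsilon)
  fix e :: real assume e: "0 < e"
  have "\<exists>U. open U \<and> E i \<subseteq> U \<and> open_content U \<le> outer (E i) + ennreal (e * (1/2) ^ Suc i)" for i
    by (rule outer_approx[of "e * (1/2) ^ Suc i" "E i"]) (use e in auto)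
  then obtain U where U: "\<And>i. open (U i)" "\<And>i. E i \<subseteq> U i"
      "\<And>i. open_content (U i) \<le> outer (E i) + ennreal (e * (1/2) ^ Suc i)"
    by metis
  have "outer (\<Union>i. E i) \<le> outer (\<Union>i. U i)" using U(2) by (intro outer_mono) blast
  also have "\<dots> = open_content (\<Union>i. U i)" using U(1) by (intro outer_open) auto
  also have "\<dots> \<le> (\<Sum>i. open_content (U i))" by (rule content_UN[OF U(1)])
  also have "\<dots> \<le> (\<Sum>i. outer (E i) + ennreal (e * (1/2) ^ Suc i))"
    by (intro suminf_le U(3)) auto
  also have "\<dots> = (\<Sum>i. outer (E i)) + (\<Sum>i. ennreal e * ennreal ((1/2) ^ Suc i))"
    using e by (subst suminf_add[symmetric]) (auto simp del: ennreal_suminf_cmult simp add: ennreal_mult[symmetric])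
  also have "\<dots> = (\<Sum>i. outer (E i)) + ennreal e"
    unfolding ennreal_suminf_cmult by (subst suminf_ennreal_eq[OF zero_le_power power_half_series]) auto
  finally show "outer (\<Union>i. E i) \<le> (\<Sum>i. outer (E i)) + ennreal e" .
qed

lemma outer_empty: "outer {} = 0"
  using outer_open[of "{}"] content_empty by simp

lemma outer_measure_space_outer: "outer_measure_space UNIV outer"
  unfolding outer_measure_space_def positive_def increasing_def countably_subadditive_def
  by (intro conjI ballI impI allI outer_empty outer_mono outer_UN)

lemma outer_Un: "outer (E \<union> F) \<le> outer E + outer F"
proof -
  have "(\<lambda>n. outer (binaryset E F n)) sums (outer E + outer F)"
    by (rule binaryset_sums) (rule outer_empty)
  then show ?thesis
    using outer_UN[of "binaryset E F"] by (simp add: sums_iff UN_binaryset_eq)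
qed

text \<open>A nearly optimal \<open>g\<close> below \<open>V \<inter> U\<close> vanishes off a
  compact \<open>K\<close>. Any \<open>h\<close> below the open set \<open>V - K\<close>, which
  contains \<open>V - U\<close>, vanishes on \<open>K\<close>, so \<open>g + h\<close> is still a
  test function for \<open>V\<close>. Taking suprema over \<open>h\<close> and then over the
  original \<open>f\<close> gives the inequality.\<close>

lemma outer_split_open:
  assumes U: "open U" and V: "open V"
  shows "outer (V \<inter> U) + outer (V - U) \<le> open_content V"
proof (rule ennreal_le_epsilon)
  fix e :: real assume e: "0 < e"
  have "ennreal (\<Lambda> f) + outer (V - U) \<le> open_content V + ennreal e" if f: "f \<in> below (V \<inter> U)" for f
  proof -
    obtain g K where g: "g \<in> below (V \<inter> U)" "\<Lambda> f \<le> \<Lambda> g + e"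
        and K: "compact K" "K \<subseteq> V \<inter> U" "\<And>x. x \<notin> K \<Longrightarrow> g x = 0"
      using below_truncate[OF f e] by metis
    have VK: "open (V - K)" using V K(1) by (intro open_Diff compact_imp_closed)
    have "outer (V - U) \<le> outer (V - K)" using K(2) by (intro outer_mono) auto
    also have "\<dots> = open_content (V - K)" by (rule outer_open[OF VK])
    finally have "ennreal (\<Lambda> f) + outer (V - U) \<le> ennreal (\<Lambda> f) + open_content (V - K)"
      by (rule add_left_mono)
    also have "\<dots> = (SUP h\<in>below (V - K). ennreal (\<Lambda> f) + ennreal (\<Lambda> h))"
      unfolding open_content_def using below_zero by (intro ennreal_SUP_add_right) auto
    also have "\<dots> \<le> open_content V + ennreal e"
    proof (rule SUP_least)
      fix h assume h: "h \<in> below (V - K)"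
      have "(\<lambda>x. g x + h x) \<in> below V"
      proof (rule belowI[OF C0_pos_add[OF belowD(1)[OF g(1)] belowD(1)[OF h]]])
        show "g x + h x \<le> 1" for x
          using K(3)[of x] belowD(2)[OF g(1), of x] belowD(2,3)[OF h, of x] by (cases "x \<in> K") auto
        show "g x + h x = 0" if "x \<notin> V" for x
          using that belowD(3)[OF g(1), of x] belowD(3)[OF h, of x] by auto
      qed
      then have "ennreal (\<Lambda> (\<lambda>x. g x + h x)) \<le> open_content V" by (rule content_upper)
      then have "ennreal (\<Lambda> g) + ennreal (\<Lambda> h) \<le> open_content V"
        using nonneg[OF belowD(1)[OF g(1)]] nonneg[OF belowD(1)[OF h]]
        by (simp add: additive[OF belowD(1)[OF g(1)] belowD(1)[OF h]])
      moreover have "ennreal (\<Lambda> f) + ennreal (\<Lambda> h) \<le> ennreal (\<Lambda> g) + ennreal (\<Lambda> h) + ennreal e"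
        using g(2) nonneg[OF belowD(1)[OF g(1)]] nonneg[OF belowD(1)[OF f]] nonneg[OF belowD(1)[OF h]] e
        by (simp flip: ennreal_plus add: ennreal_leI)
      ultimately show "ennreal (\<Lambda> f) + ennreal (\<Lambda> h) \<le> open_content V + ennreal e"
        by (meson add_right_mono order_trans)
    qed
    finally show ?thesis .
  qed
  moreover have "outer (V \<inter> U) + outer (V - U) = (SUP f\<in>below (V \<inter> U). ennreal (\<Lambda> f) + outer (V - U))"
    unfolding outer_open[OF open_Int[OF V U]] open_content_def using below_zero
    by (intro ennreal_SUP_add_left[symmetric]) auto
  ultimately show "outer (V \<inter> U) + outer (V - U) \<le> open_content V + ennreal e"
    by (simp add: SUP_least)
qed

text \<open>Open sets split every set additively, which is measurability in the sense of
  Caratheodory; the infimum over open supersets reduces it to the case of an open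
  \<open>E\<close>.\<close>

lemma outer_split:
  assumes U: "open U"
  shows "outer (E \<inter> U) + outer (E - U) = outer E"
proof (rule antisym)
  show "outer (E \<inter> U) + outer (E - U) \<le> outer E"
    unfolding outer_def[of E]
  proof (rule INF_greatest, clarify)
    fix V assume V: "open V" "E \<subseteq> V"
    have "outer (E \<inter> U) + outer (E - U) \<le> outer (V \<inter> U) + outer (V - U)"
      using V by (intro add_mono outer_mono) auto
    also have "\<dots> \<le> open_content V" by (rule outer_split_open[OF U V(1)])
    finally show "outer (E \<inter> U) + outer (E - U) \<le> open_content V" .
  qed
  have "(E \<inter> U) \<union> (E - U) = E" by auto
  then show "outer E \<le> outer (E \<inter> U) + outer (E - U)"
    using outer_Un[of "E \<inter> U" "E - U"] by simp
qed

definition riesz_measure :: "'g measure" where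
  "riesz_measure = measure_of UNIV (sets borel) outer"

lemma sets_riesz_measure [simp, measurable_cong]: "sets riesz_measure = sets borel"
  unfolding riesz_measure_def
  using sigma_algebra.sigma_sets_eq[OF borel_sigma_algebra] by (subst sets_measure_of) auto

lemma space_riesz_measure [simp]: "space riesz_measure = UNIV"
  by (simp add: riesz_measure_def space_measure_of_conv)

text \<open>\<open>outer\<close> lives on all subsets, so the system of Caratheodory-measurable sets
  is formed inside the full power set. It is a \<sigma>-algebra containing the open sets, hence the
  Borel sets, and \<open>outer\<close> is countably additive on it.\<close>

lemma emeasure_riesz_measure:
  assumes E: "E \<in> sets borel"
  shows "emeasure riesz_measure E = outer E"
proof -
  interpret P: sigma_algebra "UNIV :: 'g set" UNIV
    using sigma_algebra_Pow[of UNIV] by simp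
  let ?L = "lambda_system UNIV UNIV outer"
  have L: "measure_space UNIV ?L outer"
    by (rule P.caratheodory_lemma[OF outer_measure_space_outer])
  have "{U. open U} \<subseteq> ?L"
    unfolding P.lambda_system_eq using outer_split by (auto simp: Int_commute)
  then have "sets borel \<subseteq> ?L"
    using L sigma_algebra.sigma_sets_subset[of UNIV ?L "{U. open U}"]
    by (simp add: borel_def measure_space_def)
  then have "countably_additive (sets borel) outer"
    using L by (auto simp: measure_space_def countably_additive_def)
  then show ?thesis
    unfolding riesz_measure_def using E
    by (intro emeasure_measure_of_sigma borel_sigma_algebra) (auto simp: positive_def outer_empty)
qed

lemma finite_riesz_measure: "finite_measure riesz_measure"
  using outer_finite[of UNIV] by (intro finite_measureI) (simp add: emeasure_riesz_measure)

lemma measure_riesz_open: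
  assumes U: "open U"
  shows "measure riesz_measure U \<le> B" and "f \<in> below U \<Longrightarrow> \<Lambda> f \<le> measure riesz_measure U"
    and "(\<And>f. f \<in> below U \<Longrightarrow> \<Lambda> f \<le> c) \<Longrightarrow> measure riesz_measure U \<le> c"
proof -
  interpret finite_measure riesz_measure by (rule finite_riesz_measure)
  have eq: "ennreal (measure riesz_measure U) = open_content U"
    using U by (simp add: emeasure_eq_measure[symmetric] emeasure_riesz_measure outer_open)
  show "measure riesz_measure U \<le> B"
    using content_le_bound[of U] B_nonneg by (simp flip: eq)
  show "\<Lambda> f \<le> measure riesz_measure U" if "f \<in> below U"
    using content_upper[OF that] by (simp flip: eq)
  show "measure riesz_measure U \<le> c" if *: "\<And>f. f \<in> below U \<Longrightarrow> \<Lambda> f \<le> c"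
  proof -
    have "0 \<le> c" using *[OF below_zero] by (simp add: zero)
    moreover have "open_content U \<le> ennreal c"
      unfolding open_content_def using * by (intro SUP_least ennreal_leI)
    ultimately show ?thesis by (simp flip: eq)
  qed
qed

text \<open>The summand for \<open>i\<close> is the length of the part of \<open>[0, y]\<close>
  lying between \<open>i\<close> and \<open>i + 1\<close>.\<close>

lemma layer_sum: "0 \<le> y \<Longrightarrow> (\<Sum>i<n. min (max (y - real i) 0) 1) = min y (real n)"
  by (induction n) (auto simp: min_def max_def)

lemma integrable_riesz_measure:
  assumes f: "f \<in> C0_pos"
  shows "integrable riesz_measure f"
proof -
  interpret finite_measure riesz_measure by (rule finite_riesz_measure)
  obtain b where "\<And>x. f x \<le> b" using C0_pos_bounded[OF f] by metis
  moreover have [measurable]: "f \<in> borel_measurable borel"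
    by (rule borel_measurable_continuous_onI[OF C0_posD(1)[OF f]])
  ultimately show ?thesis
    using C0_posD(2)[OF f] by (intro integrable_const_bound[of _ b] AE_I2) auto
qed

text \<open>
  Layer by layer, both \<open>\<Lambda>\<close> and the integral are squeezed between the measures of consecutive
  superlevel sets; the errors telescope.
\<close>

lemma integral_riesz_measure:
  assumes f: "f \<in> C0_pos"
  shows "(\<integral>x. f x \<partial>riesz_measure) = \<Lambda> f"
proof -
  interpret finite_measure riesz_measure by (rule finite_riesz_measure)
  obtain b where b: "0 < b" "\<And>x. f x \<le> b" using C0_pos_bounded[OF f] by metis
  \<comment> \<open>The layers of \<open>n f\<close> have height 1 and their total error is at most
    \<open>B\<close> for every \<open>n\<close>, so the difference itself must be 0.\<close>
  have key: "real n * \<bar>(\<integral>x. f x \<partial>riesz_measure) - \<Lambda> f\<bar> \<le> B" for n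
  proof -
    \<comment> \<open>With \<open>N\<close> at least \<open>n b\<close> the layers exhaust
      \<open>n f\<close> exactly, without a tail.\<close>
    obtain N :: nat where N: "real n * b \<le> real N" using real_arch_simple by blast
    define h where "h i x = min (max (real n * f x - real i) 0) 1" for i x
    define S where "S i = {x. real i < real n * f x}" for i
    have S: "open (S i)" for i
      unfolding S_def by (intro open_Collect_less continuous_intros C0_posD(1)[OF f])
    have h: "h i \<in> C0_pos" for i
      using C0_posD[OF f] unfolding h_def
      by (intro C0_pos_le[OF C0_pos_cmult_nat[OF f, of n]] continuous_intros) (auto simp: min_le_iff_disj)
    have sum_h: "(\<Sum>i<N. h i x) = real n * f x" for x
    proof -
      have "real n * f x \<le> real N"
        using N mult_left_mono[OF b(2)[of x], of "real n"] by simp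
      then show ?thesis
        using layer_sum[of "real n * f x" N] C0_posD(2)[OF f] by (simp add: h_def)
    qed
    have h_below: "h i \<in> below (S i)" for i
      by (rule belowI[OF h]) (auto simp: h_def S_def)
    have h_above: "indicator (S (Suc i)) x \<le> h i x" for i x
      by (auto simp: h_def S_def indicator_def)
    have diff: "\<bar>(\<integral>x. h i x \<partial>riesz_measure) - \<Lambda> (h i)\<bar> \<le> measure riesz_measure (S i) - measure riesz_measure (S (Suc i))" for i
    proof -
      have ind: "integrable riesz_measure (indicator (S i) :: 'g \<Rightarrow> real)" for i
        using S by (simp add: integrable_indicator_iff emeasure_eq_measure)
      have "\<Lambda> (h i) \<le> measure riesz_measure (S i)" by (rule measure_riesz_open(2)[OF S h_below])
      moreover have "measure riesz_measure (S (Suc i)) \<le> \<Lambda> (h i)"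
      proof (rule measure_riesz_open(3)[OF S])
        fix g assume g: "g \<in> below (S (Suc i))"
        then have "g x \<le> h i x" for x
          using h_above[of i x] by (auto simp: below_def intro: order_trans)
        then show "\<Lambda> g \<le> \<Lambda> (h i)" by (intro mono belowD(1)[OF g] h)
      qed
      moreover have "(\<integral>x. h i x \<partial>riesz_measure) \<le> (\<integral>x. indicator (S i) x \<partial>riesz_measure)"
        using h_below[of i] by (intro integral_mono integrable_riesz_measure h ind) (simp add: below_def)
      moreover have "(\<integral>x. indicator (S (Suc i)) x \<partial>riesz_measure) \<le> (\<integral>x. h i x \<partial>riesz_measure)"
        by (intro integral_mono integrable_riesz_measure h ind h_above)
      ultimately show ?thesis by simp
    qed
    have "real n * (\<integral>x. f x \<partial>riesz_measure) = (\<integral>x. (\<Sum>i<N. h i x) \<partial>riesz_measure)"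
      unfolding sum_h by simp
    also have "\<dots> = (\<Sum>i<N. \<integral>x. h i x \<partial>riesz_measure)"
      by (intro Bochner_Integration.integral_sum integrable_riesz_measure h)
    finally have I: "real n * (\<integral>x. f x \<partial>riesz_measure) = (\<Sum>i<N. \<integral>x. h i x \<partial>riesz_measure)" .
    have "real n * \<Lambda> f = \<Lambda> (\<lambda>x. \<Sum>i<N. h i x)"
      unfolding sum_h by (simp add: cmult_nat[OF f])
    also have "\<dots> = (\<Sum>i<N. \<Lambda> (h i))" using sum_C0_pos[of "{..<N}" h] h by simp
    finally have L: "real n * \<Lambda> f = (\<Sum>i<N. \<Lambda> (h i))" .
    have "real n * \<bar>(\<integral>x. f x \<partial>riesz_measure) - \<Lambda> f\<bar> =
        \<bar>real n * (\<integral>x. f x \<partial>riesz_measure) - real n * \<Lambda> f\<bar>"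
      by (simp add: abs_mult flip: right_diff_distrib)
    also have "\<dots> = \<bar>(\<Sum>i<N. (\<integral>x. h i x \<partial>riesz_measure) - \<Lambda> (h i))\<bar>"
      unfolding I L by (simp add: sum_subtractf)
    also have "\<dots> \<le> (\<Sum>i<N. measure riesz_measure (S i) - measure riesz_measure (S (Suc i)))"
      by (rule order_trans[OF sum_abs]) (intro sum_mono diff)
    also have "\<dots> = measure riesz_measure (S 0) - measure riesz_measure (S N)"
      by (rule sum_lessThan_telescope')
    also have "\<dots> \<le> B"
      using measure_riesz_open(1)[OF S[of 0]] measure_nonneg[of riesz_measure "S N"] by linarith
    finally show ?thesis .
  qed
  show ?thesis
  proof (rule ccontr)
    assume "\<not> ?thesis"
    then have "0 < \<bar>(\<integral>x. f x \<partial>riesz_measure) - \<Lambda> f\<bar>" by simp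
    then obtain n :: nat where "B < real n * \<bar>(\<integral>x. f x \<partial>riesz_measure) - \<Lambda> f\<bar>"
      using reals_Archimedean3 by blast
    then show False using key[of n] by simp
  qed
qed

text \<open>Outer regularity is turned inside out within the compact closure: an open
  \<open>U\<close> slightly larger than \<open>closure A - A\<close> is removed from
  \<open>closure A\<close>, leaving a compact subset of \<open>A\<close>.\<close>

lemma riesz_measure_inner_regular:
  assumes A: "A \<in> compacted_borel" and e: "0 < e"
  obtains C where "compact C" "C \<subseteq> A" "measure riesz_measure (A - C) \<le> e"
proof -
  interpret finite_measure riesz_measure by (rule finite_riesz_measure)
  define E where "E = closure A - A"
  have [measurable]: "A \<in> sets borel" "E \<in> sets borel"
    using A by (auto simp: cb_sets E_def)
  obtain U where U: "open U" "E \<subseteq> U" "open_content U \<le> outer E + ennreal e"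
    using outer_approx[OF e] .
  show thesis
  proof (rule that[of "closure A - U"])
    show "compact (closure A - U)" using A U(1) by (intro compact_diff) (auto simp: compacted_borel_def)
    show "closure A - U \<subseteq> A" using U(2) by (auto simp: E_def)
    have "ennreal (measure riesz_measure U) \<le> ennreal (measure riesz_measure E) + ennreal e"
      using U by (simp add: emeasure_eq_measure[symmetric] emeasure_riesz_measure outer_open)
    then have "measure riesz_measure U \<le> measure riesz_measure E + e"
      using e by (simp flip: ennreal_plus)
    moreover have "measure riesz_measure (U - E) = measure riesz_measure U - measure riesz_measure E"
      using U by (intro finite_measure_Diff) auto
    moreover have "A - (closure A - U) \<subseteq> U - E"
      using closure_subset[of A] by (auto simp: E_def)
    then have "measure riesz_measure (A - (closure A - U)) \<le> measure riesz_measure (U - E)"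
      using U(1) by (intro finite_measure_mono) auto
    ultimately show "measure riesz_measure (A - (closure A - U)) \<le> e" by linarith
  qed
qed

end

section \<open>Regularity\<close>

text \<open>This form with an error \<open>e\<close> passes through finite sums and domination more
  directly than the supremum formula does.\<close>

definition cb_inner_regular :: "'g::topological_space measure \<Rightarrow> bool" where
  "cb_inner_regular M \<longleftrightarrow> cb_finite_measure M \<and>
     (\<forall>A\<in>compacted_borel. \<forall>e>0. \<exists>C. compact C \<and> C \<subseteq> A \<and> measure M (A - C) \<le> e)"

lemma cb_inner_regularD:
  assumes "cb_inner_regular M"
  shows "cb_finite_measure M"
    "A \<in> compacted_borel \<Longrightarrow> 0 < e \<Longrightarrow> \<exists>C. compact C \<and> C \<subseteq> A \<and> measure M (A - C) \<le> e"
  using assms by (auto simp: cb_inner_regular_def)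

text \<open>The union of the compact sets chosen for the finitely many \<open>M k\<close> serves all
  of them at once, and the weighted errors stay within \<open>e\<close>.\<close>

lemma cb_inner_regular_le:
  fixes V :: "'g::t2_space measure"
  assumes K: "finite K" and M: "\<And>k. k \<in> K \<Longrightarrow> cb_inner_regular (M k)" and V: "cb_finite_measure V"
    and le: "\<And>A. A \<in> compacted_borel \<Longrightarrow> emeasure V A \<le> (\<Sum>k\<in>K. ennreal (a k) * emeasure (M k) A)"
    and a: "\<And>k. k \<in> K \<Longrightarrow> 0 \<le> a k"
  shows "cb_inner_regular V"
  unfolding cb_inner_regular_def
proof (intro conjI ballI allI impI)
  fix A :: "'g set" and e :: real
  assume A: "A \<in> compacted_borel" and e: "0 < e"
  \<comment> \<open>Each measure is granted the error \<open>e / s\<close>; the added 1 makes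
    \<open>s\<close> positive even if every coefficient is 0.\<close>
  define s where "s = (\<Sum>k\<in>K. a k) + 1"
  have s: "0 < s" using a by (simp add: s_def sum_nonneg add_nonneg_pos)
  have "\<exists>C. compact C \<and> C \<subseteq> A \<and> measure (M k) (A - C) \<le> e / s" if "k \<in> K" for k
    using cb_inner_regularD(2)[OF M[OF that] A] e s by simp
  then obtain C where C: "\<And>k. k \<in> K \<Longrightarrow> compact (C k)" "\<And>k. k \<in> K \<Longrightarrow> C k \<subseteq> A"
      "\<And>k. k \<in> K \<Longrightarrow> measure (M k) (A - C k) \<le> e / s"
    by metis
  let ?C = "\<Union>k\<in>K. C k"
  have C': "compact ?C" "?C \<subseteq> A" using C K by auto
  have AC: "A - ?C \<in> compacted_borel"
    using A C'(1) by (intro cb_Diff) (auto intro: borel_closed compact_imp_closed)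
  have "measure (M k) (A - ?C) \<le> e / s" if k: "k \<in> K" for k
  proof -
    have "A - C k \<in> compacted_borel"
      using A C(1)[OF k] by (intro cb_Diff) (auto intro: borel_closed compact_imp_closed)
    then have "measure (M k) (A - ?C) \<le> measure (M k) (A - C k)"
      using cb_finite_measureD[OF cb_inner_regularD(1)[OF M[OF k]]] k
      by (intro measure_mono_fmeasurable) (auto simp: fmeasurable_def cb_sets AC)
    then show ?thesis using C(3)[OF k] by simp
  qed
  then have "(\<Sum>k\<in>K. a k * measure (M k) (A - ?C)) \<le> (\<Sum>k\<in>K. a k * (e / s))"
    using a by (intro sum_mono mult_left_mono) auto
  also have "\<dots> = (\<Sum>k\<in>K. a k) * (e / s)" by (rule sum_distrib_right[symmetric])
  also have "\<dots> \<le> s * (e / s)"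
    using e s by (intro mult_right_mono) (auto simp: s_def)
  also have "\<dots> = e" using s by simp
  finally have sum_le: "(\<Sum>k\<in>K. a k * measure (M k) (A - ?C)) \<le> e" .
  have "ennreal (measure V (A - ?C)) = emeasure V (A - ?C)"
    using cb_finite_measureD(4)[OF V AC] by simp
  also have "\<dots> \<le> (\<Sum>k\<in>K. ennreal (a k) * emeasure (M k) (A - ?C))" by (rule le[OF AC])
  also have "\<dots> = (\<Sum>k\<in>K. ennreal (a k * measure (M k) (A - ?C)))"
    using cb_finite_measureD(4)[OF cb_inner_regularD(1)[OF M] AC] a
    by (intro sum.cong refl) (simp add: ennreal_mult)
  also have "\<dots> = ennreal (\<Sum>k\<in>K. a k * measure (M k) (A - ?C))"
    using a by (intro sum_ennreal) auto
  finally have "measure V (A - ?C) \<le> (\<Sum>k\<in>K. a k * measure (M k) (A - ?C))"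
    using a by (simp add: sum_nonneg)
  then show "\<exists>C. compact C \<and> C \<subseteq> A \<and> measure V (A - C) \<le> e"
    using C' sum_le by (intro exI[of _ ?C]) auto
qed (rule V)

text \<open>The variation is finite on compacted Borel sets, so it can be subtracted; approximating
  the variation of \<open>A\<close> from inside then means that \<open>A - C\<close> has small
  variation.\<close>

lemma regular_measures_iff:
  fixes \<mu> :: "'g::t2_space set \<Rightarrow> complex"
  shows "\<mu> \<in> regular_measures \<longleftrightarrow>
    \<mu> \<in> extensional compacted_borel \<and> cb_additive \<mu> \<and> cb_inner_regular (variation_measure \<mu>)"
proof (cases "complex_cb_measure \<mu>")
  case True
  then have \<mu>: "cb_additive \<mu>" "\<mu> \<in> extensional compacted_borel"
    by (auto simp: complex_cb_measure_iff)
  note V = cb_finite_variation_measure[OF \<mu>(1)]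
  let ?V = "measure (variation_measure \<mu>)"
  have var: "variation \<mu> A = ennreal (?V A)" if "A \<in> compacted_borel" for A
    using emeasure_variation_measure_cb[OF \<mu>(1) that] cb_finite_measureD(4)[OF V that] by simp
  have diff: "?V (A - C) = ?V A - ?V C" if "A \<in> compacted_borel" "compact C" "C \<subseteq> A" for A C
    using that cb_finite_measureD(3)[OF V that(1)]
    by (intro measure_Diff) (auto simp: cb_sets borel_closed compact_imp_closed)
  have "(\<forall>A\<in>compacted_borel. variation \<mu> A = (SUP C\<in>{C. compact C \<and> C \<subseteq> A}. variation \<mu> C)) \<longleftrightarrow>
      cb_inner_regular (variation_measure \<mu>)" (is "?L \<longleftrightarrow> ?R")
  proof
    assume L: ?L
    show ?R
      unfolding cb_inner_regular_def
    proof (intro conjI ballI allI impI)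
      fix A :: "'g set" and e :: real
      assume A: "A \<in> compacted_borel" and e: "0 < e"
      show "\<exists>C. compact C \<and> C \<subseteq> A \<and> ?V (A - C) \<le> e"
      \<comment> \<open>If \<open>?V A\<close> does not exceed \<open>e\<close>, then
        \<open>?V A - e\<close> is not positive and the strict inequality obtained below would fail
        under \<open>ennreal\<close>; the empty set settles that case.\<close>
      proof (cases "?V A \<le> e")
        case True
        then show ?thesis by (intro exI[of _ "{}"]) simp
      next
        case False
        have "ennreal (?V A - e) < variation \<mu> A"
          using False e by (simp add: var[OF A] ennreal_less_iff)
        also have "\<dots> = (SUP C\<in>{C. compact C \<and> C \<subseteq> A}. variation \<mu> C)" using L A by blast
        finally obtain C where C: "compact C" "C \<subseteq> A" "ennreal (?V A - e) < variation \<mu> C"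
          unfolding less_SUP_iff by auto
        then have "?V A - e < ?V C"
          using False by (simp add: var[OF compact_in_cb] ennreal_less_iff)
        then show ?thesis using C diff[OF A C(1,2)] by (intro exI[of _ C]) simp
      qed
    qed (rule V)
  next
    assume R: ?R
    show ?L
    proof (intro ballI antisym)
      fix A :: "'g set" assume A: "A \<in> compacted_borel"
      show "variation \<mu> A \<le> (SUP C\<in>{C. compact C \<and> C \<subseteq> A}. variation \<mu> C)"
      proof (rule ennreal_le_epsilon)
        fix e :: real assume e: "0 < e"
        obtain C where C: "compact C" "C \<subseteq> A" "?V (A - C) \<le> e"
          using cb_inner_regularD(2)[OF R A e] by blast
        have "variation \<mu> A \<le> ennreal (?V C + e)"
          using C diff[OF A C(1,2)] by (simp add: var[OF A] ennreal_leI)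
        also have "\<dots> = variation \<mu> C + ennreal e"
          using e by (simp add: var[OF compact_in_cb[OF C(1)]])
        also have "\<dots> \<le> (SUP C\<in>{C. compact C \<and> C \<subseteq> A}. variation \<mu> C) + ennreal e"
          using C by (intro add_right_mono SUP_upper) auto
        finally show "variation \<mu> A \<le> (SUP C\<in>{C. compact C \<and> C \<subseteq> A}. variation \<mu> C) + ennreal e" .
      qed
      show "(SUP C\<in>{C. compact C \<and> C \<subseteq> A}. variation \<mu> C) \<le> variation \<mu> A"
        using A by (intro SUP_least cb_premeasure_mono cb_premeasure_variation \<mu>)
          (auto simp: borel_closed compact_imp_closed)
    qed
  qed
  then show ?thesis using True \<mu> by (simp add: regular_measures_def)
qed (auto simp: regular_measures_def complex_cb_measure_iff)

lemma regular_measuresD: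
  fixes \<mu> :: "'g::t2_space set \<Rightarrow> complex"
  assumes "\<mu> \<in> regular_measures"
  shows "\<mu> \<in> extensional compacted_borel" "cb_additive \<mu>" "cb_inner_regular (variation_measure \<mu>)"
  using assms by (auto simp: regular_measures_iff)

lemma cb_inner_regular_jordan_part:
  fixes \<mu> :: "'g::t2_space set \<Rightarrow> complex"
  assumes \<mu>: "\<mu> \<in> regular_measures"
  shows "cb_inner_regular (jordan_part \<mu> k)"
proof (rule cb_inner_regular_le[of "{()}" "\<lambda>_. variation_measure \<mu>" _ "\<lambda>_. 1"])
  note reg = regular_measuresD[OF \<mu>]
  show "cb_inner_regular (variation_measure \<mu>)" by (rule reg)
  show "cb_finite_measure (jordan_part \<mu> k)" by (rule cb_finite_jordan_part[OF reg(2)])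
  show "emeasure (jordan_part \<mu> k) A \<le> (\<Sum>k\<in>{()}. ennreal 1 * emeasure (variation_measure \<mu>) A)"
    if "A \<in> compacted_borel" for A
    using jordan_part_le_variation[OF reg(2) cb_sets[OF that], of k] by simp
qed simp_all

text \<open>The variation is dominated by the combination of the \<open>M k\<close>, so regularity
  can be checked in any representation; sums, multiples, densities and Riesz measures are all
  treated this way.\<close>

lemma represents_regular:
  fixes \<mu> :: "'g::t2_space set \<Rightarrow> complex"
  assumes KM: "represents K c M \<mu>" and M: "\<And>k. k \<in> K \<Longrightarrow> cb_inner_regular (M k)"
    and \<mu>: "\<mu> \<in> extensional compacted_borel"
  shows "\<mu> \<in> regular_measures"
  unfolding regular_measures_iff
proof (intro conjI \<mu> represents_cb_additive[OF KM])
  show "cb_inner_regular (variation_measure \<mu>)"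
  proof (rule cb_inner_regular_le[OF representsD(1)[OF KM] M])
    show "cb_finite_measure (variation_measure \<mu>)"
      by (rule cb_finite_variation_measure[OF represents_cb_additive[OF KM]])
    show "emeasure (variation_measure \<mu>) A \<le> (\<Sum>k\<in>K. ennreal (cmod (c k)) * emeasure (M k) A)"
      if "A \<in> compacted_borel" for A
      by (rule represents_variation_measure_le[OF KM cb_sets[OF that]])
  qed simp_all
qed

lemma represents_bounded:
  fixes \<mu> :: "'g::t2_space set \<Rightarrow> complex"
  assumes KM: "represents K c M \<mu>" and M: "\<And>k. k \<in> K \<Longrightarrow> emeasure (M k) UNIV < \<infinity>"
  shows "total_variation \<mu> < \<infinity>"
proof -
  have "total_variation \<mu> \<le> (\<Sum>k\<in>K. ennreal (cmod (c k)) * emeasure (M k) UNIV)"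
    using represents_variation_measure_le[OF KM, of UNIV]
    by (simp add: emeasure_variation_measure_UNIV[OF represents_cb_additive[OF KM]])
  also have "\<dots> < \<infinity>"
    using M representsD(1)[OF KM] by (auto simp: ennreal_mult_less_top)
  finally show ?thesis .
qed

text \<open>On a compacted set the density is bounded by some \<open>b\<close>, so a compact set
  with error \<open>e / b\<close> for a Jordan part has error at most \<open>e\<close> after
  multiplication by \<open>h\<close>.\<close>

lemma regular_density_measure:
  fixes \<nu> :: "'g::t2_space set \<Rightarrow> complex"
  assumes \<nu>: "\<nu> \<in> regular_measures" and h: "cb_bounded h"
  shows "density_measure (\<lambda>x. of_real (h x)) \<nu> \<in> regular_measures"
proof (rule represents_regular[OF represents_density_measure[OF represents_jordan_part h]])
  show "cb_additive \<nu>" by (rule regular_measuresD[OF \<nu>])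
  fix k :: nat
  let ?J = "jordan_part \<nu> k"
  note J = cb_inner_regular_jordan_part[OF \<nu>, of k]
  note D = cb_bounded_density[OF h cb_inner_regularD(1)[OF J]]
  show "cb_inner_regular (density ?J h)"
    unfolding cb_inner_regular_def
  proof (intro conjI ballI allI impI D(1))
    fix A :: "'g set" and e :: real assume A: "A \<in> compacted_borel" and e: "0 < e"
    obtain b0 where b0: "\<And>x. x \<in> A \<Longrightarrow> h x \<le> b0" using h A unfolding cb_bounded_def by metis
    \<comment> \<open>The maximum with 1 makes \<open>b\<close> positive, as division by it
      requires.\<close>
    define b where "b = max b0 1"
    have b: "0 < b" "\<And>x. x \<in> A \<Longrightarrow> h x \<le> b" using b0 by (auto simp: b_def intro: max.coboundedI1)
    obtain C where C: "compact C" "C \<subseteq> A" "measure ?J (A - C) \<le> e / b"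
      using cb_inner_regularD(2)[OF J A, of "e / b"] e b by auto
    have AC: "A - C \<in> compacted_borel"
      using A C(1) by (intro cb_Diff) (auto intro: borel_closed compact_imp_closed)
    have i: "has_bochner_integral ?J (\<lambda>x. indicator (A - C) x *\<^sub>R b) (measure ?J (A - C) *\<^sub>R b)"
      using cb_finite_measureD[OF cb_inner_regularD(1)[OF J]] AC
      by (intro has_bochner_integral_indicator) (auto simp: cb_sets)
    have "measure (density ?J h) (A - C) = (\<integral>x. indicator (A - C) x * h x \<partial>?J)"
      by (rule D(2)[OF AC])
    also have "\<dots> \<le> (\<integral>x. indicator (A - C) x *\<^sub>R b \<partial>?J)"
      using i b(2) h by (intro integral_mono cb_bounded_integrable[OF h cb_inner_regularD(1)[OF J] AC])
        (auto simp: has_bochner_integral_iff indicator_def)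
    also have "\<dots> = measure ?J (A - C) * b" using i by (simp add: has_bochner_integral_iff)
    also have "\<dots> \<le> e" using C(3) b(1) by (simp add: field_simps)
    finally show "\<exists>C. compact C \<and> C \<subseteq> A \<and> measure (density ?J h) (A - C) \<le> e"
      using C by blast
  qed
qed simp

section \<open>Integrating functions vanishing at infinity\<close>

lemma C0_iff: "\<phi> \<in> C0 \<longleftrightarrow> continuous_on UNIV \<phi> \<and> (\<lambda>x. cmod (\<phi> x)) \<in> C0_pos"
  by (auto simp: C0_def C0_pos_def intro: continuous_on_norm)

lemma C0D:
  assumes "\<phi> \<in> C0"
  shows "continuous_on UNIV \<phi>" "(\<lambda>x. cmod (\<phi> x)) \<in> C0_pos" "\<phi> \<in> borel_measurable borel"
  using assms borel_measurable_continuous_onI[of \<phi>] by (simp_all add: C0_iff)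

lemma C0_le:
  assumes \<phi>: "\<phi> \<in> C0_pos" and \<psi>: "continuous_on UNIV \<psi>" "\<And>x. cmod (\<psi> x) \<le> \<phi> x"
  shows "\<psi> \<in> C0"
  unfolding C0_iff using \<psi> by (intro conjI C0_pos_le[OF \<phi>] continuous_on_norm) auto

lemma C0_add: "\<phi> \<in> C0 \<Longrightarrow> \<psi> \<in> C0 \<Longrightarrow> (\<lambda>x. \<phi> x + \<psi> x) \<in> C0"
  by (rule C0_le[OF C0_pos_add[OF C0D(2)[of \<phi>] C0D(2)[of \<psi>]]])
    (simp_all add: continuous_on_add C0D(1) norm_triangle_ineq)

lemma C0_cmult:
  assumes "\<phi> \<in> C0"
  shows "(\<lambda>x. c * \<phi> x) \<in> C0"
proof -
  obtain n :: nat where n: "cmod c \<le> real n" using real_arch_simple by blast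
  show ?thesis
  proof (rule C0_le[OF C0_pos_cmult_nat[OF C0D(2)[OF assms], of n]])
    show "continuous_on UNIV (\<lambda>x. c * \<phi> x)"
      by (intro continuous_intros C0D(1)[OF assms])
    show "cmod (c * \<phi> x) \<le> real n * cmod (\<phi> x)" for x
      unfolding norm_mult by (intro mult_right_mono n) simp
  qed
qed

lemma C0_of_real: "f \<in> C0_pos \<Longrightarrow> (\<lambda>x. complex_of_real (f x)) \<in> C0"
  using C0_posD(1,2)[of f] by (intro C0_le[of f] continuous_on_of_real) simp_all

lemma sup_norm_upper:
  assumes "\<phi> \<in> C0"
  shows "cmod (\<phi> x) \<le> sup_norm \<phi>"
proof -
  obtain b where "\<And>x. cmod (\<phi> x) \<le> b" using C0_pos_bounded[OF C0D(2)[OF assms]] by metis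
  then show ?thesis
    unfolding sup_norm_def by (intro cSUP_upper bdd_aboveI2) auto
qed

lemma sup_norm_least: "(\<And>x. cmod (\<phi> x) \<le> b) \<Longrightarrow> sup_norm \<phi> \<le> b"
  unfolding sup_norm_def by (rule cSUP_least) auto

lemma sup_norm_nonneg: "\<phi> \<in> C0 \<Longrightarrow> 0 \<le> sup_norm \<phi>"
  using order_trans[OF norm_ge_zero sup_norm_upper] .

text \<open>The sets where the modulus is at least 1/(n+1) are compact, increase with n and cover
  every point where the function is nonzero.\<close>

lemma C0_cb_supported:
  fixes \<phi> :: "'g::t2_space \<Rightarrow> complex"
  assumes \<phi>: "\<phi> \<in> C0"
  shows "cb_supported \<phi>"
proof -
  define A where "A n = {x. inverse (real (Suc n)) \<le> cmod (\<phi> x)}" for n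
  have "A n \<in> compacted_borel" for n
    unfolding A_def by (intro compact_in_cb C0_pos_compact_ge[OF C0D(2)[OF \<phi>]]) simp
  moreover have "incseq A"
  proof (rule incseq_SucI)
    show "A n \<subseteq> A (Suc n)" for n
    proof -
      have "inverse (real (Suc (Suc n))) \<le> inverse (real (Suc n))"
        by (intro le_imp_inverse_le) auto
      then show ?thesis unfolding A_def using order_trans by blast
    qed
  qed
  moreover have "\<phi> x = 0" if "x \<notin> (\<Union>n. A n)" for x
  proof (rule ccontr)
    assume "\<phi> x \<noteq> 0"
    then obtain n where "inverse (real (Suc n)) < cmod (\<phi> x)"
      using reals_Archimedean[of "cmod (\<phi> x)"] by (auto simp del: of_nat_Suc)
    then have "x \<in> A n" by (simp add: A_def)
    then show False using that by blast
  qed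
  ultimately show ?thesis unfolding cb_supported_def by (intro exI[of _ A]) auto
qed

text \<open>A condition sufficient for membership in \<open>L1\<close> that is stable under sums and
  multiples; Borel measurability keeps completions out of the argument.\<close>

definition cb_integrable :: "('g::topological_space set \<Rightarrow> complex) \<Rightarrow> ('g \<Rightarrow> complex) \<Rightarrow> bool" where
  "cb_integrable \<nu> f \<longleftrightarrow>
     f \<in> borel_measurable borel \<and> integrable (variation_measure \<nu>) f \<and> cb_supported f"

lemma cb_integrable_add:
  assumes "cb_additive \<nu>" "cb_integrable \<nu> f" "cb_integrable \<nu> g"
  shows "cb_integrable \<nu> (\<lambda>x. f x + g x)" "cb_integral \<nu> (\<lambda>x. f x + g x) = cb_integral \<nu> f + cb_integral \<nu> g"
  using assms by (auto simp: cb_integrable_def cb_integral_add intro: cb_supported_add)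

lemma cb_integrable_cmult:
  assumes "cb_additive \<nu>" "cb_integrable \<nu> f"
  shows "cb_integrable \<nu> (\<lambda>x. c * f x)" "cb_integral \<nu> (\<lambda>x. c * f x) = c * cb_integral \<nu> f"
  using assms cb_supported_zero[of f "\<lambda>x. c * f x"] by (auto simp: cb_integrable_def cb_integral_cmult)

lemma cb_integrable_zero: "cb_integrable \<nu> (\<lambda>_. 0)"
  by (auto simp: cb_integrable_def intro: cb_supported_cb[of "{}"])

lemma cb_integrable_sum:
  assumes \<nu>: "cb_additive \<nu>" and "finite I" "\<And>i. i \<in> I \<Longrightarrow> cb_integrable \<nu> (f i)"
  shows "cb_integrable \<nu> (\<lambda>x. \<Sum>i\<in>I. f i x) \<and>
    cb_integral \<nu> (\<lambda>x. \<Sum>i\<in>I. f i x) = (\<Sum>i\<in>I. cb_integral \<nu> (f i))"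
  using assms(2,3)
proof (induction I rule: finite_induct)
  case empty
  show ?case
    using cb_integrable_zero[of \<nu>] cb_integrable_cmult(2)[OF \<nu> cb_integrable_zero, of 0] by simp
next
  case (insert i I)
  then show ?case by (simp add: cb_integrable_add[OF \<nu>])
qed

lemma cb_integrable_indicator:
  assumes \<nu>: "cb_additive \<nu>" and A: "A \<in> compacted_borel"
  shows "cb_integrable \<nu> (indicator A)"
  unfolding cb_integrable_def
proof (intro conjI borel_measurable_indicator cb_sets A cb_supported_cb[OF A])
  show "integrable (variation_measure \<nu>) (indicator A :: 'a \<Rightarrow> complex)"
    using has_bochner_integral_indicator_cb[OF cb_finite_variation_measure[OF \<nu>] A]
    by (simp add: has_bochner_integral_iff)
qed simp

lemma cb_integrable_C0:
  fixes \<phi> :: "'g::t2_space \<Rightarrow> complex"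
  assumes \<mu>: "cb_additive \<mu>" "total_variation \<mu> < \<infinity>" and \<phi>: "\<phi> \<in> C0"
  shows "cb_integrable \<mu> \<phi>"
    and "(\<integral>x. cmod (\<phi> x) \<partial>variation_measure \<mu>) \<le> sup_norm \<phi> * measure_norm \<mu>"
proof -
  have tv: "emeasure (variation_measure \<mu>) UNIV = total_variation \<mu>"
    by (rule emeasure_variation_measure_UNIV[OF \<mu>(1)])
  interpret finite_measure "variation_measure \<mu>"
    using \<mu>(2) by (intro finite_measureI) (simp add: tv)
  have [measurable]: "\<phi> \<in> borel_measurable borel" by (rule C0D[OF \<phi>])
  have int: "integrable (variation_measure \<mu>) \<phi>"
    using sup_norm_upper[OF \<phi>] by (intro integrable_const_bound[of _ "sup_norm \<phi>"]) auto
  then show "cb_integrable \<mu> \<phi>"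
    using C0_cb_supported[OF \<phi>] by (simp add: cb_integrable_def)
  have "(\<integral>x. cmod (\<phi> x) \<partial>variation_measure \<mu>) \<le> (\<integral>x. sup_norm \<phi> \<partial>variation_measure \<mu>)"
    using int sup_norm_upper[OF \<phi>] by (intro integral_mono) auto
  also have "\<dots> = sup_norm \<phi> * measure_norm \<mu>"
    by (simp add: measure_norm_def measure_def tv)
  finally show "(\<integral>x. cmod (\<phi> x) \<partial>variation_measure \<mu>) \<le> sup_norm \<phi> * measure_norm \<mu>" .
qed

section \<open>The norm of an integral functional\<close>

text \<open>
  The test function takes the value \<open>cnj (sgn (\<mu> (C B)))\<close> on a compact \<open>C B \<subseteq> B\<close> for each part \<open>B\<close>
  and lives on a neighbourhood of the union of the \<open>C B\<close> that is small in variation; composing with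
  the radial retraction onto the unit disc keeps it bounded by 1.
\<close>

lemma variation_test_function:
  fixes \<mu> :: "'g::t2_space set \<Rightarrow> complex"
  assumes lc: "locally_compact_space (euclidean :: 'g topology)"
    and \<mu>: "\<mu> \<in> regular_measures" "total_variation \<mu> < \<infinity>"
    and P: "finite P" "P \<subseteq> compacted_borel" "disjoint P" and e: "0 < e"
  obtains \<phi> where "\<phi> \<in> C0" "\<And>x. cmod (\<phi> x) \<le> 1"
    "(\<Sum>B\<in>P. cmod (\<mu> B)) \<le> cmod (cb_integral \<mu> \<phi>) + e"
proof -
  let ?V = "variation_measure \<mu>"
  note reg = regular_measuresD[OF \<mu>(1)]
  note V = cb_finite_variation_measure[OF reg(2)]
  \<comment> \<open>Passing from \<open>B\<close> to \<open>C B\<close> costs at most \<delta> for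
    each of the \<open>card P\<close> parts, and one further \<delta> is spent on the neighbourhood
    \<open>U - CC\<close>.\<close>
  define \<delta> where "\<delta> = e / (real (card P) + 1)"
  have \<delta>: "0 < \<delta>" "real (card P) * \<delta> + \<delta> = e"
  proof -
    have n: "0 < real (card P) + 1" by linarith
    then show "0 < \<delta>" using e by (simp add: \<delta>_def)
    have "real (card P) * \<delta> + \<delta> = (real (card P) + 1) * \<delta>" by (simp add: distrib_right)
    also have "\<dots> = e" using n by (simp add: \<delta>_def)
    finally show "real (card P) * \<delta> + \<delta> = e" .
  qed
  have "\<exists>C. compact C \<and> C \<subseteq> B \<and> measure ?V (B - C) \<le> \<delta>" if "B \<in> P" for B
    using cb_inner_regularD(2)[OF reg(3) _ \<delta>(1)] P that by auto
  then obtain C where C: "\<And>B. B \<in> P \<Longrightarrow> compact (C B)" "\<And>B. B \<in> P \<Longrightarrow> C B \<subseteq> B"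
      "\<And>B. B \<in> P \<Longrightarrow> measure ?V (B - C B) \<le> \<delta>"
    by metis
  have disj: "C B \<inter> C B' = {}" if "B \<in> P" "B' \<in> P" "B \<noteq> B'" for B B'
    using disjointD[OF P(3) that] C(2)[OF that(1)] C(2)[OF that(2)] by blast
  define CC where "CC = (\<Union>B\<in>P. C B)"
  have CC: "compact CC" using P(1) C(1) by (auto simp: CC_def)
  obtain W L where WL: "open W" "compact L" "CC \<subseteq> W" "W \<subseteq> L"
    using locally_compact_open_hull[OF lc CC] .
  have WCC: "W - CC \<in> compacted_borel"
    using WL CC by (intro cb_subset[OF compact_in_cb[OF WL(2)]]) (auto simp: borel_closed compact_imp_closed)
  \<comment> \<open>Inner regularity of \<open>W - CC\<close> acts as outer regularity of
    \<open>CC\<close>: removing the compact \<open>D\<close> from \<open>W\<close> leaves an open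
    neighbourhood of \<open>CC\<close> with small excess.\<close>
  obtain D where D: "compact D" "D \<subseteq> W - CC" "measure ?V (W - CC - D) \<le> \<delta>"
    using cb_inner_regularD(2)[OF reg(3) WCC \<delta>(1)] by blast
  define U where "U = W - D"
  have U: "open U" "CC \<subseteq> U" "U \<subseteq> L"
    using WL D by (auto simp: U_def compact_imp_closed)
  have UCC: "U - CC \<in> compacted_borel" "measure ?V (U - CC) \<le> \<delta>"
  proof -
    have eq: "U - CC = W - CC - D" by (auto simp: U_def)
    show "measure ?V (U - CC) \<le> \<delta>" unfolding eq by (rule D(3))
    show "U - CC \<in> compacted_borel"
      unfolding eq using D(1) by (intro cb_Diff[OF WCC]) (auto simp: borel_closed compact_imp_closed)
  qed
  \<comment> \<open>Vanishing on the other compact sets leaves a single summand of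
    \<open>\<phi>0\<close> on each \<open>C B\<close>, with value \<open>s B\<close>.\<close>
  define cut where "cut B u \<longleftrightarrow> continuous_on UNIV u \<and> (\<forall>x\<in>C B. u x = 1) \<and>
      (\<forall>x\<in>CC - C B. u x = 0) \<and> (\<forall>x. x \<notin> U \<longrightarrow> u x = 0)" for B and u :: "'g \<Rightarrow> real"
  have "\<exists>u. cut B u" if B: "B \<in> P" for B
  proof -
    let ?R = "\<Union>B'\<in>P - {B}. C B'"
    have "compact ?R" using P(1) C(1) by (intro compact_UN) auto
    then have "open (U - ?R)" using U(1) by (intro open_Diff compact_imp_closed)
    moreover have "C B \<subseteq> U - ?R" using U(2) B disj by (auto simp: CC_def)
    ultimately obtain u :: "'g \<Rightarrow> real" where u: "continuous_on UNIV u"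
        "\<And>x. x \<in> C B \<Longrightarrow> u x = 1" "\<And>x. x \<notin> U - ?R \<Longrightarrow> u x = 0"
      using Urysohn_compact_open[OF lc C(1)[OF B], of "U - ?R"] by metis
    moreover have "x \<notin> U - ?R" if "x \<in> CC - C B" for x using that by (auto simp: CC_def)
    ultimately show ?thesis
      unfolding cut_def by (intro exI[of _ u] conjI ballI allI impI) auto
  qed
  then obtain u where "\<And>B. B \<in> P \<Longrightarrow> cut B (u B)" by metis
  then have u: "\<And>B. B \<in> P \<Longrightarrow> continuous_on UNIV (u B)"
      "\<And>B x. B \<in> P \<Longrightarrow> x \<in> C B \<Longrightarrow> u B x = 1" "\<And>B x. B \<in> P \<Longrightarrow> x \<in> CC - C B \<Longrightarrow> u B x = 0"
      "\<And>B x. B \<in> P \<Longrightarrow> x \<notin> U \<Longrightarrow> u B x = 0"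
    unfolding cut_def by blast+
  \<comment> \<open>Multiplication by \<open>s B\<close> turns \<open>\<mu> (C B)\<close> into its
    modulus. If that value is 0, so is \<open>s B\<close>; hence only modulus at most 1 is
    claimed.\<close>
  define s where "s B = cnj (sgn (\<mu> (C B)))" for B
  have s: "cmod (s B) \<le> 1" "s B * \<mu> (C B) = of_real (cmod (\<mu> (C B)))" for B
  proof -
    show "cmod (s B) \<le> 1" by (simp add: s_def norm_sgn)
    let ?z = "\<mu> (C B)"
    have "s B * ?z = (?z * cnj ?z) / of_real (cmod ?z)"
      by (simp add: s_def sgn_eq)
    also have "\<dots> = of_real (cmod ?z)"
      unfolding complex_norm_square[symmetric] by (simp add: power2_eq_square)
    finally show "s B * ?z = of_real (cmod ?z)" .
  qed
  define \<phi>0 where "\<phi>0 x = (\<Sum>B\<in>P. s B * of_real (u B x))" for x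
  define \<phi> where "\<phi> x = \<phi>0 x / of_real (max 1 (cmod (\<phi>0 x)))" for x
  have cont0: "continuous_on UNIV \<phi>0"
    unfolding \<phi>0_def by (intro continuous_intros u(1))
  have cont: "continuous_on UNIV \<phi>"
    unfolding \<phi>_def by (intro continuous_intros cont0) auto
  have \<phi>1: "cmod (\<phi> x) \<le> 1" for x
    by (auto simp: \<phi>_def norm_divide divide_le_eq_1 max_def)
  have \<phi>_out: "\<phi> x = 0" if "x \<notin> U" for x
    using u(4) that by (simp add: \<phi>_def \<phi>0_def)
  have \<phi>_C: "\<phi> x = s B" if "B \<in> P" "x \<in> C B" for x B
  proof -
    have "u B' x = (if B' = B then 1 else 0)" if "B' \<in> P" for B'
      using u(2,3)[OF that] \<open>B \<in> P\<close> \<open>x \<in> C B\<close> disj[OF that \<open>B \<in> P\<close>] by (auto simp: CC_def)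
    then have "\<phi>0 x = (\<Sum>B'\<in>P. if B' = B then s B' else 0)"
      unfolding \<phi>0_def by (intro sum.cong) auto
    also have "\<dots> = s B" using P(1) that by simp
    finally show ?thesis using s(1)[of B] by (simp add: \<phi>_def max_def)
  qed
  have \<phi>: "\<phi> \<in> C0"
    unfolding C0_iff
  proof (intro conjI cont C0_pos_compact_support[OF continuous_on_norm[OF cont] _ WL(2)])
    show "cmod (\<phi> x) = 0" if "x \<notin> L" for x
      using \<phi>_out[of x] U(3) that by auto
  qed simp
  define \<psi> where "\<psi> x = (\<Sum>B\<in>P. s B * indicator (C B) x)" for x
  have \<psi>: "cb_integrable \<mu> \<psi>" "cb_integral \<mu> \<psi> = of_real (\<Sum>B\<in>P. cmod (\<mu> (C B)))"
  proof -
    have *: "cb_integrable \<mu> (\<lambda>x. s B * indicator (C B) x)"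
        "cb_integral \<mu> (\<lambda>x. s B * indicator (C B) x) = s B * \<mu> (C B)" if "B \<in> P" for B
      using cb_integrable_cmult[OF reg(2) cb_integrable_indicator[OF reg(2) compact_in_cb[OF C(1)[OF that]]]]
      by (simp_all add: cb_integral_indicator[OF reg(2) compact_in_cb[OF C(1)[OF that]]])
    show "cb_integrable \<mu> \<psi>" "cb_integral \<mu> \<psi> = of_real (\<Sum>B\<in>P. cmod (\<mu> (C B)))"
      using cb_integrable_sum[OF reg(2) P(1), of "\<lambda>B x. s B * indicator (C B) x"] *
      unfolding \<psi>_def by (simp_all add: s(2))
  qed
  note \<phi>int = cb_integrable_C0(1)[OF reg(2) \<mu>(2) \<phi>]
  define d where "d x = \<phi> x + (- 1) * \<psi> x" for x
  have d: "cb_integrable \<mu> d" "cb_integral \<mu> d = cb_integral \<mu> \<phi> - cb_integral \<mu> \<psi>"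
    unfolding d_def
    using cb_integrable_add[OF reg(2) \<phi>int cb_integrable_cmult(1)[OF reg(2) \<psi>(1), of "- 1"]]
      cb_integrable_cmult(2)[OF reg(2) \<psi>(1), of "- 1"] by simp_all
  \<comment> \<open>On \<open>CC\<close> both functions equal \<open>s B\<close>, off
    \<open>U\<close> both vanish, and in between the step function is 0 while the test function has
    modulus at most 1.\<close>
  have diff_le: "cmod (d x) \<le> indicator (U - CC) x" for x
  proof (cases "x \<in> CC")
    case True
    then obtain B where B: "B \<in> P" "x \<in> C B" by (auto simp: CC_def)
    have "\<psi> x = (\<Sum>B'\<in>P. if B' = B then s B' else 0)"
      unfolding \<psi>_def using B disj[OF _ B(1)] by (intro sum.cong) (auto simp: indicator_def)
    also have "\<dots> = s B" using P(1) B by simp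
    finally show ?thesis using \<phi>_C[OF B] by (simp add: d_def)
  next
    case False
    then have "\<psi> x = 0" unfolding \<psi>_def by (intro sum.neutral) (auto simp: CC_def)
    then show ?thesis using \<phi>1[of x] \<phi>_out[of x] False by (auto simp: d_def indicator_def)
  qed
  have i: "has_bochner_integral ?V (indicator (U - CC) :: 'g \<Rightarrow> real) (measure ?V (U - CC))"
    using cb_finite_measureD[OF V] UCC(1) by (intro has_bochner_integral_real_indicator) (auto simp: cb_sets)
  have "cmod (cb_integral \<mu> d) \<le> (\<integral>x. cmod (d x) \<partial>?V)"
    using d(1) by (intro cmod_cb_integral_le[OF reg(2)]) (auto simp: cb_integrable_def)
  also have "\<dots> \<le> (\<integral>x. indicator (U - CC) x \<partial>?V)"
    using d(1) i diff_le by (intro integral_mono) (auto simp: cb_integrable_def has_bochner_integral_iff)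
  also have "\<dots> = measure ?V (U - CC)" using i by (simp add: has_bochner_integral_iff)
  finally have close: "cmod (cb_integral \<mu> \<phi> - cb_integral \<mu> \<psi>) \<le> \<delta>"
    using UCC(2) d(2) by simp
  have "(\<Sum>B\<in>P. cmod (\<mu> B)) \<le> (\<Sum>B\<in>P. cmod (\<mu> (C B)) + \<delta>)"
  proof (rule sum_mono)
    fix B assume B: "B \<in> P"
    then have Bcb: "B \<in> compacted_borel" and CB: "C B \<in> sets borel"
      using P(2) C(1)[OF B] by (auto simp: borel_closed compact_imp_closed)
    have "\<mu> (B - C B) = \<mu> B - \<mu> (C B)"
      by (rule cb_additive_Diff[OF reg(2) Bcb CB C(2)[OF B]])
    moreover have "ennreal (cmod (\<mu> (B - C B))) \<le> ennreal (measure ?V (B - C B))"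
      using variation_ge[OF cb_Diff[OF Bcb CB], of \<mu>] emeasure_variation_measure_cb[OF reg(2) cb_Diff[OF Bcb CB]]
        cb_finite_measureD(4)[OF V cb_Diff[OF Bcb CB]] by simp
    then have "cmod (\<mu> (B - C B)) \<le> \<delta>" using C(3)[OF B] by simp
    ultimately show "cmod (\<mu> B) \<le> cmod (\<mu> (C B)) + \<delta>"
      using norm_triangle_ineq[of "\<mu> (C B)" "\<mu> B - \<mu> (C B)"] by simp
  qed
  also have "\<dots> = cmod (cb_integral \<mu> \<psi>) + real (card P) * \<delta>"
    unfolding \<psi>(2) by (simp add: sum.distrib sum_nonneg del: of_real_sum)
  also have "cmod (cb_integral \<mu> \<psi>) \<le> cmod (cb_integral \<mu> \<phi>) + \<delta>"
    using close norm_triangle_ineq2[of "cb_integral \<mu> \<psi>" "cb_integral \<mu> \<phi>"] by (simp add: norm_minus_commute)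
  finally show thesis using \<delta>(2) by (intro that[OF \<phi> \<phi>1]) simp
qed

lemma C0_zero: "(\<lambda>_. 0) \<in> C0"
  by (rule C0_le[OF C0_pos_zero]) auto

text \<open>The upper bound is the estimate of an integral by the variation. For the lower bound,
  every finite partition sum of the variation is, up to \<open>e\<close>, the modulus of an integral
  over a function in the unit ball.\<close>

lemma dual_norm_integral_functional:
  fixes \<mu> :: "'g::t2_space set \<Rightarrow> complex"
  assumes lc: "locally_compact_space (euclidean :: 'g topology)" and "\<mu> \<in> bounded_regular_measures"
  shows "dual_norm C0 sup_norm (integral_functional C0 \<mu>) = measure_norm \<mu>"
proof -
  have \<mu>: "\<mu> \<in> regular_measures" "total_variation \<mu> < \<infinity>"
    using assms(2) by (auto simp: bounded_regular_measures_def)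
  note add = regular_measuresD(2)[OF \<mu>(1)]
  let ?N = "dual_norm C0 sup_norm (integral_functional C0 \<mu>)"
  have le: "cmod (integral_functional C0 \<mu> \<phi>) \<le> measure_norm \<mu>" if \<phi>: "\<phi> \<in> C0" "sup_norm \<phi> \<le> 1" for \<phi>
  proof -
    have "cmod (cb_integral \<mu> \<phi>) \<le> (\<integral>x. cmod (\<phi> x) \<partial>variation_measure \<mu>)"
      using cb_integrable_C0(1)[OF add \<mu>(2) \<phi>(1)]
      by (intro cmod_cb_integral_le[OF add]) (auto simp: cb_integrable_def)
    also have "\<dots> \<le> sup_norm \<phi> * measure_norm \<mu>" by (rule cb_integrable_C0(2)[OF add \<mu>(2) \<phi>(1)])
    also have "\<dots> \<le> measure_norm \<mu>"
      using \<phi> sup_norm_nonneg[OF \<phi>(1)] by (intro mult_left_le_one_le) (auto simp: measure_norm_def)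
    finally show ?thesis using \<phi> by (simp add: integral_functional_def)
  qed
  have z: "(\<lambda>_. 0) \<in> {\<phi> \<in> C0. sup_norm \<phi> \<le> 1}"
    using C0_zero by (auto intro: sup_norm_least)
  have upper: "cmod (integral_functional C0 \<mu> \<phi>) \<le> ?N" if "\<phi> \<in> C0" "sup_norm \<phi> \<le> 1" for \<phi>
    unfolding dual_norm_def using that le by (intro cSUP_upper bdd_aboveI2[of _ _ "measure_norm \<mu>"]) auto
  show ?thesis
  proof (rule antisym)
    show "?N \<le> measure_norm \<mu>"
      unfolding dual_norm_def using z le by (intro cSUP_least) auto
    have N0: "0 \<le> ?N" using upper[of "\<lambda>_. 0"] z norm_ge_zero order_trans by blast
    have "variation \<mu> A \<le> ennreal ?N" if "A \<in> compacted_borel" for A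
      unfolding variation_def
    proof (rule SUP_least, clarify)
      fix P :: "'g set set" assume P: "finite P" "P \<subseteq> compacted_borel" "disjoint P"
      have "(\<Sum>B\<in>P. cmod (\<mu> B)) \<le> ?N"
      proof (rule field_le_epsilon)
        fix e :: real assume "0 < e"
        then obtain \<phi> where \<phi>: "\<phi> \<in> C0" "\<And>x. cmod (\<phi> x) \<le> 1"
            "(\<Sum>B\<in>P. cmod (\<mu> B)) \<le> cmod (cb_integral \<mu> \<phi>) + e"
          using variation_test_function[OF lc \<mu> P] by metis
        have "cmod (cb_integral \<mu> \<phi>) \<le> ?N"
          using upper[OF \<phi>(1) sup_norm_least[OF \<phi>(2)]] \<phi>(1) by (simp add: integral_functional_def)
        then show "(\<Sum>B\<in>P. cmod (\<mu> B)) \<le> ?N + e" using \<phi>(3) by simp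
      qed
      then show "(\<Sum>B\<in>P. ennreal (cmod (\<mu> B))) \<le> ennreal ?N"
        by (simp add: ennreal_leI)
    qed
    then have "total_variation \<mu> \<le> ennreal ?N"
      unfolding total_variation_def by (rule SUP_least)
    then show "measure_norm \<mu> \<le> ?N"
      unfolding measure_norm_def using N0 by (rule enn2real_leI[rotated])
  qed
qed

section \<open>Bounded functionals are integral functionals\<close>

text \<open>The functional \<open>p\<close> is the positive part of \<open>u\<close>. The bound on
  \<open>u\<close> gives \<open>p\<close> the constant \<open>B\<close> and \<open>p - u\<close> the
  constant \<open>2 * B\<close>, so both have Riesz measures.\<close>

lemma real_functional_riesz:
  fixes u :: "('g::t2_space \<Rightarrow> real) \<Rightarrow> real"
  assumes lc: "locally_compact_space (euclidean :: 'g topology)"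
    and add: "\<And>f g. f \<in> C0_pos \<Longrightarrow> g \<in> C0_pos \<Longrightarrow> u (\<lambda>x. f x + g x) = u f + u g"
    and B: "0 \<le> B" and bound: "\<And>f c. f \<in> C0_pos \<Longrightarrow> (\<And>x. f x \<le> c) \<Longrightarrow> \<bar>u f\<bar> \<le> B * c"
  obtains M N where
    "finite_measure M" "cb_inner_regular M" "\<And>f. f \<in> C0_pos \<Longrightarrow> integrable M f"
    "finite_measure N" "cb_inner_regular N" "\<And>f. f \<in> C0_pos \<Longrightarrow> integrable N f"
    "\<And>f. f \<in> C0_pos \<Longrightarrow> u f = (\<integral>x. f x \<partial>M) - (\<integral>x. f x \<partial>N)"
proof -
  define b where "b f = {g \<in> C0_pos. \<forall>x. g x \<le> f x}" for f :: "'g \<Rightarrow> real"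
  define p where "p f = (SUP g\<in>b f. u g)" for f
  have bI: "g \<in> b f" if "g \<in> C0_pos" "\<And>x. g x \<le> f x" for f g using that by (simp add: b_def)
  have bD: "g \<in> C0_pos" "g x \<le> f x" if "g \<in> b f" for f g x using that by (auto simp: b_def)
  have ub: "u g \<le> B * c" if "g \<in> b f" "\<And>x. f x \<le> c" for f g c
    using bound[of g c] bD[OF that(1)] order_trans[OF _ that(2)] by (meson abs_le_D1)
  have bdd: "bdd_above (u ` b f)" if f: "f \<in> C0_pos" for f
  proof -
    obtain c where "\<And>x. f x \<le> c" using C0_pos_bounded[OF f] by metis
    then show ?thesis using ub by (intro bdd_aboveI2) blast
  qed
  have p_upper: "u g \<le> p f" if "f \<in> C0_pos" "g \<in> b f" for f g
    unfolding p_def using that by (intro cSUP_upper bdd)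
  have zero_b: "(\<lambda>_. 0) \<in> b f" if "f \<in> C0_pos" for f
    using C0_posD(2)[OF that] by (intro bI C0_pos_zero)
  have p_least: "p f \<le> c" if "f \<in> C0_pos" "\<And>g. g \<in> b f \<Longrightarrow> u g \<le> c" for f c
    unfolding p_def using that zero_b by (intro cSUP_least) auto
  have u0: "u (\<lambda>_. 0) = 0" using add[OF C0_pos_zero C0_pos_zero] by simp
  have p_nonneg: "0 \<le> p f" if "f \<in> C0_pos" for f
    using p_upper[OF that zero_b[OF that]] u0 by simp
  have p_ge: "u f \<le> p f" if "f \<in> C0_pos" for f
    using that by (intro p_upper bI) auto
  have p_bound: "p f \<le> B * c" if "f \<in> C0_pos" "\<And>x. f x \<le> c" for f c
    using that ub by (intro p_least) blast+
  have p_add: "p (\<lambda>x. f x + g x) = p f + p g" if f: "f \<in> C0_pos" and g: "g \<in> C0_pos" for f g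
  proof (rule antisym)
    note fg = C0_pos_add[OF f g]
    show "p (\<lambda>x. f x + g x) \<le> p f + p g"
    proof (rule p_least[OF fg])
      fix h assume h: "h \<in> b (\<lambda>x. f x + g x)"
      note hC = bD(1)[OF h]
      \<comment> \<open>Riesz decomposition: a function below \<open>f + g\<close> is the sum of its
        minimum with \<open>f\<close> and a remainder, and the remainder lies below
        \<open>g\<close>.\<close>
      have 1: "(\<lambda>x. min (h x) (f x)) \<in> C0_pos" and 2: "(\<lambda>x. h x - min (h x) (f x)) \<in> C0_pos"
        using C0_posD[OF hC] C0_posD[OF f] by (intro C0_pos_le[OF hC] continuous_intros; auto)+
      have "u h = u (\<lambda>x. min (h x) (f x)) + u (\<lambda>x. h x - min (h x) (f x))"
        using add[OF 1 2] by simp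
      also have "\<dots> \<le> p f + p g"
      proof (intro add_mono p_upper f g bI 1 2)
        show "h x - min (h x) (f x) \<le> g x" for x
          using bD(2)[OF h, of x] C0_posD(2)[OF g, of x] by (auto simp: min_def)
      qed simp
      finally show "u h \<le> p f + p g" .
    qed
    have "u g' + u f' \<le> p (\<lambda>x. f x + g x)" if "f' \<in> b f" "g' \<in> b g" for f' g'
    proof -
      have "u (\<lambda>x. f' x + g' x) \<le> p (\<lambda>x. f x + g x)"
        using bD[OF that(1)] bD[OF that(2)] by (intro p_upper fg bI C0_pos_add add_mono)
      then show ?thesis using add[OF bD(1)[OF that(1)] bD(1)[OF that(2)]] by simp
    qed
    \<comment> \<open>The supremum over \<open>g'\<close> is taken with \<open>f'\<close> fixed, and
      the supremum over \<open>f'\<close> afterwards.\<close>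
    then have "p g \<le> p (\<lambda>x. f x + g x) - u f'" if "f' \<in> b f" for f'
      using that by (intro p_least[OF g]) (simp add: le_diff_eq)
    then have "p f \<le> p (\<lambda>x. f x + g x) - p g"
      by (intro p_least[OF f]) (simp add: le_diff_eq diff_le_eq add.commute)
    then show "p f + p g \<le> p (\<lambda>x. f x + g x)" by simp
  qed
  interpret P: C0_positive_functional p B
    by unfold_locales (fact lc p_nonneg p_add B p_bound)+
  interpret Q: C0_positive_functional "\<lambda>f. p f - u f" "2 * B"
  proof (unfold_locales, fact lc)
    show "0 \<le> p f - u f" if "f \<in> C0_pos" for f using p_ge[OF that] by simp
    show "p (\<lambda>x. f x + g x) - u (\<lambda>x. f x + g x) = p f - u f + (p g - u g)"
      if "f \<in> C0_pos" "g \<in> C0_pos" for f g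
      using p_add[OF that] add[OF that] by simp
    show "0 \<le> 2 * B" using B by simp
    show "p f - u f \<le> 2 * B * c" if "f \<in> C0_pos" "\<And>x. f x \<le> c" for f c
      using p_bound[OF that] bound[OF that] by linarith
  qed
  have reg: "cb_inner_regular P.riesz_measure" "cb_inner_regular Q.riesz_measure"
    unfolding cb_inner_regular_def cb_finite_measure_def
    using P.riesz_measure_inner_regular Q.riesz_measure_inner_regular
      finite_measure.emeasure_finite[OF P.finite_riesz_measure]
      finite_measure.emeasure_finite[OF Q.finite_riesz_measure]
    by (auto simp: less_top) metis+
  show thesis
  proof (rule that[of P.riesz_measure Q.riesz_measure])
    show "u f = (\<integral>x. f x \<partial>P.riesz_measure) - (\<integral>x. f x \<partial>Q.riesz_measure)" if "f \<in> C0_pos" for f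
      using P.integral_riesz_measure[OF that] Q.integral_riesz_measure[OF that] by simp
  qed (use reg P.finite_riesz_measure Q.finite_riesz_measure P.integrable_riesz_measure Q.integrable_riesz_measure in auto)
qed

lemma dualD:
  assumes "F \<in> dual V N"
  shows "F \<in> extensional V" "\<And>f g. f \<in> V \<Longrightarrow> g \<in> V \<Longrightarrow> F (\<lambda>x. f x + g x) = F f + F g"
    "\<And>f c. f \<in> V \<Longrightarrow> F (\<lambda>x. c * f x) = c * F f" "\<exists>B. \<forall>f\<in>V. cmod (F f) \<le> B * N f"
proof -
  from assms have F: "F \<in> extensional V \<and>
     (\<forall>f\<in>V. \<forall>g\<in>V. F (\<lambda>x. f x + g x) = F f + F g) \<and>
     (\<forall>c. \<forall>f\<in>V. F (\<lambda>x. c * f x) = c * F f) \<and>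
     (\<exists>B. \<forall>f\<in>V. cmod (F f) \<le> B * N f)"
    unfolding dual_def by (rule CollectD)
  show "F \<in> extensional V" using F by (elim conjE)
  have add: "\<forall>f\<in>V. \<forall>g\<in>V. F (\<lambda>x. f x + g x) = F f + F g" using F by (elim conjE)
  show "F (\<lambda>x. f x + g x) = F f + F g" if "f \<in> V" "g \<in> V" for f g
    by (rule add[rule_format, OF that])
  have cmult: "\<forall>c. \<forall>f\<in>V. F (\<lambda>x. c * f x) = c * F f" using F by (elim conjE)
  show "F (\<lambda>x. c * f x) = c * F f" if "f \<in> V" for f c
    by (rule cmult[rule_format, OF that])
  show "\<exists>B. \<forall>f\<in>V. cmod (F f) \<le> B * N f" using F by (elim conjE)
qed

lemma dual_C0_sum:
  assumes F: "F \<in> dual C0 N" and "finite I" "\<And>i. i \<in> I \<Longrightarrow> f i \<in> C0"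
  shows "(\<lambda>x. \<Sum>i\<in>I. c i * f i x) \<in> C0 \<and> F (\<lambda>x. \<Sum>i\<in>I. c i * f i x) = (\<Sum>i\<in>I. c i * F (f i))"
  using assms(2,3)
proof (induction I rule: finite_induct)
  case empty
  show ?case using C0_zero dualD(3)[OF F C0_zero, of 0] by simp
next
  case (insert i I)
  then show ?case
    using dualD(2)[OF F C0_cmult[of "f i" "c i"], of "\<lambda>x. \<Sum>i\<in>I. c i * f i x"]
    by (simp add: C0_add C0_cmult dualD(3)[OF F])
qed

text \<open>The summand for \<open>j\<close> is the nonnegative component of \<open>z\<close> along
  the axis of \<open>\<i> ^ j\<close>, with the same rotation as in \<open>jordan_part\<close>.
  Applied pointwise it writes a function in \<open>C0\<close> through four members of the
  cone.\<close>

lemma complex_quadrants: "(\<Sum>j<4. \<i> ^ j * of_real (max 0 (Re ((- \<i>) ^ j * z)))) = z"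
proof -
  have m: "max 0 y - max 0 (- y) = y" for y :: real by (simp add: max_def)
  have "(\<Sum>j<4. \<i> ^ j * of_real (max 0 (Re ((- \<i>) ^ j * z)))) =
      of_real (max 0 (Re z) - max 0 (- Re z)) + \<i> * of_real (max 0 (Im z) - max 0 (- Im z))"
    by (simp add: eval_nat_numeral algebra_simps)
  then show ?thesis unfolding m by (simp add: complex_eq_iff)
qed

text \<open>Real and imaginary part of \<open>F\<close>, restricted to the cone, yield two finite
  regular measures each, and their combination defines \<mu>. Splitting a function along the four
  half-axes extends the identity from the cone to \<open>C0\<close> by linearity of
  \<open>F\<close>.\<close>

lemma dual_C0_integral_functional:
  fixes F :: "('g::t2_space \<Rightarrow> complex) \<Rightarrow> complex"
  assumes lc: "locally_compact_space (euclidean :: 'g topology)" and F: "F \<in> dual C0 sup_norm"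
  obtains \<mu> where "\<mu> \<in> bounded_regular_measures" "F = integral_functional C0 \<mu>"
proof -
  obtain B0 where B0: "\<And>f. f \<in> C0 \<Longrightarrow> cmod (F f) \<le> B0 * sup_norm f"
    using dualD(4)[OF F] by auto
  \<comment> \<open>The definition of \<open>dual\<close> puts no sign on its constant, while
    \<open>real_functional_riesz\<close> asks for a nonnegative one.\<close>
  define B where "B = max B0 0"
  have F_le: "cmod (F (\<lambda>x. of_real (f x))) \<le> B * c" if f: "f \<in> C0_pos" "\<And>x. f x \<le> c" for f c
  proof -
    have "cmod (F (\<lambda>x. of_real (f x))) \<le> B0 * sup_norm (\<lambda>x. complex_of_real (f x))"
      by (rule B0[OF C0_of_real[OF f(1)]])
    also have "\<dots> \<le> B * sup_norm (\<lambda>x. complex_of_real (f x))"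
      using sup_norm_nonneg[OF C0_of_real[OF f(1)]] by (intro mult_right_mono) (auto simp: B_def)
    also have "\<dots> \<le> B * c"
      using f C0_posD(2)[OF f(1)] by (intro mult_left_mono sup_norm_least) (auto simp: B_def)
    finally show ?thesis .
  qed
  have F_add: "F (\<lambda>x. of_real (f x + g x)) = F (\<lambda>x. of_real (f x)) + F (\<lambda>x. of_real (g x))"
    if "f \<in> C0_pos" "g \<in> C0_pos" for f g
    using dualD(2)[OF F C0_of_real[OF that(1)] C0_of_real[OF that(2)]] by simp
  obtain M0 M2 where M02: "finite_measure M0" "cb_inner_regular M0" "\<And>f. f \<in> C0_pos \<Longrightarrow> integrable M0 f"
      "finite_measure M2" "cb_inner_regular M2" "\<And>f. f \<in> C0_pos \<Longrightarrow> integrable M2 f"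
      "\<And>f. f \<in> C0_pos \<Longrightarrow> Re (F (\<lambda>x. of_real (f x))) = (\<integral>x. f x \<partial>M0) - (\<integral>x. f x \<partial>M2)"
  proof (rule real_functional_riesz[OF lc, of "\<lambda>f. Re (F (\<lambda>x. of_real (f x)))" B])
    show "\<bar>Re (F (\<lambda>x. of_real (f x)))\<bar> \<le> B * c" if "f \<in> C0_pos" "\<And>x. f x \<le> c" for f c
      using order_trans[OF abs_Re_le_cmod F_le[OF that]] .
  qed (auto simp: F_add B_def simp del: of_real_add)
  obtain M1 M3 where M13: "finite_measure M1" "cb_inner_regular M1" "\<And>f. f \<in> C0_pos \<Longrightarrow> integrable M1 f"
      "finite_measure M3" "cb_inner_regular M3" "\<And>f. f \<in> C0_pos \<Longrightarrow> integrable M3 f"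
      "\<And>f. f \<in> C0_pos \<Longrightarrow> Im (F (\<lambda>x. of_real (f x))) = (\<integral>x. f x \<partial>M1) - (\<integral>x. f x \<partial>M3)"
  proof (rule real_functional_riesz[OF lc, of "\<lambda>f. Im (F (\<lambda>x. of_real (f x)))" B])
    show "\<bar>Im (F (\<lambda>x. of_real (f x)))\<bar> \<le> B * c" if "f \<in> C0_pos" "\<And>x. f x \<le> c" for f c
      using order_trans[OF abs_Im_le_cmod F_le[OF that]] .
  qed (auto simp: F_add B_def simp del: of_real_add)
  \<comment> \<open>The numbering follows \<open>\<i> ^ k\<close>: 0 and 2 come from the real part
    of \<open>F\<close>, 1 and 3 from the imaginary part, the even or odd pair differing by the sign
    -1.\<close>
  define M where "M k = (if k = 0 then M0 else if k = 1 then M1 else if k = 2 then M2 else M3)" for k :: nat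
  have M: "finite_measure (M k)" "cb_inner_regular (M k)" "\<And>f. f \<in> C0_pos \<Longrightarrow> integrable (M k) f" for k
    using M02 M13 by (auto simp: M_def)
  have FM: "F (\<lambda>x. of_real (f x)) = (\<Sum>k<4. \<i> ^ k * of_real (\<integral>x. f x \<partial>M k))" if "f \<in> C0_pos" for f
    using M02(7)[OF that] M13(7)[OF that] by (simp add: M_def eval_nat_numeral complex_eq_iff)
  define \<mu> where "\<mu> = (\<lambda>A\<in>compacted_borel. \<Sum>k<4. \<i> ^ k * complex_of_real (measure (M k) A))"
  have KM: "represents {..<4} (\<lambda>k. \<i> ^ k) M \<mu>"
    using cb_inner_regularD(1)[OF M(2)] by (auto simp: represents_def \<mu>_def)
  have "\<mu> \<in> regular_measures"
    by (rule represents_regular[OF KM M(2)]) (simp add: \<mu>_def)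
  moreover have "total_variation \<mu> < \<infinity>"
    using finite_measure.emeasure_finite[OF M(1)] by (intro represents_bounded[OF KM]) (auto simp: less_top)
  ultimately have \<mu>: "\<mu> \<in> bounded_regular_measures" by (simp add: bounded_regular_measures_def)
  have "F \<phi> = cb_integral \<mu> \<phi>" if \<phi>: "\<phi> \<in> C0" for \<phi>
  proof -
    define q where "q j x = max 0 (Re ((- \<i>) ^ j * \<phi> x))" for j :: nat and x
    have q: "q j \<in> C0_pos" for j
    proof (rule C0_pos_le[OF C0D(2)[OF \<phi>]])
      show "continuous_on UNIV (q j)"
        unfolding q_def by (intro continuous_intros C0D(1)[OF \<phi>])
      show "q j x \<le> cmod (\<phi> x)" for x
        using complex_Re_le_cmod[of "(- \<i>) ^ j * \<phi> x"] by (simp add: q_def norm_mult norm_power)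
    qed (simp add: q_def)
    have \<phi>q: "\<phi> x = (\<Sum>j<4. \<i> ^ j * of_real (q j x))" for x
      unfolding q_def complex_quadrants ..
    have int: "integrable (M k) (\<lambda>x. complex_of_real (q j x))" for j k
      using M(3)[OF q] by (rule integrable_of_real)
    have int\<phi>: "integrable (M k) \<phi>" for k
      unfolding \<phi>q[abs_def] using int by (intro Bochner_Integration.integrable_sum integrable_mult_right)
    have "cb_integral \<mu> \<phi> = (\<Sum>k<4. \<i> ^ k * (\<integral>x. \<phi> x \<partial>M k))"
      by (rule represents_cb_integral[OF KM C0D(3)[OF \<phi>] int\<phi> C0_cb_supported[OF \<phi>]])
    also have "\<dots> = (\<Sum>k<4. \<i> ^ k * (\<Sum>j<4. \<i> ^ j * of_real (\<integral>x. q j x \<partial>M k)))"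
      unfolding \<phi>q using int by (simp add: Bochner_Integration.integral_sum)
    \<comment> \<open>Interchanging the sums collects the four measures behind each
      \<open>q j\<close>, the form in which \<open>FM\<close> applies.\<close>
    also have "\<dots> = (\<Sum>j<4. \<i> ^ j * (\<Sum>k<4. \<i> ^ k * of_real (\<integral>x. q j x \<partial>M k)))"
      unfolding sum_distrib_left by (subst sum.swap) (simp add: mult_ac)
    also have "\<dots> = (\<Sum>j<4. \<i> ^ j * F (\<lambda>x. of_real (q j x)))"
      using FM[OF q] by simp
    also have "\<dots> = F (\<lambda>x. \<Sum>j<4. \<i> ^ j * of_real (q j x))"
      using dual_C0_sum[OF F, of "{..<4}" "\<lambda>j x. of_real (q j x)" "\<lambda>j. \<i> ^ j"] C0_of_real[OF q] by simp
    also have "\<dots> = F \<phi>" unfolding \<phi>q[symmetric] ..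
    finally show ?thesis ..
  qed
  then have "F = integral_functional C0 \<mu>"
    using dualD(1)[OF F] by (intro extensionalityI[of _ C0]) (auto simp: integral_functional_def)
  then show thesis by (rule that[OF \<mu>])
qed

section \<open>The dual of the space of functions vanishing at infinity\<close>

lemma function_space_dual:
  assumes V: "\<And>f g. f \<in> V \<Longrightarrow> g \<in> V \<Longrightarrow> (\<lambda>x. f x + g x) \<in> V"
    "\<And>c f. f \<in> V \<Longrightarrow> (\<lambda>x. c * f x) \<in> V"
  shows "function_space V (dual V N)"
proof -
  have zero: "(\<lambda>f\<in>V. 0) \<in> dual V N"
    unfolding dual_def using V by (auto intro: exI[of _ 0])
  have add: "(\<lambda>f\<in>V. F f + G f) \<in> dual V N" if F: "F \<in> dual V N" and G: "G \<in> dual V N" for F G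
  proof -
    obtain B C where B: "\<And>f. f \<in> V \<Longrightarrow> cmod (F f) \<le> B * N f" and C: "\<And>f. f \<in> V \<Longrightarrow> cmod (G f) \<le> C * N f"
      using dualD(4)[OF F] dualD(4)[OF G] by blast
    have "cmod (F f + G f) \<le> (B + C) * N f" if "f \<in> V" for f
      using norm_triangle_ineq[of "F f" "G f"] B[OF that] C[OF that] by (simp add: distrib_right)
    then have "\<exists>B. \<forall>f\<in>V. cmod ((\<lambda>f\<in>V. F f + G f) f) \<le> B * N f"
      by (intro exI[of _ "B + C"]) simp
    then show ?thesis
      unfolding dual_def using V
      by (simp add: dualD(2)[OF F] dualD(3)[OF F] dualD(2)[OF G] dualD(3)[OF G] distrib_left)
  qed
  have cmult: "(\<lambda>f\<in>V. c * F f) \<in> dual V N" if F: "F \<in> dual V N" for c F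
  proof -
    obtain B where B: "\<And>f. f \<in> V \<Longrightarrow> cmod (F f) \<le> B * N f"
      using dualD(4)[OF F] by blast
    have "cmod (c * F f) \<le> (cmod c * B) * N f" if "f \<in> V" for f
      using mult_left_mono[OF B[OF that] norm_ge_zero[of c]] by (simp add: norm_mult mult.assoc)
    then have "\<exists>B. \<forall>f\<in>V. cmod ((\<lambda>f\<in>V. c * F f) f) \<le> B * N f"
      by (intro exI[of _ "cmod c * B"]) simp
    then show ?thesis
      unfolding dual_def using V
      by (simp add: dualD(2)[OF F] dualD(3)[OF F] distrib_left mult.left_commute)
  qed
  show ?thesis
    unfolding function_space_def using zero add cmult by (auto dest: dualD(1))
qed

lemma isometric_isomorphism_comp:
  assumes T: "isometric_isomorphism D1 E1 N1 D2 E2 N2 T" and S: "isometric_isomorphism D2 E2 N2 D3 E3 N3 S"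
  shows "isometric_isomorphism D1 E1 N1 D3 E3 N3 (\<lambda>f. S (T f))"
proof -
  have bT: "bij_betw T E1 E2" and bS: "bij_betw S E2 E3"
    using T S by (simp_all add: isometric_isomorphism_def)
  have TE: "T f \<in> E2" if "f \<in> E1" for f using bij_betwE[OF bT] that by blast
  have "bij_betw (\<lambda>f. S (T f)) E1 E3"
    using bij_betw_trans[OF bT bS] by (simp add: o_def)
  then show ?thesis
    using T S TE by (simp add: isometric_isomorphism_def)
qed

lemma isometric_isomorphism_cong:
  assumes T: "isometric_isomorphism D E N D' E' N' T" and eq: "\<And>f. f \<in> E \<Longrightarrow> S f = T f"
  shows "isometric_isomorphism D E N D' E' N' S"
proof -
  have fs: "function_space D E" and bij: "bij_betw T E E'"
    using T by (simp_all add: isometric_isomorphism_def)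
  have "bij_betw S E E'" using bij_betw_cong[of E S T E'] eq bij by blast
  then show ?thesis
    using T fs eq unfolding isometric_isomorphism_def function_space_def by simp
qed

section \<open>Linear structure of the regular measures\<close>

lemma bounded_regular_measuresD:
  fixes \<mu> :: "'g::t2_space set \<Rightarrow> complex"
  assumes "\<mu> \<in> bounded_regular_measures"
  shows "\<mu> \<in> regular_measures" "total_variation \<mu> < \<infinity>" "cb_additive \<mu>" "\<mu> \<in> extensional compacted_borel"
  using assms regular_measuresD[of \<mu>] by (auto simp: bounded_regular_measures_def)

text \<open>The Jordan parts of both summands together represent the sum, and each of them is inner
  regular.\<close>

lemma regular_add:
  fixes \<mu> \<nu> :: "'g::t2_space set \<Rightarrow> complex"
  assumes \<mu>: "\<mu> \<in> regular_measures" and \<nu>: "\<nu> \<in> regular_measures"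
  shows "(\<lambda>A\<in>compacted_borel. \<mu> A + \<nu> A) \<in> regular_measures"
  using cb_inner_regular_jordan_part[OF \<mu>] cb_inner_regular_jordan_part[OF \<nu>]
  by (intro represents_regular[OF represents_add[OF
        represents_jordan_part[OF regular_measuresD(2)[OF \<mu>]]
        represents_jordan_part[OF regular_measuresD(2)[OF \<nu>]]]]) auto

lemma regular_cmult:
  fixes \<nu> :: "'g::t2_space set \<Rightarrow> complex"
  assumes \<nu>: "\<nu> \<in> regular_measures"
  shows "(\<lambda>A\<in>compacted_borel. c * \<nu> A) \<in> regular_measures"
  by (rule represents_regular[OF represents_cmult[OF represents_jordan_part[OF regular_measuresD(2)[OF \<nu>]], where c = c]
        cb_inner_regular_jordan_part[OF \<nu>]]) simp_all

lemma jordan_part_bounded: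
  fixes \<mu> :: "'g::t2_space set \<Rightarrow> complex"
  assumes "\<mu> \<in> bounded_regular_measures"
  shows "emeasure (jordan_part \<mu> k) UNIV < \<infinity>"
  using jordan_part_le_variation[of \<mu> UNIV k] bounded_regular_measuresD(2,3)[OF assms]
  by (simp add: emeasure_variation_measure_UNIV le_less_trans)

lemma bounded_regular_add:
  fixes \<mu> \<nu> :: "'g::t2_space set \<Rightarrow> complex"
  assumes \<mu>: "\<mu> \<in> bounded_regular_measures" and \<nu>: "\<nu> \<in> bounded_regular_measures"
  shows "(\<lambda>A\<in>compacted_borel. \<mu> A + \<nu> A) \<in> bounded_regular_measures"
proof -
  note D = bounded_regular_measuresD[OF \<mu>] bounded_regular_measuresD[OF \<nu>]
  have "total_variation (\<lambda>A\<in>compacted_borel. \<mu> A + \<nu> A) < \<infinity>"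
    using jordan_part_bounded[OF \<mu>] jordan_part_bounded[OF \<nu>]
    by (intro represents_bounded[OF represents_add[OF represents_jordan_part[OF D(3)]
          represents_jordan_part[OF D(7)]]]) auto
  then show ?thesis using regular_add[OF D(1,5)] by (simp add: bounded_regular_measures_def)
qed

lemma bounded_regular_cmult:
  fixes \<nu> :: "'g::t2_space set \<Rightarrow> complex"
  assumes \<nu>: "\<nu> \<in> bounded_regular_measures"
  shows "(\<lambda>A\<in>compacted_borel. c * \<nu> A) \<in> bounded_regular_measures"
proof -
  note D = bounded_regular_measuresD[OF \<nu>]
  have "total_variation (\<lambda>A\<in>compacted_borel. c * \<nu> A) < \<infinity>"
    by (rule represents_bounded[OF represents_cmult[OF represents_jordan_part[OF D(3)], where c = c]
          jordan_part_bounded[OF \<nu>]]) simp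
  then show ?thesis using regular_cmult[OF D(1)] by (simp add: bounded_regular_measures_def)
qed

text \<open>The zero measure is the empty combination, so regularity and boundedness hold
  vacuously.\<close>

lemma zero_bounded_regular: "(\<lambda>A\<in>compacted_borel. 0) \<in> (bounded_regular_measures :: ('g::t2_space set \<Rightarrow> complex) set)"
proof -
  have R: "represents ({} :: nat set) (\<lambda>_. 0) (\<lambda>_. null_measure borel) (\<lambda>A\<in>(compacted_borel :: 'g set set). 0)"
    by (simp add: represents_def)
  show ?thesis
    using represents_regular[OF R] represents_bounded[OF R] by (simp add: bounded_regular_measures_def)
qed

lemma function_space_bounded_regular:
  "function_space compacted_borel (bounded_regular_measures :: ('g::t2_space set \<Rightarrow> complex) set)"
  unfolding function_space_def
  by (intro conjI subsetI ballI allI zero_bounded_regular bounded_regular_add bounded_regular_cmult)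
    (rule bounded_regular_measuresD(4))

lemma integral_functional_C0_add:
  fixes \<mu> \<nu> :: "'g::t2_space set \<Rightarrow> complex"
  assumes "\<mu> \<in> bounded_regular_measures" "\<nu> \<in> bounded_regular_measures"
  shows "integral_functional C0 (\<lambda>A\<in>compacted_borel. \<mu> A + \<nu> A) =
    (\<lambda>\<phi>\<in>C0. integral_functional C0 \<mu> \<phi> + integral_functional C0 \<nu> \<phi>)"
  unfolding integral_functional_def
proof (rule restrict_ext)
  fix \<phi> :: "'g \<Rightarrow> complex" assume \<phi>: "\<phi> \<in> C0"
  note D = bounded_regular_measuresD[OF assms(1)] bounded_regular_measuresD[OF assms(2)]
  have "cb_integral (\<lambda>A\<in>compacted_borel. \<mu> A + \<nu> A) \<phi> = cb_integral \<mu> \<phi> + cb_integral \<nu> \<phi>"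
    using cb_integrable_C0(1)[OF D(3,2) \<phi>] cb_integrable_C0(1)[OF D(7,6) \<phi>]
    by (intro cb_integral_measure_add D) (auto simp: cb_integrable_def)
  then show "cb_integral (\<lambda>A\<in>compacted_borel. \<mu> A + \<nu> A) \<phi> =
      (\<lambda>\<phi>\<in>C0. cb_integral \<mu> \<phi>) \<phi> + (\<lambda>\<phi>\<in>C0. cb_integral \<nu> \<phi>) \<phi>"
    using \<phi> by simp
qed

lemma integral_functional_C0_cmult:
  fixes \<nu> :: "'g::t2_space set \<Rightarrow> complex"
  assumes "\<nu> \<in> bounded_regular_measures"
  shows "integral_functional C0 (\<lambda>A\<in>compacted_borel. c * \<nu> A) = (\<lambda>\<phi>\<in>C0. c * integral_functional C0 \<nu> \<phi>)"
  unfolding integral_functional_def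
proof (rule restrict_ext)
  fix \<phi> :: "'g \<Rightarrow> complex" assume \<phi>: "\<phi> \<in> C0"
  note D = bounded_regular_measuresD[OF assms]
  have "cb_integral (\<lambda>A\<in>compacted_borel. c * \<nu> A) \<phi> = c * cb_integral \<nu> \<phi>"
    using cb_integrable_C0(1)[OF D(3,2) \<phi>]
    by (intro cb_integral_measure_cmult D) (auto simp: cb_integrable_def)
  then show "cb_integral (\<lambda>A\<in>compacted_borel. c * \<nu> A) \<phi> = c * (\<lambda>\<phi>\<in>C0. cb_integral \<nu> \<phi>) \<phi>"
    using \<phi> by simp
qed

lemma C0_subset_L1:
  fixes \<mu> :: "'g::t2_space set \<Rightarrow> complex"
  assumes "\<mu> \<in> bounded_regular_measures"
  shows "C0 \<subseteq> L1 \<mu>"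
  using cb_integrable_C0(1)[OF bounded_regular_measuresD(3,2)[OF assms]]
    cb_integral_jordan_part(1)[OF bounded_regular_measuresD(3)[OF assms]]
  by (auto simp: cb_integrable_def)

lemma integral_functional_C0_dual:
  fixes \<mu> :: "'g::t2_space set \<Rightarrow> complex"
  assumes "\<mu> \<in> bounded_regular_measures"
  shows "integral_functional C0 \<mu> \<in> dual C0 sup_norm"
proof -
  note D = bounded_regular_measuresD[OF assms]
  note int = cb_integrable_C0[OF D(3,2)]
  have "cmod (cb_integral \<mu> \<phi>) \<le> measure_norm \<mu> * sup_norm \<phi>" if "\<phi> \<in> C0" for \<phi>
    using order_trans[OF cmod_cb_integral_le[OF D(3)] int(2)[OF that]] int(1)[OF that]
    by (auto simp: cb_integrable_def mult.commute)
  then have "\<exists>B. \<forall>\<phi>\<in>C0. cmod (integral_functional C0 \<mu> \<phi>) \<le> B * sup_norm \<phi>"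
    by (intro exI[of _ "measure_norm \<mu>"]) (simp add: integral_functional_def)
  then show ?thesis
    unfolding dual_def
    using cb_integrable_add(2)[OF D(3) int(1) int(1)] cb_integrable_cmult(2)[OF D(3) int(1)]
    by (simp add: integral_functional_def C0_add C0_cmult)
qed

text \<open>Injectivity comes from the norm formula: if two measures have the same functional, their
  difference has functional 0, hence total variation 0. Surjectivity is
  \<open>dual_C0_integral_functional\<close>.\<close>

theorem isometric_isomorphism_C0:
  assumes lc: "locally_compact_space (euclidean :: 'g::t2_space topology)"
  shows "isometric_isomorphism compacted_borel (bounded_regular_measures :: ('g set \<Rightarrow> complex) set) measure_norm
    C0 (dual C0 sup_norm) (dual_norm C0 sup_norm) (integral_functional C0)"
  unfolding isometric_isomorphism_def
proof (intro conjI ballI allI)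
  let ?I = "integral_functional (C0 :: ('g \<Rightarrow> complex) set)"
  show "bij_betw ?I bounded_regular_measures (dual C0 sup_norm)"
    unfolding bij_betw_def
  proof (intro conjI inj_onI)
    fix \<mu> \<nu> :: "'g set \<Rightarrow> complex"
    assume \<mu>: "\<mu> \<in> bounded_regular_measures" and \<nu>: "\<nu> \<in> bounded_regular_measures" and eq: "?I \<mu> = ?I \<nu>"
    define \<nu>' where "\<nu>' = (\<lambda>A\<in>compacted_borel. - 1 * \<nu> A)"
    define \<kappa> where "\<kappa> = (\<lambda>A\<in>compacted_borel. \<mu> A + \<nu>' A)"
    have \<nu>': "\<nu>' \<in> bounded_regular_measures" unfolding \<nu>'_def by (rule bounded_regular_cmult[OF \<nu>])
    have \<kappa>: "\<kappa> \<in> bounded_regular_measures" unfolding \<kappa>_def by (rule bounded_regular_add[OF \<mu> \<nu>'])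
    have "?I \<nu>' = (\<lambda>\<phi>\<in>C0. - 1 * ?I \<nu> \<phi>)" unfolding \<nu>'_def by (rule integral_functional_C0_cmult[OF \<nu>])
    then have "?I \<kappa> = (\<lambda>\<phi>\<in>C0. 0)"
      unfolding \<kappa>_def integral_functional_C0_add[OF \<mu> \<nu>'] by (intro restrict_ext) (simp add: eq)
    then have "dual_norm C0 sup_norm (?I \<kappa>) \<le> 0"
      unfolding dual_norm_def using C0_zero
      by (intro cSUP_least) (auto intro!: exI[of _ "\<lambda>_. 0"] sup_norm_least)
    then have "enn2real (total_variation \<kappa>) = 0"
      using dual_norm_integral_functional[OF lc \<kappa>] by (simp add: measure_norm_def antisym)
    \<comment> \<open>\<open>enn2real\<close> also sends \<infinity> to 0; the boundedness of
      \<open>\<kappa>\<close> rules that out.\<close>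
    then have tv: "total_variation \<kappa> = 0"
      using bounded_regular_measuresD(2)[OF \<kappa>] by (auto simp: enn2real_eq_0_iff)
    show "\<mu> = \<nu>"
    proof (rule extensionalityI[OF bounded_regular_measuresD(4)[OF \<mu>] bounded_regular_measuresD(4)[OF \<nu>]])
      fix A :: "'g set" assume A: "A \<in> compacted_borel"
      have "ennreal (cmod (\<kappa> A)) \<le> variation \<kappa> A" by (rule variation_ge[OF A])
      also have "\<dots> \<le> total_variation \<kappa>" unfolding total_variation_def by (rule SUP_upper[OF A])
      finally have "\<kappa> A = 0" unfolding tv by simp
      then show "\<mu> A = \<nu> A" using A by (simp add: \<kappa>_def \<nu>'_def)
    qed
  next
    show "?I ` bounded_regular_measures = dual C0 sup_norm"
    proof (intro equalityI subsetI)
      fix F :: "('g \<Rightarrow> complex) \<Rightarrow> complex" assume "F \<in> dual C0 sup_norm"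
      then show "F \<in> ?I ` bounded_regular_measures"
        by (rule dual_C0_integral_functional[OF lc]) simp
    qed (auto intro: integral_functional_C0_dual)
  qed
qed (simp_all add: function_space_bounded_regular function_space_dual C0_add C0_cmult
      integral_functional_C0_add integral_functional_C0_cmult dual_norm_integral_functional[OF lc])

section \<open>Weighted spaces\<close>

locale positive_weight =
  fixes \<omega> :: "'g::t2_space \<Rightarrow> real"
  assumes cont: "continuous_on UNIV \<omega>" and pos: "0 < \<omega> x"
begin

abbreviation "times_weight \<equiv> density_measure (\<lambda>x. complex_of_real (\<omega> x))"
abbreviation "divide_weight \<equiv> density_measure (\<lambda>x. complex_of_real (1 / \<omega> x))"

lemma nz: "\<omega> x \<noteq> 0"
  using pos[of x] by simp

lemma cb_bounded_weight: "cb_bounded \<omega>" "cb_bounded (\<lambda>x. 1 / \<omega> x)"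
  using pos nz by (auto intro!: cb_bounded_continuous continuous_intros cont less_imp_le)

lemma divide_times: "\<nu> \<in> regular_measures \<Longrightarrow> divide_weight (times_weight \<nu>) = \<nu>"
  by (rule density_measure_inverse[OF regular_measuresD(2,1) cb_bounded_weight]) (simp_all add: nz)

lemma times_divide: "\<nu> \<in> regular_measures \<Longrightarrow> times_weight (divide_weight \<nu>) = \<nu>"
  by (rule density_measure_inverse[OF regular_measuresD(2,1) cb_bounded_weight(2,1)]) (simp_all add: nz)

lemma weighted_measuresD:
  assumes "\<nu> \<in> weighted_measures \<omega>"
  shows "\<nu> \<in> regular_measures" "times_weight \<nu> \<in> bounded_regular_measures"
  using assms by (auto simp: weighted_measures_def)

lemma divide_weight_weighted:
  assumes "\<mu> \<in> bounded_regular_measures"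
  shows "divide_weight \<mu> \<in> weighted_measures \<omega>"
proof -
  note \<mu> = bounded_regular_measuresD(1)[OF assms]
  show ?thesis
    unfolding weighted_measures_def mem_Collect_eq times_divide[OF \<mu>]
    by (intro conjI regular_density_measure[OF \<mu> cb_bounded_weight(2)] assms)
qed

end

lemma cb_integrable_density:
  assumes \<nu>: "cb_additive \<nu>" and h: "cb_bounded h" and A: "A \<in> compacted_borel"
  shows "cb_integrable \<nu> (\<lambda>x. of_real (h x) * indicator A x)"
proof -
  have [measurable]: "h \<in> borel_measurable borel" "A \<in> sets borel"
    using h A by (auto simp: cb_bounded_def cb_sets)
  have eq: "(\<lambda>x. complex_of_real (h x) * indicator A x) = (\<lambda>x. of_real (indicator A x * h x))"
    by (auto simp: indicator_def)
  have "integrable (variation_measure \<nu>) (\<lambda>x. complex_of_real (h x) * indicator A x)"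
    unfolding eq
    by (rule integrable_of_real[OF cb_bounded_integrable[OF h cb_finite_variation_measure[OF \<nu>] A]])
  moreover have "cb_supported (\<lambda>x. complex_of_real (h x) * indicator A x)"
    by (rule cb_supported_cb[OF A]) simp
  moreover have "(\<lambda>x. complex_of_real (h x) * indicator A x) \<in> borel_measurable borel" by measurable
  ultimately show ?thesis by (simp add: cb_integrable_def)
qed

lemma density_measure_add:
  assumes \<mu>: "cb_additive \<mu>" and \<nu>: "cb_additive \<nu>" and h: "cb_bounded h"
  shows "density_measure (\<lambda>x. of_real (h x)) (\<lambda>A\<in>compacted_borel. \<mu> A + \<nu> A) =
    (\<lambda>A\<in>compacted_borel. density_measure (\<lambda>x. of_real (h x)) \<mu> A + density_measure (\<lambda>x. of_real (h x)) \<nu> A)"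
proof (rule extensionalityI[of _ compacted_borel])
  fix A :: "'a set" assume A: "A \<in> compacted_borel"
  let ?f = "\<lambda>x. complex_of_real (h x) * indicator A x"
  have "cb_integral (\<lambda>A\<in>compacted_borel. \<mu> A + \<nu> A) ?f = cb_integral \<mu> ?f + cb_integral \<nu> ?f"
    using cb_integrable_density[OF \<mu> h A] cb_integrable_density[OF \<nu> h A]
    by (intro cb_integral_measure_add[OF \<mu> \<nu>]) (auto simp: cb_integrable_def)
  then show "density_measure (\<lambda>x. of_real (h x)) (\<lambda>A\<in>compacted_borel. \<mu> A + \<nu> A) A =
    (\<lambda>A\<in>compacted_borel. density_measure (\<lambda>x. of_real (h x)) \<mu> A + density_measure (\<lambda>x. of_real (h x)) \<nu> A) A"
    using A by (simp add: density_measure_def)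
qed simp_all

lemma density_measure_cmult:
  assumes \<nu>: "cb_additive \<nu>" and h: "cb_bounded h"
  shows "density_measure (\<lambda>x. of_real (h x)) (\<lambda>A\<in>compacted_borel. c * \<nu> A) =
    (\<lambda>A\<in>compacted_borel. c * density_measure (\<lambda>x. of_real (h x)) \<nu> A)"
proof (rule extensionalityI[of _ compacted_borel])
  fix A :: "'a set" assume A: "A \<in> compacted_borel"
  let ?f = "\<lambda>x. complex_of_real (h x) * indicator A x"
  have "cb_integral (\<lambda>A\<in>compacted_borel. c * \<nu> A) ?f = c * cb_integral \<nu> ?f"
    using cb_integrable_density[OF \<nu> h A]
    by (intro cb_integral_measure_cmult[OF \<nu>]) (auto simp: cb_integrable_def)
  then show "density_measure (\<lambda>x. of_real (h x)) (\<lambda>A\<in>compacted_borel. c * \<nu> A) A =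
    (\<lambda>A\<in>compacted_borel. c * density_measure (\<lambda>x. of_real (h x)) \<nu> A) A"
    using A by (simp add: density_measure_def)
qed simp_all

context positive_weight
begin

lemma function_space_weighted: "function_space compacted_borel (weighted_measures \<omega>)"
  unfolding function_space_def
proof (intro conjI ballI allI subsetI)
  show "\<nu> \<in> extensional compacted_borel" if "\<nu> \<in> weighted_measures \<omega>" for \<nu>
    by (rule regular_measuresD(1)[OF weighted_measuresD(1)[OF that]])
  show add: "(\<lambda>A\<in>compacted_borel. \<mu> A + \<nu> A) \<in> weighted_measures \<omega>"
    if "\<mu> \<in> weighted_measures \<omega>" "\<nu> \<in> weighted_measures \<omega>" for \<mu> \<nu>
    using weighted_measuresD[OF that(1)] weighted_measuresD[OF that(2)]
    by (simp add: weighted_measures_def regular_add bounded_regular_add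
        density_measure_add[OF regular_measuresD(2) regular_measuresD(2) cb_bounded_weight(1)])
  show cmult: "(\<lambda>A\<in>compacted_borel. c * \<nu> A) \<in> weighted_measures \<omega>" if "\<nu> \<in> weighted_measures \<omega>" for c \<nu>
    using weighted_measuresD[OF that]
    by (simp add: weighted_measures_def regular_cmult bounded_regular_cmult
        density_measure_cmult[OF regular_measuresD(2) cb_bounded_weight(1)])
  \<comment> \<open>Zero is obtained as 0 times some member; one exists, namely the quotient of the
    bounded zero measure by the weight.\<close>
  show "(\<lambda>A\<in>compacted_borel. 0) \<in> weighted_measures \<omega>"
    using cmult[OF divide_weight_weighted[OF zero_bounded_regular], of 0] by simp
qed

lemma times_weight_isomorphism:
  "isometric_isomorphism compacted_borel (weighted_measures \<omega>) (weighted_measure_norm \<omega>)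
    compacted_borel bounded_regular_measures measure_norm times_weight"
  unfolding isometric_isomorphism_def
proof (intro conjI ballI allI function_space_weighted function_space_bounded_regular)
  show "bij_betw times_weight (weighted_measures \<omega>) bounded_regular_measures"
  proof (rule bij_betw_byWitness[of _ divide_weight])
    show "\<forall>\<nu>\<in>weighted_measures \<omega>. divide_weight (times_weight \<nu>) = \<nu>"
      using divide_times weighted_measuresD(1) by blast
    show "\<forall>\<mu>\<in>bounded_regular_measures. times_weight (divide_weight \<mu>) = \<mu>"
      using times_divide bounded_regular_measuresD(1) by blast
  qed (use weighted_measuresD(2) divide_weight_weighted in auto)
qed (auto simp: weighted_measure_norm_def
      intro!: density_measure_add density_measure_cmult cb_bounded_weight regular_measuresD(2) weighted_measuresD(1))

lemma divide_weight_isomorphism: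
  "isometric_isomorphism compacted_borel bounded_regular_measures measure_norm
    compacted_borel (weighted_measures \<omega>) (weighted_measure_norm \<omega>) divide_weight"
  unfolding isometric_isomorphism_def
proof (intro conjI ballI allI function_space_weighted function_space_bounded_regular)
  show "bij_betw divide_weight bounded_regular_measures (weighted_measures \<omega>)"
  proof (rule bij_betw_byWitness[of _ times_weight])
    show "\<forall>\<nu>\<in>weighted_measures \<omega>. divide_weight (times_weight \<nu>) = \<nu>"
      using divide_times weighted_measuresD(1) by blast
    show "\<forall>\<mu>\<in>bounded_regular_measures. times_weight (divide_weight \<mu>) = \<mu>"
      using times_divide bounded_regular_measuresD(1) by blast
  qed (use weighted_measuresD(2) divide_weight_weighted in auto)
  show "weighted_measure_norm \<omega> (divide_weight \<mu>) = measure_norm \<mu>" if "\<mu> \<in> bounded_regular_measures" for \<mu>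
    unfolding weighted_measure_norm_def times_divide[OF bounded_regular_measuresD(1)[OF that]] ..
qed (intro density_measure_add density_measure_cmult cb_bounded_weight bounded_regular_measuresD(3); assumption)+

lemma C0_weighted_iff: "\<psi> \<in> C0_weighted \<omega> \<longleftrightarrow> (\<lambda>x. \<psi> x / of_real (\<omega> x)) \<in> C0"
  by (simp add: C0_weighted_def)

lemma C0_weighted_times: "\<phi> \<in> C0 \<Longrightarrow> (\<lambda>x. of_real (\<omega> x) * \<phi> x) \<in> C0_weighted \<omega>"
  by (simp add: C0_weighted_iff nz)

lemma C0_weighted_add: "\<phi> \<in> C0_weighted \<omega> \<Longrightarrow> \<psi> \<in> C0_weighted \<omega> \<Longrightarrow> (\<lambda>x. \<phi> x + \<psi> x) \<in> C0_weighted \<omega>"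
  using C0_add by (simp add: C0_weighted_iff add_divide_distrib)

lemma C0_weighted_cmult: "\<psi> \<in> C0_weighted \<omega> \<Longrightarrow> (\<lambda>x. c * \<psi> x) \<in> C0_weighted \<omega>"
  using C0_cmult by (simp add: C0_weighted_iff flip: times_divide_eq_right)

text \<open>With \<phi> = \<psi>/\<omega> in \<open>C0\<close>, integrability of \<phi> for the
  finite measure |\<omega>\<nu>| means integrability of \<psi> for (1/\<omega>)|\<omega>\<nu>|, and
  this measure dominates |\<nu>|. The integral formula then follows by moving the density
  \<omega>.\<close>

lemma weighted_integrable:
  assumes \<nu>: "\<nu> \<in> weighted_measures \<omega>" and \<psi>: "\<psi> \<in> C0_weighted \<omega>"
  shows "cb_integrable \<nu> \<psi>"
    and "cb_integral \<nu> \<psi> = cb_integral (times_weight \<nu>) (\<lambda>x. \<psi> x / of_real (\<omega> x))"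
proof -
  let ?\<phi> = "\<lambda>x. \<psi> x / complex_of_real (\<omega> x)" and ?\<mu> = "times_weight \<nu>"
  note reg = weighted_measuresD(1)[OF \<nu>]
  note \<mu> = bounded_regular_measuresD[OF weighted_measuresD(2)[OF \<nu>]]
  have \<phi>: "?\<phi> \<in> C0" using \<psi> by (simp add: C0_weighted_iff)
  have eq: "(\<lambda>x. of_real (\<omega> x) * ?\<phi> x) = \<psi>" using nz by auto
  have [measurable]: "\<omega> \<in> borel_measurable borel" by (rule borel_measurable_continuous_onI[OF cont])
  have [measurable]: "?\<phi> \<in> borel_measurable borel" by (rule C0D(3)[OF \<phi>])
  have "(\<lambda>x. of_real (\<omega> x) * ?\<phi> x) \<in> borel_measurable borel" by measurable
  then have [measurable]: "\<psi> \<in> borel_measurable borel" unfolding eq .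
  have "integrable (variation_measure ?\<mu>) ?\<phi>"
    using cb_integrable_C0(1)[OF \<mu>(3,2) \<phi>] by (simp add: cb_integrable_def)
  \<comment> \<open>The density 1/\<omega> times \<psi> is \<open>?\<phi>\<close>, so this only
    restates the preceding integrability.\<close>
  then have int: "integrable (density (variation_measure ?\<mu>) (\<lambda>x. 1 / \<omega> x)) \<psi>"
    using pos by (subst integrable_density) (auto simp: scaleR_conv_of_real less_imp_le)
  have "integrable (variation_measure \<nu>) \<psi>"
  proof (rule integrable_measure_mono[OF _ _ int])
    show "emeasure (variation_measure \<nu>) A \<le> emeasure (density (variation_measure ?\<mu>) (\<lambda>x. 1 / \<omega> x)) A"
      if "A \<in> sets (variation_measure \<nu>)" for A
      using variation_density_measure_le[OF \<mu>(3) cb_bounded_weight(2), of A] that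
      unfolding divide_times[OF reg] by simp
  qed simp
  then show *: "cb_integrable \<nu> \<psi>"
    using cb_supported_zero[OF C0_cb_supported[OF \<phi>], of \<psi>] nz by (simp add: cb_integrable_def)
  have "cb_integral ?\<mu> ?\<phi> = cb_integral \<nu> (\<lambda>x. of_real (\<omega> x) * ?\<phi> x)"
  proof (rule cb_integral_density_measure[OF regular_measuresD(2)[OF reg] cb_bounded_weight(1)])
    show "integrable (variation_measure \<nu>) (\<lambda>x. of_real (\<omega> x) * ?\<phi> x)"
      unfolding eq using * by (simp add: cb_integrable_def)
  qed (use \<phi> C0_cb_supported in auto)
  then show "cb_integral \<nu> \<psi> = cb_integral ?\<mu> ?\<phi>" unfolding eq ..
qed

section \<open>Transport of the dual space along the weight\<close>

text \<open>The adjoint of the isometry \<psi> \<mapsto> \<psi>/\<omega> from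
  \<open>C0_weighted\<close> onto \<open>C0\<close>.\<close>

definition dual_times :: "(('g \<Rightarrow> complex) \<Rightarrow> complex) \<Rightarrow> (('g \<Rightarrow> complex) \<Rightarrow> complex)" where
  "dual_times F = (\<lambda>\<psi>\<in>C0_weighted \<omega>. F (\<lambda>x. \<psi> x / of_real (\<omega> x)))"

text \<open>The adjoint of the inverse isometry \<phi> \<mapsto> \<omega>\<phi>.\<close>

definition dual_divide :: "(('g \<Rightarrow> complex) \<Rightarrow> complex) \<Rightarrow> (('g \<Rightarrow> complex) \<Rightarrow> complex)" where
  "dual_divide G = (\<lambda>\<phi>\<in>C0. G (\<lambda>x. of_real (\<omega> x) * \<phi> x))"

lemma sup_norm_weighted_times: "sup_norm_weighted \<omega> (\<lambda>x. of_real (\<omega> x) * \<phi> x) = sup_norm \<phi>"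
  by (simp add: sup_norm_weighted_def nz)

lemma dual_times_dual:
  assumes F: "F \<in> dual C0 sup_norm"
  shows "dual_times F \<in> dual (C0_weighted \<omega>) (sup_norm_weighted \<omega>)"
proof -
  obtain B where B: "\<And>\<phi>. \<phi> \<in> C0 \<Longrightarrow> cmod (F \<phi>) \<le> B * sup_norm \<phi>" using dualD(4)[OF F] by blast
  then have "\<exists>B. \<forall>\<psi>\<in>C0_weighted \<omega>. cmod (dual_times F \<psi>) \<le> B * sup_norm_weighted \<omega> \<psi>"
    by (intro exI[of _ B]) (simp add: dual_times_def C0_weighted_iff sup_norm_weighted_def)
  moreover have "dual_times F (\<lambda>x. f x + g x) = dual_times F f + dual_times F g"
    if "f \<in> C0_weighted \<omega>" "g \<in> C0_weighted \<omega>" for f g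
    using dualD(2)[OF F, of "\<lambda>x. f x / of_real (\<omega> x)" "\<lambda>x. g x / of_real (\<omega> x)"] that C0_weighted_add[OF that]
    by (simp add: dual_times_def add_divide_distrib) (simp add: C0_weighted_iff)
  moreover have "dual_times F (\<lambda>x. c * f x) = c * dual_times F f" if "f \<in> C0_weighted \<omega>" for f c
    using dualD(3)[OF F, of "\<lambda>x. f x / of_real (\<omega> x)" c] that C0_weighted_cmult[OF that, of c]
    by (simp add: dual_times_def) (simp add: C0_weighted_iff)
  moreover have "dual_times F \<in> extensional (C0_weighted \<omega>)" by (simp add: dual_times_def)
  ultimately show ?thesis unfolding dual_def by blast
qed

lemma dual_divide_dual:
  assumes G: "G \<in> dual (C0_weighted \<omega>) (sup_norm_weighted \<omega>)"
  shows "dual_divide G \<in> dual C0 sup_norm"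
proof -
  obtain B where B: "\<And>\<psi>. \<psi> \<in> C0_weighted \<omega> \<Longrightarrow> cmod (G \<psi>) \<le> B * sup_norm_weighted \<omega> \<psi>"
    using dualD(4)[OF G] by blast
  have "\<exists>B. \<forall>\<phi>\<in>C0. cmod (dual_divide G \<phi>) \<le> B * sup_norm \<phi>"
    using B[OF C0_weighted_times] by (intro exI[of _ B]) (simp add: dual_divide_def sup_norm_weighted_times)
  moreover have "dual_divide G (\<lambda>x. f x + g x) = dual_divide G f + dual_divide G g"
    if "f \<in> C0" "g \<in> C0" for f g
    using dualD(2)[OF G C0_weighted_times[OF that(1)] C0_weighted_times[OF that(2)]] that C0_add[OF that]
    by (simp add: dual_divide_def distrib_left)
  moreover have "dual_divide G (\<lambda>x. c * f x) = c * dual_divide G f" if "f \<in> C0" for f c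
    using dualD(3)[OF G C0_weighted_times[OF that], of c] that C0_cmult[OF that, of c]
    by (simp add: dual_divide_def mult.left_commute)
  moreover have "dual_divide G \<in> extensional C0" by (simp add: dual_divide_def)
  ultimately show ?thesis unfolding dual_def by blast
qed

lemma dual_divide_times: "F \<in> dual C0 sup_norm \<Longrightarrow> dual_divide (dual_times F) = F"
  by (rule extensionalityI[OF _ dualD(1)])
    (auto simp: dual_divide_def dual_times_def C0_weighted_times nz)

lemma dual_times_divide:
  "G \<in> dual (C0_weighted \<omega>) (sup_norm_weighted \<omega>) \<Longrightarrow> dual_times (dual_divide G) = G"
  by (rule extensionalityI[OF _ dualD(1)])
    (auto simp: dual_divide_def dual_times_def C0_weighted_iff nz)

text \<open>Multiplication by \<omega> maps the unit ball of \<open>C0\<close> onto that of the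
  weighted space, so both suprema run over the same numbers.\<close>

lemma dual_norm_times:
  "dual_norm (C0_weighted \<omega>) (sup_norm_weighted \<omega>) (dual_times F) = dual_norm C0 sup_norm F"
proof -
  have "{\<psi> \<in> C0_weighted \<omega>. sup_norm_weighted \<omega> \<psi> \<le> 1} =
      (\<lambda>\<phi> x. of_real (\<omega> x) * \<phi> x) ` {\<phi> \<in> C0. sup_norm \<phi> \<le> 1}" (is "?L = ?R")
  proof (intro equalityI subsetI)
    fix \<psi> assume "\<psi> \<in> ?L"
    then show "\<psi> \<in> ?R"
      by (intro image_eqI[of _ _ "\<lambda>x. \<psi> x / of_real (\<omega> x)"])
        (auto simp: C0_weighted_iff sup_norm_weighted_def nz)
  qed (auto simp: C0_weighted_times sup_norm_weighted_times)
  then have "dual_norm (C0_weighted \<omega>) (sup_norm_weighted \<omega>) (dual_times F) =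
      (SUP \<phi>\<in>{\<phi> \<in> C0. sup_norm \<phi> \<le> 1}. cmod (dual_times F (\<lambda>x. of_real (\<omega> x) * \<phi> x)))"
    unfolding dual_norm_def by (simp add: image_image)
  also have "\<dots> = dual_norm C0 sup_norm F"
    unfolding dual_norm_def by (intro SUP_cong refl) (simp add: dual_times_def C0_weighted_times nz)
  finally show ?thesis .
qed

lemma dual_times_isomorphism:
  "isometric_isomorphism C0 (dual C0 sup_norm) (dual_norm C0 sup_norm)
    (C0_weighted \<omega>) (dual (C0_weighted \<omega>) (sup_norm_weighted \<omega>))
    (dual_norm (C0_weighted \<omega>) (sup_norm_weighted \<omega>)) dual_times"
  unfolding isometric_isomorphism_def
proof (intro conjI ballI allI)
  show "bij_betw dual_times (dual C0 sup_norm) (dual (C0_weighted \<omega>) (sup_norm_weighted \<omega>))"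
    by (rule bij_betw_byWitness[of _ dual_divide])
      (auto intro: dual_divide_times dual_times_divide dual_times_dual dual_divide_dual)
  show "dual_times (\<lambda>\<phi>\<in>C0. F \<phi> + G \<phi>) = (\<lambda>\<psi>\<in>C0_weighted \<omega>. dual_times F \<psi> + dual_times G \<psi>)" for F G
    unfolding dual_times_def by (intro restrict_ext) (simp add: C0_weighted_iff)
  show "dual_times (\<lambda>\<phi>\<in>C0. c * F \<phi>) = (\<lambda>\<psi>\<in>C0_weighted \<omega>. c * dual_times F \<psi>)" for c F
    unfolding dual_times_def by (intro restrict_ext) (simp add: C0_weighted_iff)
qed (simp_all add: function_space_dual C0_add C0_cmult C0_weighted_add C0_weighted_cmult dual_norm_times)

text \<open>Integration against \<nu> factors through \<nu> \<mapsto> \<omega>\<nu>, integration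
  over \<open>C0\<close>, and an adjoint. The weighted duality is thereby a composition of three
  isometric isomorphisms.\<close>

lemma integral_functional_weighted:
  "\<nu> \<in> weighted_measures \<omega> \<Longrightarrow>
    integral_functional (C0_weighted \<omega>) \<nu> = dual_times (integral_functional C0 (times_weight \<nu>))"
  unfolding integral_functional_def dual_times_def
  by (rule restrict_ext) (simp add: weighted_integrable(2), simp add: C0_weighted_iff)

lemma integral_functional_weighted_isomorphism:
  assumes lc: "locally_compact_space (euclidean :: 'g topology)"
  shows "isometric_isomorphism compacted_borel (weighted_measures \<omega>) (weighted_measure_norm \<omega>)
    (C0_weighted \<omega>) (dual (C0_weighted \<omega>) (sup_norm_weighted \<omega>))
    (dual_norm (C0_weighted \<omega>) (sup_norm_weighted \<omega>)) (integral_functional (C0_weighted \<omega>))"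
  by (rule isometric_isomorphism_cong[OF isometric_isomorphism_comp[OF isometric_isomorphism_comp[OF
        times_weight_isomorphism isometric_isomorphism_C0[OF lc]] dual_times_isomorphism]
        integral_functional_weighted])

lemma C0_weighted_subset_L1:
  assumes \<nu>: "\<nu> \<in> weighted_measures \<omega>"
  shows "C0_weighted \<omega> \<subseteq> L1 \<nu>"
proof
  fix \<psi> assume "\<psi> \<in> C0_weighted \<omega>"
  then show "\<psi> \<in> L1 \<nu>"
    using weighted_integrable(1)[OF \<nu>] regular_measuresD(2)[OF weighted_measuresD(1)[OF \<nu>]]
    by (auto simp: cb_integrable_def intro: cb_integral_jordan_part(1))
qed

end

section \<open>Weak-star continuity\<close>

lemma topspace_weak_star [simp]: "topspace (weak_star V N) = dual V N"
  using dualD(1) by (auto simp: weak_star_def PiE_def)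

text \<open>Continuity into a product is tested coordinatewise, and the coordinate of
  \<open>T F\<close> at \<open>g\<close> is the evaluation of \<open>F\<close> at
  \<open>t g\<close>. This is why adjoint maps are weak-star continuous.\<close>

lemma continuous_map_weak_star:
  assumes dual: "\<And>F. F \<in> dual V N \<Longrightarrow> T F \<in> dual W M"
    and eval: "\<And>F g. F \<in> dual V N \<Longrightarrow> g \<in> W \<Longrightarrow> T F g = F (t g)"
    and t: "\<And>g. g \<in> W \<Longrightarrow> t g \<in> V"
  shows "continuous_map (weak_star V N) (weak_star W M) T"
  unfolding weak_star_def[of W M]
proof (rule continuous_map_into_subtopology)
  show "T \<in> topspace (weak_star V N) \<rightarrow> dual W M" using dual by simp
  show "continuous_map (weak_star V N) (product_topology (\<lambda>_. euclidean) W) T"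
    unfolding continuous_map_componentwise
  proof (intro conjI ballI)
    show "T ` topspace (weak_star V N) \<subseteq> extensional W"
      using dualD(1)[OF dual] by auto
    fix g assume g: "g \<in> W"
    have "continuous_map (weak_star V N) euclidean (\<lambda>F. F (t g))"
      unfolding weak_star_def
      by (intro continuous_map_from_subtopology continuous_map_product_projection t g)
    then show "continuous_map (weak_star V N) euclidean (\<lambda>F. T F g)"
      by (rule continuous_map_eq) (simp add: eval g)
  qed
qed

text \<open>Both topologies on measures are pulled back along integration, so continuity of
  \<open>D\<close> is read off from a commuting square whose opposite side is the map
  \<open>R\<close> between the dual spaces.\<close>

lemma continuous_map_measures_weak_star:
  assumes R: "continuous_map (weak_star V N) (weak_star W M) R"
    and D: "\<And>\<nu>. \<nu> \<in> E \<Longrightarrow> D \<nu> \<in> E'"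
    and eq: "\<And>\<nu>. \<nu> \<in> E \<Longrightarrow> integral_functional W (D \<nu>) = R (integral_functional V \<nu>)"
  shows "continuous_map (measures_weak_star V N E) (measures_weak_star W M E') D"
  unfolding measures_weak_star_def[of W M E']
proof (rule continuous_map_pullback')
  have "continuous_map (measures_weak_star V N E) (weak_star W M) (R \<circ> integral_functional V)"
    unfolding measures_weak_star_def by (rule continuous_map_pullback[OF R])
  then show "continuous_map (measures_weak_star V N E) (weak_star W M) (integral_functional W \<circ> D)"
    by (rule continuous_map_eq) (simp add: measures_weak_star_def topspace_pullback_topology eq)
  show "topspace (measures_weak_star V N E) \<subseteq> D -` E'"
    using D by (auto simp: measures_weak_star_def topspace_pullback_topology)
qed

text \<open>Under the identifications \<open>times_weight\<close> corresponds to
  \<open>dual_divide\<close> and \<open>divide_weight\<close> to \<open>dual_times\<close>: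
  multiplying the measure by \<omega> amounts to multiplying the argument of the functional by
  \<omega>. Both maps of functionals are adjoints.\<close>

lemma (in positive_weight) homeomorphic_maps_weak_star:
  "homeomorphic_maps
    (measures_weak_star (C0_weighted \<omega>) (sup_norm_weighted \<omega>) (weighted_measures \<omega>))
    (measures_weak_star C0 sup_norm bounded_regular_measures) times_weight divide_weight"
  unfolding homeomorphic_maps_def
proof (intro conjI ballI)
  have I: "integral_functional C0 (times_weight \<nu>) \<in> dual C0 sup_norm" if "\<nu> \<in> weighted_measures \<omega>" for \<nu>
    by (rule integral_functional_C0_dual[OF weighted_measuresD(2)[OF that]])
  show "continuous_map (measures_weak_star (C0_weighted \<omega>) (sup_norm_weighted \<omega>) (weighted_measures \<omega>))
      (measures_weak_star C0 sup_norm bounded_regular_measures) times_weight"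
  proof (rule continuous_map_measures_weak_star[OF continuous_map_weak_star])
    show "dual_divide G \<in> dual C0 sup_norm" if "G \<in> dual (C0_weighted \<omega>) (sup_norm_weighted \<omega>)" for G
      by (rule dual_divide_dual[OF that])
    show "dual_divide G \<phi> = G (\<lambda>x. of_real (\<omega> x) * \<phi> x)" if "\<phi> \<in> C0" for G \<phi>
      using that by (simp add: dual_divide_def)
    show "integral_functional C0 (times_weight \<nu>) = dual_divide (integral_functional (C0_weighted \<omega>) \<nu>)"
      if "\<nu> \<in> weighted_measures \<omega>" for \<nu>
      using that by (simp add: integral_functional_weighted dual_divide_times I)
  qed (simp_all add: C0_weighted_times weighted_measuresD(2))
  show "continuous_map (measures_weak_star C0 sup_norm bounded_regular_measures)
      (measures_weak_star (C0_weighted \<omega>) (sup_norm_weighted \<omega>) (weighted_measures \<omega>)) divide_weight"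
  proof (rule continuous_map_measures_weak_star[OF continuous_map_weak_star])
    show "dual_times F \<in> dual (C0_weighted \<omega>) (sup_norm_weighted \<omega>)" if "F \<in> dual C0 sup_norm" for F
      by (rule dual_times_dual[OF that])
    show "dual_times F \<psi> = F (\<lambda>x. \<psi> x / of_real (\<omega> x))" if "\<psi> \<in> C0_weighted \<omega>" for F \<psi>
      using that by (simp add: dual_times_def)
    show "integral_functional (C0_weighted \<omega>) (divide_weight \<mu>) = dual_times (integral_functional C0 \<mu>)"
      if "\<mu> \<in> bounded_regular_measures" for \<mu>
      using integral_functional_weighted[OF divide_weight_weighted[OF that]]
      unfolding times_divide[OF bounded_regular_measuresD(1)[OF that]] .
    show "divide_weight \<mu> \<in> weighted_measures \<omega>" if "\<mu> \<in> bounded_regular_measures" for \<mu>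
      by (rule divide_weight_weighted[OF that])
  qed (simp_all add: C0_weighted_iff)
  show "divide_weight (times_weight \<nu>) = \<nu>"
    if "\<nu> \<in> topspace (measures_weak_star (C0_weighted \<omega>) (sup_norm_weighted \<omega>) (weighted_measures \<omega>))" for \<nu>
    using that by (intro divide_times weighted_measuresD(1)) (simp add: measures_weak_star_def topspace_pullback_topology)
  show "times_weight (divide_weight \<mu>) = \<mu>"
    if "\<mu> \<in> topspace (measures_weak_star C0 sup_norm bounded_regular_measures)" for \<mu>
    using that by (intro times_divide bounded_regular_measuresD(1)) (simp add: measures_weak_star_def topspace_pullback_topology)
qed

text \<open>The inclusions in \<open>L1\<close> are part of the claim because
  \<open>cb_integral\<close> is a definite description, which has some value for every function;
  they ensure that the pairing is a genuine integral.\<close>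

theorem proposition1p3:
  fixes \<omega> :: "'g::{topological_group_add, t2_space} \<Rightarrow> real"
  assumes "locally_compact_space (euclidean :: 'g topology)"
    and "weight \<omega>"
  shows
    "(\<forall>\<nu>\<in>weighted_measures \<omega>.
        C0_weighted \<omega> \<subseteq> L1 \<nu> \<and>
        integral_functional (C0_weighted \<omega>) \<nu> \<in> dual (C0_weighted \<omega>) (sup_norm_weighted \<omega>) \<and>
        dual_norm (C0_weighted \<omega>) (sup_norm_weighted \<omega>) (integral_functional (C0_weighted \<omega>) \<nu>)
          = weighted_measure_norm \<omega> \<nu>) \<and>
     dual (C0_weighted \<omega>) (sup_norm_weighted \<omega>)
       = integral_functional (C0_weighted \<omega>) ` weighted_measures \<omega> \<and>
     isometric_isomorphism
       compacted_borel (weighted_measures \<omega>) (weighted_measure_norm \<omega>)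
       (C0_weighted \<omega>) (dual (C0_weighted \<omega>) (sup_norm_weighted \<omega>))
       (dual_norm (C0_weighted \<omega>) (sup_norm_weighted \<omega>))
       (integral_functional (C0_weighted \<omega>)) \<and>
     (\<forall>\<mu>\<in>(bounded_regular_measures :: ('g set \<Rightarrow> complex) set). C0 \<subseteq> L1 \<mu>) \<and>
     isometric_isomorphism
       compacted_borel (bounded_regular_measures :: ('g set \<Rightarrow> complex) set) measure_norm
       C0 (dual C0 sup_norm) (dual_norm C0 sup_norm)
       (integral_functional C0) \<and>
     isometric_isomorphism
       compacted_borel (weighted_measures \<omega>) (weighted_measure_norm \<omega>)
       compacted_borel bounded_regular_measures measure_norm
       (density_measure (\<lambda>x. of_real (\<omega> x))) \<and>
     isometric_isomorphism
       compacted_borel bounded_regular_measures measure_norm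
       compacted_borel (weighted_measures \<omega>) (weighted_measure_norm \<omega>)
       (density_measure (\<lambda>x. of_real (1 / \<omega> x))) \<and>
     (\<forall>\<nu>\<in>weighted_measures \<omega>.
        density_measure (\<lambda>x. of_real (1 / \<omega> x)) (density_measure (\<lambda>x. of_real (\<omega> x)) \<nu>) = \<nu>) \<and>
     (\<forall>\<mu>\<in>bounded_regular_measures.
        density_measure (\<lambda>x. of_real (\<omega> x)) (density_measure (\<lambda>x. of_real (1 / \<omega> x)) \<mu>) = \<mu>) \<and>
     homeomorphic_maps
       (measures_weak_star (C0_weighted \<omega>) (sup_norm_weighted \<omega>) (weighted_measures \<omega>))
       (measures_weak_star C0 sup_norm bounded_regular_measures)
       (density_measure (\<lambda>x. of_real (\<omega> x)))
       (density_measure (\<lambda>x. of_real (1 / \<omega> x)))"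
proof -
  interpret positive_weight \<omega>
    using assms(2) by unfold_locales (auto simp: weight_def)
  note iso = integral_functional_weighted_isomorphism[OF assms(1)]
  have image: "integral_functional (C0_weighted \<omega>) ` weighted_measures \<omega> =
      dual (C0_weighted \<omega>) (sup_norm_weighted \<omega>)"
    using iso by (simp add: isometric_isomorphism_def bij_betw_def)
  have norm: "dual_norm (C0_weighted \<omega>) (sup_norm_weighted \<omega>) (integral_functional (C0_weighted \<omega>) \<nu>)
      = weighted_measure_norm \<omega> \<nu>" if "\<nu> \<in> weighted_measures \<omega>" for \<nu>
    using iso that by (simp add: isometric_isomorphism_def)
  show ?thesis
    by (intro conjI ballI C0_weighted_subset_L1 norm iso image[symmetric] C0_subset_L1
        isometric_isomorphism_C0[OF assms(1)] times_weight_isomorphism divide_weight_isomorphism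
        divide_times times_divide homeomorphic_maps_weak_star weighted_measuresD(1) bounded_regular_measuresD(1))
      (use image in auto)
qed

end
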